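(* Let $n\ge1$ and let $A$ and $B$ be two open symmetric convex subsets of $\mathbb{R}^n$ such that neither of them is equal to $\mathbb{R}^n$. Then $$\lambda_1(A\cap B)\ \le\ \lambda_1(A)+\lambda_1(B).$$
   Context: A set $A\subseteq\mathbb{R}^n$ is symmetric if $A=-A$. For an open set $D\subseteq\mathbb{R}^n$, $\lambda_1(D)$ denotes the spectral gap (bottom of the spectrum) of the Laplacian on $D$ with Dirichlet boundary condition, i.e. $\lambda_1(D)=\inf\{\int_D|\nabla f|^2dx : f\in C_c^\infty(D),\ \int_D f^2dx=1\}$ (with $\inf\emptyset=+\infty$). For bounded $D$ it is the first eigenvalue of $-\Delta$ on $D$ with Dirichlet boundary condition. *)

theory Defs
  imports "HOL-Analysis.Analysis"
begin

text \<open>Class \<open>C\<^sup>k\<close> on the whole space: all iterated directional derivatives up to order \<open>k\<close>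
  exist (as values of Frechet derivatives) and are continuous.\<close>

primrec C_diff :: "nat \<Rightarrow> ('a::real_normed_vector \<Rightarrow> 'b::real_normed_vector) \<Rightarrow> bool" where
  "C_diff 0 f \<longleftrightarrow> continuous_on UNIV f"
| "C_diff (Suc k) f \<longleftrightarrow>
     (\<forall>x. f differentiable (at x)) \<and> (\<forall>v. C_diff k (\<lambda>x. frechet_derivative f (at x) v))"

definition smooth :: "('a::real_normed_vector \<Rightarrow> 'b::real_normed_vector) \<Rightarrow> bool" where
  "smooth f \<longleftrightarrow> (\<forall>k. C_diff k f)"

text \<open>The space \<open>C\<^sub>c\<^sup>\<infinity>(D)\<close> for open \<open>D\<close>, with its elements extended by \<open>0\<close> outside \<open>D\<close>.\<close>

definition test_functions :: "'a::euclidean_space set \<Rightarrow> ('a \<Rightarrow> real) set" where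
  "test_functions D =
     {f. smooth f \<and> compact (closure {x. f x \<noteq> 0}) \<and> closure {x. f x \<noteq> 0} \<subseteq> D}"

definition gradient :: "('a::euclidean_space \<Rightarrow> real) \<Rightarrow> 'a \<Rightarrow> 'a" where
  "gradient f x = (\<Sum>b\<in>Basis. frechet_derivative f (at x) b *\<^sub>R b)"

lemma GDERIV_gradient:
  assumes "f differentiable (at x)"
  shows "GDERIV f x :> gradient f x"
proof -
  have der: "(f has_derivative frechet_derivative f (at x)) (at x)"
    using assms by (simp add: frechet_derivative_works)
  have "frechet_derivative f (at x) h = inner h (gradient f x)" for h
  proof -
    interpret linear "frechet_derivative f (at x)"
      using der by (rule has_derivative_linear)
    have "frechet_derivative f (at x) h
        = frechet_derivative f (at x) (\<Sum>b\<in>Basis. inner h b *\<^sub>R b)"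
      by (simp add: euclidean_representation)
    also have "\<dots> = inner h (gradient f x)"
      by (simp add: sum scaleR gradient_def inner_sum_right mult.commute)
    finally show ?thesis .
  qed
  then have "frechet_derivative f (at x) = (\<lambda>h. inner h (gradient f x))"
    by (rule ext)
  with der show ?thesis
    by (simp add: gderiv_def)
qed

text \<open>The bottom of the Dirichlet spectrum of the Laplacian on an open set \<open>D\<close>. It takes values in
  the extended reals, so that the infimum over the empty set (when \<open>D = {}\<close>) is \<open>\<infinity>\<close>.\<close>

definition lambda1 :: "'a::euclidean_space set \<Rightarrow> ereal" where
  "lambda1 D =
     Inf {ereal (LINT x:D|lborel. (norm (gradient f x))\<^sup>2) | f.
            f \<in> test_functions D \<and> (LINT x:D|lborel. (f x)\<^sup>2) = 1}"

end

theory Submission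
  imports Defs
begin

text \<open>Replace \<open>-\<Delta>\<close> on an open set \<open>K\<close> by the compression \<open>T\<^sub>K w = 1\<^sub>K (k * w)\<close> of the convolution with the
  uniform density \<open>k\<close> of a small ball.  The deficit \<open>1 - \<langle>w, T\<^sub>K w\<rangle>\<close> of a unit vector \<open>w\<close> is half the average
  of \<open>\<parallel>w - w(\<cdot> - h)\<parallel>\<^sup>2\<close> over the ball.  Averaging over all translations \<open>x\<close> as in Lieb's theorem on the
  intersection of two domains, some normalized product \<open>f(y) g(y - x)\<close> of test functions of \<open>A\<close> and \<open>B\<close>
  has a deficit that exceeds the sum of the deficits of \<open>f\<close> and \<open>g\<close> by arbitrarily little; it lives on
  \<open>K\<^sub>x = A \<inter> (B + x)\<close>.  By the Prekopa-Leindler inequality, \<open>\<langle>1, T\<^sub>K\<^sup>n 1\<rangle>\<close> for \<open>K = K\<^sub>x\<close> does not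
  exceed the same moment for \<open>K\<^sub>0 = A \<inter> B\<close>, because \<open>K\<^sub>-\<^sub>x = - K\<^sub>x\<close> and \<open>(K\<^sub>x + K\<^sub>-\<^sub>x)/2 \<subseteq> K\<^sub>0\<close>;
  letting \<open>n \<rightarrow> \<infinity>\<close> carries the deficit over to a function on \<open>A \<inter> B\<close>.  Mollifying this function at a scale \<open>\<eta>\<close> much larger than the radius of the
  ball costs a factor \<open>1 + O(\<eta>)\<close> and turns the translation differences into the Dirichlet energy.\<close>

text \<open>The averaging over translations selects some x that cannot be prescribed; symmetry and
  convexity enter to bring the bound back from x to 0. This comparison is made on moments because
  they are iterated integrals of nonnegative kernels, which Prekopa-Leindler can handle, whereas a
  Rayleigh quotient is not of that form. With a bounded operator in place of the Laplacian, no
  eigenfunction, semigroup or limit has to be produced: one suitable iterate already yields a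
  function on A \<inter> B. The ball serves three purposes: its indicator is even
  (self-adjointness), log-concave (Prekopa-Leindler) and isotropic (averaged translation differences
  see the whole gradient). In the final argument the kernel is the plain indicator, with mass S in
  place of 1. The function found on A \<inter> B is only bounded and measurable and depends on the
  radius \<delta>, so every estimate that restricts \<delta> must be uniform in that function. The
  scale \<eta> is fixed first, and \<delta> = \<eta>/N lets N small steps add up to one step of size
  \<eta>.\<close>

section \<open>The Prekopa-Leindler inequality\<close>

lemma emeasure_lborel_affine_image:
  fixes S :: "real set"
  assumes "S \<in> sets borel"
  shows "(\<lambda>x. x / 2 + c) ` S \<in> sets borel"
    and "emeasure lborel ((\<lambda>x. x / 2 + c) ` S) = emeasure lborel S / 2"
proof -
  have eq: "(\<lambda>x. x / 2 + c) ` S = (\<lambda>y. 2 * (y - c)) -` S"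
    by (auto simp: image_iff field_simps intro!: bexI[where x="2 * (_ - c)"])
  show 1: "(\<lambda>x. x / 2 + c) ` S \<in> sets borel"
    unfolding eq using assms by (rule measurable_sets_borel[rotated]) auto
  have "emeasure lborel S = (\<integral>\<^sup>+x. indicator S x \<partial>lborel)"
    using assms by simp
  also have "\<dots> = 2 * (\<integral>\<^sup>+y. indicator S (- 2 * c + 2 * y) \<partial>lborel)"
    using assms by (subst nn_integral_real_affine[where c=2 and t="-2*c"]) auto
  also have "(\<lambda>y. indicator S (- 2 * c + 2 * y) :: ennreal) = indicator ((\<lambda>x. x / 2 + c) ` S)"
    unfolding eq by (auto simp: indicator_def fun_eq_iff algebra_simps)
  finally have "emeasure lborel S = 2 * emeasure lborel ((\<lambda>x. x / 2 + c) ` S)"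
    using 1 by simp
  then show "emeasure lborel ((\<lambda>x. x / 2 + c) ` S) = emeasure lborel S / 2"
    by (simp add: mult.commute[of 2] ennreal_mult_divide_eq)
qed

lemma emeasure_near_point:
  fixes S :: "real set"
  assumes "S \<in> sets borel" "S \<subseteq> T \<union> {a..a + e}" "T \<in> sets borel" "e \<ge> 0"
  shows "emeasure lborel S \<le> emeasure lborel T + ennreal e"
proof -
  have "emeasure lborel S \<le> emeasure lborel (T \<union> {a..a + e})"
    using assms by (intro emeasure_mono) auto
  also have "\<dots> \<le> emeasure lborel T + emeasure lborel {a..a + e}"
    using assms by (intro emeasure_subadditive) auto
  finally show ?thesis using assms by simp
qed

text \<open>For \<open>a\<close> near the supremum of \<open>A\<close> and \<open>b\<close> near the infimum of \<open>B\<close>, the sets \<open>(A \<inter> {..a} + b)/2\<close> and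
  \<open>(a + B \<inter> {b<..})/2\<close> are disjoint subsets of \<open>C\<close>.\<close>

lemma Brunn_Minkowski_real:
  fixes A B C :: "real set"
  assumes [measurable]: "A \<in> sets borel" "B \<in> sets borel" "C \<in> sets borel"
    and ne: "A \<noteq> {}" "B \<noteq> {}" and bd: "bdd_above A" "bdd_below B"
    and mid: "\<And>a b. a \<in> A \<Longrightarrow> b \<in> B \<Longrightarrow> (a + b) / 2 \<in> C"
  shows "emeasure lborel A + emeasure lborel B \<le> 2 * emeasure lborel C"
proof (rule ennreal_le_epsilon)
  fix e :: real assume e: "0 < e"
  obtain a where a: "a \<in> A" "Sup A - e / 2 < a"
    using less_cSupE[of "Sup A - e / 2" A] ne e by auto
  obtain b where b: "b \<in> B" "b < Inf B + e / 2"
    using cInf_lessD[of B "Inf B + e / 2"] ne e by auto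
  define A1 where "A1 = A \<inter> {..a}"
  \<comment> \<open>The cut is strict so that the two half-size images do not share the point (a +
    b)/2.\<close>
  define B1 where "B1 = B \<inter> {b<..}"
  have [measurable]: "A1 \<in> sets borel" "B1 \<in> sets borel"
    unfolding A1_def B1_def by auto
  have "emeasure lborel A \<le> emeasure lborel A1 + ennreal (e/2)"
  proof (rule emeasure_near_point[where a=a])
    show "A \<subseteq> A1 \<union> {a..a + e / 2}"
      using a cSup_upper[OF _ bd(1)] unfolding A1_def by fastforce
  qed (use e in auto)
  moreover have "emeasure lborel B \<le> emeasure lborel B1 + ennreal (e/2)"
  proof (rule emeasure_near_point[where a="Inf B"])
    show "B \<subseteq> B1 \<union> {Inf B..Inf B + e / 2}"
      using b cInf_lower[OF _ bd(2)] unfolding B1_def by fastforce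
  qed (use e in auto)
  ultimately have 1: "emeasure lborel A + emeasure lborel B
      \<le> (emeasure lborel A1 + emeasure lborel B1) + ennreal e"
    using add_mono[of "emeasure lborel A" _ "emeasure lborel B"] e
    by (force simp: ac_simps simp flip: ennreal_plus)
  let ?X = "(\<lambda>x. x / 2 + b / 2) ` A1" and ?Y = "(\<lambda>x. x / 2 + a / 2) ` B1"
  have "emeasure lborel A1 / 2 + emeasure lborel B1 / 2 = emeasure lborel ?X + emeasure lborel ?Y"
    by (simp add: emeasure_lborel_affine_image)
  also have "\<dots> = emeasure lborel (?X \<union> ?Y)"
    by (rule plus_emeasure) (auto simp: emeasure_lborel_affine_image A1_def B1_def)
  also have "\<dots> \<le> emeasure lborel C"
  proof (rule emeasure_mono)
    show "?X \<union> ?Y \<subseteq> C"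
      using mid[OF _ b(1)] mid[OF a(1)] by (auto simp: A1_def B1_def add_divide_distrib add.commute)
  qed auto
  finally have "(emeasure lborel A1 + emeasure lborel B1) / 2 * 2 \<le> emeasure lborel C * 2"
    by (intro mult_right_mono) (auto simp: add_divide_distrib_ennreal)
  moreover have "(emeasure lborel A1 + emeasure lborel B1) / 2 * 2 = emeasure lborel A1 + emeasure lborel B1"
    unfolding ennreal_divide_times by (simp add: ennreal_divide_self)
  ultimately have "emeasure lborel A1 + emeasure lborel B1 \<le> 2 * emeasure lborel C"
    by (simp add: mult.commute)
  with 1 show "emeasure lborel A + emeasure lborel B \<le> 2 * emeasure lborel C + ennreal e"
    by (meson add_right_mono order_trans)
qed

text \<open>Layer-cake formula with heights cut at 1, the range in which the level sets of functions
  with supremum 1 are nonempty. Negative values contribute 0 on both sides, as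
  \<open>ennreal\<close> sends them to 0.\<close>

lemma nn_integral_level_sets:
  fixes F :: "real \<Rightarrow> real"
  assumes [measurable]: "F \<in> borel_measurable borel"
  shows "(\<integral>\<^sup>+x. ennreal (min 1 (F x)) \<partial>lborel)
    = (\<integral>\<^sup>+t. indicator {0<..<1} t * emeasure lborel {x. t < F x} \<partial>lborel)"
proof -
  have "(\<integral>\<^sup>+x. ennreal (min 1 (F x)) \<partial>lborel)
    = (\<integral>\<^sup>+x. (\<integral>\<^sup>+t. indicator {0<..<1} t * indicator {x. t < F x} x \<partial>lborel) \<partial>lborel)"
  proof (rule nn_integral_cong)
    fix x
    have "(\<integral>\<^sup>+t. indicator {0<..<1} t * indicator {x. t < F x} x \<partial>lborel)
      = (\<integral>\<^sup>+t. indicator {0<..<min 1 (F x)} t \<partial>lborel)"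
      by (intro nn_integral_cong) (auto simp: indicator_def)
    also have "\<dots> = ennreal (min 1 (F x))"
      by (cases "F x \<ge> 0") (auto simp: ennreal_neg)
    finally show "ennreal (min 1 (F x)) =
       (\<integral>\<^sup>+t. indicator {0<..<1} t * indicator {x. t < F x} x \<partial>lborel)" ..
  qed
  also have "\<dots> = (\<integral>\<^sup>+t. (\<integral>\<^sup>+x. indicator {0<..<1} t * indicator {x. t < F x} x \<partial>lborel) \<partial>lborel)"
  proof (rule lborel_pair.Fubini')
    have "(\<lambda>p. indicator {0<..<1} (fst p) * (if fst p < F (snd p) then 1 else 0 :: ennreal))
        \<in> borel_measurable (lborel \<Otimes>\<^sub>M lborel)"
      by measurable
    then show "(\<lambda>(t, x). indicator {0<..<1} t * indicator {x. t < F x} x :: ennreal)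
        \<in> borel_measurable (lborel \<Otimes>\<^sub>M lborel)"
      by (rule measurable_cong[THEN iffD1, rotated]) (auto simp: indicator_def)
  qed
  also have "\<dots> = (\<integral>\<^sup>+t. indicator {0<..<1} t * emeasure lborel {x. t < F x} \<partial>lborel)"
    by (intro nn_integral_cong, subst nn_integral_cmult) auto
  finally show ?thesis .
qed

text \<open>At every height t in (0,1) the level sets of \<open>F\<close> and \<open>G\<close> are
  nonempty and their midpoints lie in the level set of \<open>H\<close>, so
  \<open>Brunn_Minkowski_real\<close> applies; integrating over t gives the additive form. The
  radius \<open>R\<close> supplies the one-sided bounds on the level sets.\<close>

lemma Prekopa_Leindler_real_normalized:
  fixes F G H :: "real \<Rightarrow> real"
  assumes [measurable]: "F \<in> borel_measurable borel" "G \<in> borel_measurable borel"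
      "H \<in> borel_measurable borel"
    and F: "\<And>x. F x \<le> 1" "\<And>t. t < 1 \<Longrightarrow> \<exists>x. t < F x" "\<And>x. F x > 0 \<Longrightarrow> \<bar>x\<bar> \<le> R"
    and G: "\<And>x. G x \<le> 1" "\<And>t. t < 1 \<Longrightarrow> \<exists>x. t < G x" "\<And>x. G x > 0 \<Longrightarrow> \<bar>x\<bar> \<le> R"
    and H: "\<And>x. 0 \<le> H x" "\<And>x y. F x > 0 \<Longrightarrow> G y > 0 \<Longrightarrow> F x * G y \<le> (H ((x + y) / 2))\<^sup>2"
  shows "(\<integral>\<^sup>+x. F x \<partial>lborel) + (\<integral>\<^sup>+x. G x \<partial>lborel) \<le> 2 * (\<integral>\<^sup>+x. H x \<partial>lborel)"
proof -
  have *: "indicator {0<..<1} t * emeasure lborel {x. t < F x} +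
      indicator {0<..<1} t * emeasure lborel {x. t < G x}
      \<le> 2 * (indicator {0<..<1} t * emeasure lborel {x. t < H x})" for t :: real
  proof (cases "0 < t \<and> t < 1")
    case True
    have "emeasure lborel {x. t < F x} + emeasure lborel {x. t < G x}
      \<le> 2 * emeasure lborel {x. t < H x}"
    proof (rule Brunn_Minkowski_real)
      show "{x. t < F x} \<noteq> {}" "{x. t < G x} \<noteq> {}" using F(2) G(2) True by auto
      have "x \<le> R" if "t < F x" for x
        using F(3)[of x] that True by linarith
      then show "bdd_above {x. t < F x}" by (intro bdd_aboveI[of _ R]) auto
      have "- R \<le> x" if "t < G x" for x
        using G(3)[of x] that True by linarith
      then show "bdd_below {x. t < G x}" by (intro bdd_belowI[of _ "-R"]) auto
      fix a b assume ab: "a \<in> {x. t < F x}" "b \<in> {x. t < G x}"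
      then have "t\<^sup>2 < F a * G b"
        using True by (auto simp: power2_eq_square intro!: mult_strict_mono)
      also have "\<dots> \<le> (H ((a + b) / 2))\<^sup>2"
        using ab True by (intro H) auto
      finally show "(a + b) / 2 \<in> {x. t < H x}"
        using H(1) power_less_imp_less_base by blast
    qed measurable
    with True show ?thesis by simp
  qed auto
  have "(\<integral>\<^sup>+x. F x \<partial>lborel) + (\<integral>\<^sup>+x. G x \<partial>lborel)
      = (\<integral>\<^sup>+x. ennreal (min 1 (F x)) \<partial>lborel) + (\<integral>\<^sup>+x. ennreal (min 1 (G x)) \<partial>lborel)"
    using F(1) G(1) by (simp add: min_absorb2)
  also have "\<dots> = (\<integral>\<^sup>+t. indicator {0<..<1} t * emeasure lborel {x. t < F x} +
      indicator {0<..<1} t * emeasure lborel {x. t < G x} \<partial>lborel)"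
    unfolding nn_integral_level_sets[OF assms(1)] nn_integral_level_sets[OF assms(2)]
    by (rule nn_integral_add[symmetric]) measurable
  also have "\<dots> \<le> (\<integral>\<^sup>+t. 2 * (indicator {0<..<1} t * emeasure lborel {x. t < H x}) \<partial>lborel)"
    by (rule nn_integral_mono) (rule *)
  also have "\<dots> = 2 * (\<integral>\<^sup>+x. ennreal (min 1 (H x)) \<partial>lborel)"
    unfolding nn_integral_level_sets[OF assms(3)] by (rule nn_integral_cmult) measurable
  \<comment> \<open>\<open>H\<close> may exceed 1; its part above height 1 is added back
    here.\<close>
  also have "\<dots> \<le> 2 * (\<integral>\<^sup>+x. H x \<partial>lborel)"
    by (intro mult_left_mono nn_integral_mono) (auto intro!: ennreal_leI)
  finally show ?thesis .
qed

text \<open>Dividing \<open>F\<close> and \<open>G\<close> by their suprema a and b, and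
  \<open>H\<close> by sqrt (a b), preserves the hypothesis and reaches the normalized case. The
  arithmetic-geometric mean inequality then turns its sum into the product.\<close>

lemma Prekopa_Leindler_real_bounded:
  fixes F G H :: "real \<Rightarrow> real"
  assumes [measurable]: "F \<in> borel_measurable borel" "G \<in> borel_measurable borel"
      "H \<in> borel_measurable borel"
    and F: "\<And>x. 0 \<le> F x" "\<And>x. F x \<le> M" "\<And>x. F x > 0 \<Longrightarrow> \<bar>x\<bar> \<le> R"
    and G: "\<And>x. 0 \<le> G x" "\<And>x. G x \<le> M" "\<And>x. G x > 0 \<Longrightarrow> \<bar>x\<bar> \<le> R"
    and H: "\<And>x. 0 \<le> H x" "\<And>x y. F x * G y \<le> (H ((x + y) / 2))\<^sup>2"
  shows "(\<integral>\<^sup>+x. F x \<partial>lborel) * (\<integral>\<^sup>+x. G x \<partial>lborel) \<le> (\<integral>\<^sup>+x. H x \<partial>lborel)\<^sup>2"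
proof (cases "(\<forall>x. F x = 0) \<or> (\<forall>x. G x = 0)")
  case True
  then show ?thesis by auto
next
  case False
  define a where "a = (SUP x. F x)"
  define b where "b = (SUP x. G x)"
  have bF: "bdd_above (range F)" and bG: "bdd_above (range G)"
    using F G by (auto intro!: bdd_aboveI)
  obtain x0 y0 where xy0: "F x0 \<noteq> 0" "G y0 \<noteq> 0" using False by auto
  have "a \<ge> F x0" "b \<ge> G y0"
    unfolding a_def b_def using bF bG by (auto intro!: cSUP_upper)
  then have ab: "a > 0" "b > 0" using F(1)[of x0] G(1)[of y0] xy0 by linarith+
  define c where "c = sqrt (a * b)"
  have c: "c > 0" "c\<^sup>2 = a * b" using ab by (auto simp: c_def)
  have fin: "(\<integral>\<^sup>+x. ennreal (F x) \<partial>lborel) < \<infinity>" "(\<integral>\<^sup>+x. ennreal (G x) \<partial>lborel) < \<infinity>"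
  proof -
    have "(\<integral>\<^sup>+x. ennreal (F x) \<partial>lborel) \<le> (\<integral>\<^sup>+x. ennreal M * indicator {-R..R} x \<partial>lborel)"
      using F by (intro nn_integral_mono) (force simp: indicator_def order_less_le intro!: ennreal_leI)
    also have "\<dots> < \<infinity>" by (simp add: nn_integral_cmult emeasure_lborel_Icc_eq ennreal_mult_less_top)
    finally show "(\<integral>\<^sup>+x. ennreal (F x) \<partial>lborel) < \<infinity>" .
    have "(\<integral>\<^sup>+x. ennreal (G x) \<partial>lborel) \<le> (\<integral>\<^sup>+x. ennreal M * indicator {-R..R} x \<partial>lborel)"
      using G by (intro nn_integral_mono) (force simp: indicator_def order_less_le intro!: ennreal_leI)
    also have "\<dots> < \<infinity>" by (simp add: nn_integral_cmult emeasure_lborel_Icc_eq ennreal_mult_less_top)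
    finally show "(\<integral>\<^sup>+x. ennreal (G x) \<partial>lborel) < \<infinity>" .
  qed
  have main: "(\<integral>\<^sup>+x. F x / a \<partial>lborel) + (\<integral>\<^sup>+x. G x / b \<partial>lborel) \<le> 2 * (\<integral>\<^sup>+x. H x / c \<partial>lborel)"
  proof (rule Prekopa_Leindler_real_normalized[where R=R])
    show "F x / a \<le> 1" "G x / b \<le> 1" for x
      using ab bF bG by (auto simp: a_def b_def intro!: cSUP_upper)
    show "\<exists>x. t < F x / a" if "t < 1" for t
    proof -
      have "t * a < a" using that ab by auto
      then obtain x where "t * a < F x" unfolding a_def using less_cSUP_iff[OF _ bF] by auto
      then show ?thesis using ab by (auto simp: field_simps)
    qed
    show "\<exists>x. t < G x / b" if "t < 1" for t
    proof -
      have "t * b < b" using that ab by auto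
      then obtain x where "t * b < G x" unfolding b_def using less_cSUP_iff[OF _ bG] by auto
      then show ?thesis using ab by (auto simp: field_simps)
    qed
    show "\<bar>x\<bar> \<le> R" if "F x / a > 0" for x using that F(3) ab by (auto simp: zero_less_divide_iff)
    show "\<bar>x\<bar> \<le> R" if "G x / b > 0" for x using that G(3) ab by (auto simp: zero_less_divide_iff)
    show "F x / a * (G y / b) \<le> (H ((x + y) / 2) / c)\<^sup>2" for x y
      using H(2)[of x y] ab c by (simp add: power_divide divide_right_mono)
  qed (use H c in auto)
  define I where "I = enn2real (\<integral>\<^sup>+x. ennreal (F x) \<partial>lborel)"
  define J where "J = enn2real (\<integral>\<^sup>+x. ennreal (G x) \<partial>lborel)"
  have IJ: "(\<integral>\<^sup>+x. ennreal (F x) \<partial>lborel) = ennreal I" "(\<integral>\<^sup>+x. ennreal (G x) \<partial>lborel) = ennreal J"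
    "I \<ge> 0" "J \<ge> 0"
    using fin by (auto simp: I_def J_def)
  have div: "(\<integral>\<^sup>+x. ennreal (f x / k) \<partial>lborel) = (\<integral>\<^sup>+x. ennreal (f x) \<partial>lborel) * ennreal (1 / k)"
    if [measurable]: "f \<in> borel_measurable borel" and "k > 0" "\<And>x. f x \<ge> 0" for f :: "real \<Rightarrow> real" and k
    using that by (subst nn_integral_multc[symmetric]) (auto simp: ennreal_mult'[symmetric])
  show ?thesis
  proof (cases "(\<integral>\<^sup>+x. ennreal (H x) \<partial>lborel) = \<infinity>")
    case True
    then show ?thesis by (simp add: power2_eq_square)
  next
    case False
    define K where "K = enn2real (\<integral>\<^sup>+x. ennreal (H x) \<partial>lborel)"
    have K: "(\<integral>\<^sup>+x. ennreal (H x) \<partial>lborel) = ennreal K" "K \<ge> 0" 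
      using False by (auto simp: K_def less_top)
    have "ennreal (I * (1/a) + J * (1/b)) \<le> ennreal (2 * (K * (1/c)))"
      using main ab c F G H K IJ
      by (simp add: div ennreal_mult' ennreal_plus del: times_divide_eq_right)
    then have 1: "I / a + J / b \<le> 2 * K / c"
      using K c ab by (subst (asm) ennreal_le_iff) auto
    have "4 * ((I / a) * (J / b)) \<le> (I / a + J / b)\<^sup>2"
      using sum_squares_bound[of "I/a" "J/b"] by (simp add: power2_sum)
    also have "\<dots> \<le> (2 * K / c)\<^sup>2"
      using 1 IJ ab by (intro power_mono) auto
    also have "\<dots> = 4 * (K\<^sup>2 / (a * b))" using c by (simp add: power_divide power_mult_distrib)
    finally have "I * J \<le> K\<^sup>2" using ab by (simp add: divide_le_cancel)
    then show ?thesis unfolding IJ(1,2) K(1)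
      using IJ K by (simp add: ennreal_mult'[symmetric] ennreal_power ennreal_leI)
  qed
qed

text \<open>Truncating \<open>F\<close> and \<open>G\<close> in height and in support gives
  increasing sequences to which the bounded case applies; monotone convergence in both indices
  removes the truncation.\<close>

lemma Prekopa_Leindler_real:
  fixes F G H :: "real \<Rightarrow> ennreal"
  assumes [measurable]: "F \<in> borel_measurable borel" "G \<in> borel_measurable borel"
      "H \<in> borel_measurable borel"
    and FGH: "\<And>x y. F x * G y \<le> (H ((x + y) / 2))\<^sup>2"
  shows "(\<integral>\<^sup>+x. F x \<partial>lborel) * (\<integral>\<^sup>+x. G x \<partial>lborel) \<le> (\<integral>\<^sup>+x. H x \<partial>lborel)\<^sup>2"
proof -
  define tr :: "(real \<Rightarrow> ennreal) \<Rightarrow> nat \<Rightarrow> real \<Rightarrow> real" where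
    "tr f n x = indicator {- real n..real n} x * enn2real (min (f x) (of_nat n))" for f n x
  have min_nat: "ennreal (enn2real (min c (of_nat n))) = min c (of_nat n)" for c :: ennreal and n
    by (rule ennreal_enn2real) (simp add: min.strict_coboundedI2 of_nat_less_top)
  have [measurable]: "tr f n \<in> borel_measurable borel" if [measurable]: "f \<in> borel_measurable borel" for f n
    unfolding tr_def[abs_def] by measurable
  have tr_eq: "ennreal (tr f n x) = indicator {- real n..real n} x * min (f x) (of_nat n)" for f n x
    unfolding tr_def using min_nat[of "f x" n] by (auto simp: indicator_def)
  have SUP_tr: "(SUP n. ennreal (tr f n x)) = f x" for f x
  proof (rule antisym)
    show "(SUP n. ennreal (tr f n x)) \<le> f x"
      unfolding tr_eq by (auto intro!: SUP_least simp: indicator_def)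
    show "f x \<le> (SUP n. ennreal (tr f n x))"
    proof (rule dense_le)
      fix c assume c: "c < f x"
      then obtain r where r: "c = ennreal r" "r \<ge> 0" by (cases c) auto
      obtain n where n: "real n \<ge> max \<bar>x\<bar> r" using real_arch_simple by blast
      then have "c \<le> of_nat n" using r by (simp add: ennreal_leI flip: ennreal_of_nat_eq_real_of_nat)
      then have "c \<le> ennreal (tr f n x)"
        unfolding tr_eq using c n by (auto simp: indicator_def abs_le_iff)
      then show "c \<le> (SUP n. ennreal (tr f n x))" by (rule SUP_upper2[rotated]) auto
    qed
  qed
  have inc: "incseq (\<lambda>n x. ennreal (tr f n x))" for f
  proof (intro monoI le_funI)
    fix m n x assume "m \<le> (n::nat)"
    then show "ennreal (tr f m x) \<le> ennreal (tr f n x)"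
      unfolding tr_eq
      by (intro mult_mono min.mono order_refl of_nat_mono) (auto simp: indicator_def)
  qed
  have SUP_int: "(\<integral>\<^sup>+x. f x \<partial>lborel) = (SUP n. \<integral>\<^sup>+x. tr f n x \<partial>lborel)"
    if [measurable]: "f \<in> borel_measurable borel" for f
    by (subst nn_integral_monotone_convergence_SUP[symmetric])
       (auto simp: SUP_tr inc)
  have fin: "(\<integral>\<^sup>+x. tr F n x \<partial>lborel) * (\<integral>\<^sup>+x. tr G m x \<partial>lborel) \<le> (\<integral>\<^sup>+x. H x \<partial>lborel)\<^sup>2" for n m
  proof -
    \<comment> \<open>\<open>H\<close> is cut at height k only. Since both truncations are at most
      k, their product stays below the square of the cut \<open>H\<close>.\<close>
    define k where "k = max n m"
    define H' where "H' x = enn2real (min (H x) (of_nat k))" for x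
    have H'_eq: "ennreal (H' x) = min (H x) (of_nat k)" for x
      unfolding H'_def by (rule min_nat)
    have [measurable]: "H' \<in> borel_measurable borel" unfolding H'_def[abs_def] by measurable
    have le: "tr f j x \<le> real k" if "j \<le> k" for f j x
    proof -
      have "ennreal (tr f j x) \<le> of_nat j" unfolding tr_eq by (auto simp: indicator_def)
      then have "tr f j x \<le> real j" by (simp add: ennreal_of_nat_eq_real_of_nat)
      then show ?thesis using that by linarith
    qed
    have "(\<integral>\<^sup>+x. tr F n x \<partial>lborel) * (\<integral>\<^sup>+x. tr G m x \<partial>lborel) \<le> (\<integral>\<^sup>+x. H' x \<partial>lborel)\<^sup>2"
    proof (rule Prekopa_Leindler_real_bounded[where M="real k" and R="real k"])
      show "tr F n x * tr G m y \<le> (H' ((x + y) / 2))\<^sup>2" for x y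
      proof -
        have "ennreal (tr F n x * tr G m y) = ennreal (tr F n x) * ennreal (tr G m y)"
          by (rule ennreal_mult') (simp add: tr_def)
        also have "\<dots> \<le> min (F x * G y) (of_nat k * of_nat k)"
        proof -
          have le: "ennreal (tr f j z) \<le> f z" "ennreal (tr f j z) \<le> of_nat j" for f j z
            unfolding tr_eq by (auto simp: indicator_def)
          have "(of_nat n :: ennreal) \<le> of_nat k" "(of_nat m :: ennreal) \<le> of_nat k"
            by (auto simp: k_def)
          then show ?thesis
            by (intro min.boundedI mult_mono le order_trans[OF le(2)]) auto
        qed
        also have "\<dots> \<le> (min (H ((x + y) / 2)) (of_nat k))\<^sup>2"
          using FGH[of x y] by (auto simp: min_def power2_eq_square)
        also have "\<dots> = ennreal ((H' ((x + y) / 2))\<^sup>2)"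
          unfolding H'_eq[symmetric] by (simp add: ennreal_power H'_def)
        finally show ?thesis by (simp add: H'_def)
      qed
      show "\<bar>x\<bar> \<le> real k" if "tr F n x > 0" for x
        using that unfolding tr_def k_def by (cases "x \<in> {- real n..real n}") auto
      show "\<bar>x\<bar> \<le> real k" if "tr G m x > 0" for x
        using that unfolding tr_def k_def by (cases "x \<in> {- real m..real m}") auto
      show "tr F n x \<le> real k" "tr G m x \<le> real k" "0 \<le> tr F n x" "0 \<le> tr G m x" "0 \<le> H' x" for x
        using le[of n F x] le[of m G x] by (auto simp: k_def) (auto simp: tr_def H'_def)
    qed measurable
    also have "\<dots> \<le> (\<integral>\<^sup>+x. H x \<partial>lborel)\<^sup>2"
      by (intro power_mono nn_integral_mono) (auto simp: H'_eq)
    finally show ?thesis .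
  qed
  show ?thesis
    unfolding SUP_int[OF assms(1)] SUP_int[OF assms(2)]
    unfolding SUP_mult_right_ennreal SUP_mult_left_ennreal by (intro SUP_least fin)
qed

text \<open>Tensorization: for fixed s and t the induction hypothesis, applied to the sections at s,
  t and (s + t)/2 in the new coordinate, says that the functions obtained by integrating out the old
  coordinates satisfy the hypothesis of the one-dimensional inequality.\<close>

lemma Prekopa_Leindler_PiM:
  fixes F G H :: "('i \<Rightarrow> real) \<Rightarrow> ennreal"
  assumes "finite I"
    and "F \<in> borel_measurable (\<Pi>\<^sub>M i\<in>I. lborel)" "G \<in> borel_measurable (\<Pi>\<^sub>M i\<in>I. lborel)"
      "H \<in> borel_measurable (\<Pi>\<^sub>M i\<in>I. lborel)"
    and "\<And>x y. x \<in> extensional I \<Longrightarrow> y \<in> extensional I \<Longrightarrow> F x * G y \<le> (H (\<lambda>i\<in>I. (x i + y i) / 2))\<^sup>2"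
  shows "(\<integral>\<^sup>+x. F x \<partial>(\<Pi>\<^sub>M i\<in>I. lborel)) * (\<integral>\<^sup>+x. G x \<partial>(\<Pi>\<^sub>M i\<in>I. lborel))
    \<le> (\<integral>\<^sup>+x. H x \<partial>(\<Pi>\<^sub>M i\<in>I. lborel))\<^sup>2"
  using assms
proof (induction I arbitrary: F G H rule: finite_induct)
  case empty
  interpret product_sigma_finite "\<lambda>_::'i. lborel :: real measure" ..
  have "F (\<lambda>x. undefined) * G (\<lambda>x. undefined) \<le> (H (\<lambda>x. undefined))\<^sup>2"
    using empty(4)[of "\<lambda>x. undefined" "\<lambda>x. undefined"] by simp
  then show ?case by (simp add: nn_integral_empty)
next
  case (insert j I)
  interpret product_sigma_finite "\<lambda>_::'i. lborel :: real measure" ..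
  note [measurable] = insert.prems(1-3)
  let ?M = "\<Pi>\<^sub>M i\<in>I. lborel :: real measure"
  have m: "(\<lambda>x. f (x(j := s))) \<in> borel_measurable ?M"
    if [measurable]: "f \<in> borel_measurable (\<Pi>\<^sub>M i\<in>insert j I. lborel)"
    for f :: "('i \<Rightarrow> real) \<Rightarrow> ennreal" and s :: real
    by measurable
  have "(\<integral>\<^sup>+x. F (x(j := s)) \<partial>?M) * (\<integral>\<^sup>+x. G (x(j := t)) \<partial>?M)
      \<le> (\<integral>\<^sup>+x. H (x(j := (s + t) / 2)) \<partial>?M)\<^sup>2" for s t
  proof (rule insert.IH)
    fix x y :: "'i \<Rightarrow> real" assume xy: "x \<in> extensional I" "y \<in> extensional I"
    have fun_upd_extensional: "x(j := s) \<in> extensional (insert j I)" "y(j := t) \<in> extensional (insert j I)"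
      using xy by (auto simp: extensional_def)
    have mid: "(\<lambda>i\<in>insert j I. ((x(j := s)) i + (y(j := t)) i) / 2)
        = (\<lambda>i\<in>I. (x i + y i) / 2)(j := (s + t) / 2)"
      using insert.hyps by (auto simp: fun_eq_iff)
    then show "F (x(j := s)) * G (y(j := t)) \<le> (H ((\<lambda>i\<in>I. (x i + y i) / 2)(j := (s + t) / 2)))\<^sup>2"
      using insert.prems(4)[of "x(j := s)" "y(j := t)"] xy
      by (simp only: fun_upd_extensional mid simp_thms)
  qed (intro m insert.prems)+
  moreover have "(\<lambda>s. \<integral>\<^sup>+x. f (x(j := s)) \<partial>?M) \<in> borel_measurable borel"
    if [measurable]: "f \<in> borel_measurable (\<Pi>\<^sub>M i\<in>insert j I. lborel)" for f :: "('i \<Rightarrow> real) \<Rightarrow> ennreal"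
  proof -
    interpret I: finite_product_sigma_finite "\<lambda>_::'i. lborel :: real measure" I
      by standard (rule insert.hyps)
    show ?thesis by measurable
  qed
  ultimately have "(\<integral>\<^sup>+s. (\<integral>\<^sup>+x. F (x(j := s)) \<partial>?M) \<partial>lborel) * (\<integral>\<^sup>+t. (\<integral>\<^sup>+x. G (x(j := t)) \<partial>?M) \<partial>lborel)
      \<le> (\<integral>\<^sup>+u. (\<integral>\<^sup>+x. H (x(j := u)) \<partial>?M) \<partial>lborel)\<^sup>2"
    by (intro Prekopa_Leindler_real insert.prems) auto
  then show ?case
    by (simp add: product_nn_integral_insert_rev insert.hyps insert.prems)
qed

theorem Prekopa_Leindler:
  fixes F G H :: "'a::euclidean_space \<Rightarrow> ennreal"
  assumes [measurable]: "F \<in> borel_measurable borel" "G \<in> borel_measurable borel"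
      "H \<in> borel_measurable borel"
    and FGH: "\<And>x y. F x * G y \<le> (H ((x + y) /\<^sub>R 2))\<^sup>2"
  shows "(\<integral>\<^sup>+x. F x \<partial>lborel) * (\<integral>\<^sup>+x. G x \<partial>lborel) \<le> (\<integral>\<^sup>+x. H x \<partial>lborel)\<^sup>2"
proof -
  let ?c = "\<lambda>f. \<Sum>b\<in>Basis. f b *\<^sub>R b :: 'a"
  have c: "(\<integral>\<^sup>+x. f x \<partial>lborel) = (\<integral>\<^sup>+x. f (?c x) \<partial>(\<Pi>\<^sub>M b\<in>(Basis::'a set). lborel))"
    if [measurable]: "f \<in> borel_measurable borel" for f :: "'a \<Rightarrow> ennreal"
    by (subst lborel_eq) (simp add: nn_integral_distr)
  show ?thesis
    unfolding c[OF assms(1)] c[OF assms(2)] c[OF assms(3)]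
  proof (rule Prekopa_Leindler_PiM)
    fix x y :: "'a \<Rightarrow> real"
    have "?c (\<lambda>i\<in>Basis. (x i + y i) / 2) = (?c x + ?c y) /\<^sub>R 2"
    proof -
      have "((s + t) / 2) *\<^sub>R v = (s *\<^sub>R v + t *\<^sub>R v) /\<^sub>R 2" for s t and v :: 'a
        by (metis scaleR_add_left scaleR_scaleR divide_inverse_commute)
      then show ?thesis
        unfolding sum.distrib[symmetric] scaleR_sum_right by (intro sum.cong) auto
    qed
    then show "F (?c x) * G (?c y) \<le> (H (?c (\<lambda>i\<in>Basis. (x i + y i) / 2)))\<^sup>2"
      using FGH[of "?c x" "?c y"] by simp
  qed auto
qed

section \<open>Bounded Borel functions with bounded support\<close>

definition bounded_measurable :: "('a::topological_space \<Rightarrow> real) \<Rightarrow> bool" where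
  "bounded_measurable w \<longleftrightarrow> w \<in> borel_measurable borel \<and> (\<exists>M. \<forall>x. \<bar>w x\<bar> \<le> M)"

text \<open>A class closed under products, translations, tensor products, marginals and
  convolutions, all of whose members are integrable. Fubini and Cauchy-Schwarz then follow from
  membership alone, and indicators of compact sets belong to it.\<close>

definition bbs :: "('a::euclidean_space \<Rightarrow> real) \<Rightarrow> bool" where
  "bbs w \<longleftrightarrow> bounded_measurable w \<and> bounded {x. w x \<noteq> 0}"

lemma bounded_measurable_borel[measurable_dest]: "bounded_measurable w \<Longrightarrow> w \<in> borel_measurable borel"
  by (simp add: bounded_measurable_def)

lemma bounded_measurableE:
  assumes "bounded_measurable w" obtains M where "M > 0" "\<And>x. \<bar>w x\<bar> \<le> M"
proof -
  obtain M where "\<And>x. \<bar>w x\<bar> \<le> M" using assms by (auto simp: bounded_measurable_def)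
  then have "\<bar>w x\<bar> \<le> max M 1" for x by (simp add: max.coboundedI1)
  then show ?thesis using that[of "max M 1"] by simp
qed

lemma bounded_measurableI:
  "w \<in> borel_measurable borel \<Longrightarrow> (\<And>x. \<bar>w x\<bar> \<le> M) \<Longrightarrow> bounded_measurable w"
  by (auto simp: bounded_measurable_def)

lemma bounded_measurable_const: "bounded_measurable (\<lambda>_. c)"
  by (rule bounded_measurableI[of _ "\<bar>c\<bar>"]) auto

lemma bounded_measurable_add:
  assumes "bounded_measurable u" "bounded_measurable v"
  shows "bounded_measurable (\<lambda>x. u x + v x)"
proof -
  note [measurable] = assms[THEN bounded_measurable_borel]
  from assms obtain M N where "\<And>x. \<bar>u x\<bar> \<le> M" "\<And>x. \<bar>v x\<bar> \<le> N"
    by (auto elim!: bounded_measurableE)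
  then show ?thesis
    by (intro bounded_measurableI[of _ "M + N"]) (auto intro: order_trans[OF abs_triangle_ineq] add_mono)
qed

lemma bounded_measurable_mult:
  assumes "bounded_measurable u" "bounded_measurable v"
  shows "bounded_measurable (\<lambda>x. u x * v x)"
proof -
  note [measurable] = assms[THEN bounded_measurable_borel]
  from assms obtain M N where "M > 0" "\<And>x. \<bar>u x\<bar> \<le> M" "\<And>x. \<bar>v x\<bar> \<le> N"
    by (auto elim!: bounded_measurableE)
  then show ?thesis
    by (intro bounded_measurableI[of _ "M * N"]) (auto simp: abs_mult intro!: mult_mono)
qed

lemma bounded_measurable_compose:
  assumes "bounded_measurable u" and [measurable]: "p \<in> borel_measurable borel"
  shows "bounded_measurable (\<lambda>x. u (p x))"
proof -
  note [measurable] = bounded_measurable_borel[OF assms(1)]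
  from assms obtain M where "\<And>x. \<bar>u x\<bar> \<le> M" by (auto elim!: bounded_measurableE)
  then show ?thesis by (intro bounded_measurableI[of _ M]) auto
qed

lemma bounded_measurable_diff:
  assumes "bounded_measurable u" "bounded_measurable v"
  shows "bounded_measurable (\<lambda>x. u x - v x)"
  using bounded_measurable_add[OF assms(1) bounded_measurable_mult[OF bounded_measurable_const[of "-1"] assms(2)]]
  by simp

lemma bounded_measurable_abs: "bounded_measurable u \<Longrightarrow> bounded_measurable (\<lambda>x. \<bar>u x\<bar>)"
  by (auto simp: bounded_measurable_def)

lemma bounded_measurable_power2: "bounded_measurable u \<Longrightarrow> bounded_measurable (\<lambda>x. (u x)\<^sup>2)"
  unfolding power2_eq_square by (rule bounded_measurable_mult)

lemma bbs_bounded_measurable: "bbs w \<Longrightarrow> bounded_measurable w"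
  by (simp add: bbs_def)

lemma bbs_borel[measurable_dest]: "bbs w \<Longrightarrow> w \<in> borel_measurable borel"
  by (simp add: bbs_def bounded_measurable_borel)

lemma bbs_mult_bounded: "bbs u \<Longrightarrow> bounded_measurable v \<Longrightarrow> bbs (\<lambda>x. u x * v x)"
  unfolding bbs_def by (auto intro: bounded_measurable_mult elim!: bounded_subset)

lemma bbs_mult: "bbs u \<Longrightarrow> bbs v \<Longrightarrow> bbs (\<lambda>x. u x * v x)"
  by (intro bbs_mult_bounded bbs_bounded_measurable)

lemma bbs_add:
  assumes "bbs u" "bbs v" shows "bbs (\<lambda>x. u x + v x)"
proof -
  have "bounded ({x. u x \<noteq> 0} \<union> {x. v x \<noteq> 0})"
    using assms by (simp add: bbs_def)
  then have "bounded {x. u x + v x \<noteq> 0}" by (rule bounded_subset) auto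
  with assms show ?thesis by (simp add: bbs_def bounded_measurable_add)
qed

lemma bbs_cmult: "bbs v \<Longrightarrow> bbs (\<lambda>x. c * v x)"
  using bbs_mult_bounded[of v "\<lambda>_. c"] by (simp add: bounded_measurable_const mult.commute)

lemma bbs_diff: "bbs u \<Longrightarrow> bbs v \<Longrightarrow> bbs (\<lambda>x. u x - v x)"
  using bbs_add[of u "\<lambda>x. -1 * v x"] bbs_cmult[of v "-1"] by simp

lemma bbs_abs: "bbs u \<Longrightarrow> bbs (\<lambda>x. \<bar>u x\<bar>)"
  unfolding bbs_def by (auto intro: bounded_measurable_abs)

lemma bbs_power2: "bbs u \<Longrightarrow> bbs (\<lambda>x. (u x)\<^sup>2)"
  unfolding power2_eq_square by (rule bbs_mult)

lemma bbs_indicator: "S \<in> sets borel \<Longrightarrow> bounded S \<Longrightarrow> bbs (indicator S)"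
  unfolding bbs_def
  by (auto intro!: bounded_measurableI[of _ 1] elim!: bounded_subset simp: indicator_def)

lemma bbsI:
  assumes "bounded_measurable w" "bounded S" "\<And>x. w x \<noteq> 0 \<Longrightarrow> x \<in> S"
  shows "bbs w"
  using assms unfolding bbs_def by (auto elim!: bounded_subset)

lemma bbs_cball:
  assumes "bbs w" obtains R where "R > 0" "\<And>x. w x \<noteq> 0 \<Longrightarrow> norm x \<le> R"
proof -
  obtain R where "R > 0" "\<And>x. x \<in> {x. w x \<noteq> 0} \<Longrightarrow> norm x \<le> R"
    using assms unfolding bbs_def bounded_pos by blast
  then show ?thesis using that[of R] by blast
qed

lemma bbs_translate: 
  assumes "bbs w" shows "bbs (\<lambda>x. w (x - h))"
proof -
  obtain R where R: "\<And>x. w x \<noteq> 0 \<Longrightarrow> norm x \<le> R" using assms bbs_cball by metis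
  show ?thesis
  proof (rule bbsI)
    show "bounded_measurable (\<lambda>x. w (x - h))"
      by (rule bounded_measurable_compose[OF bbs_bounded_measurable[OF assms]]) measurable
    show "x \<in> cball h R" if "w (x - h) \<noteq> 0" for x
      using R[OF that] by (simp add: dist_norm norm_minus_commute)
  qed auto
qed

lemma bbs_reflect: 
  assumes "bbs w" shows "bbs (\<lambda>x. w (h - x))"
proof -
  obtain R where R: "\<And>x. w x \<noteq> 0 \<Longrightarrow> norm x \<le> R" using assms bbs_cball by metis
  show ?thesis
  proof (rule bbsI)
    show "bounded_measurable (\<lambda>x. w (h - x))"
      by (rule bounded_measurable_compose[OF bbs_bounded_measurable[OF assms]]) measurable
    show "x \<in> cball h R" if "w (h - x) \<noteq> 0" for x
      using R[OF that] by (simp add: dist_norm norm_minus_commute)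
  qed auto
qed

lemma bbs_integrable[intro]: 
  assumes "bbs w" shows "integrable lborel w"
proof -
  obtain R where R: "\<And>x. w x \<noteq> 0 \<Longrightarrow> norm x \<le> R" using assms bbs_cball by metis
  obtain M where M: "M > 0" "\<And>x. \<bar>w x\<bar> \<le> M"
    using assms bbs_bounded_measurable bounded_measurableE by metis
  note [measurable] = bbs_borel[OF assms]
  show ?thesis
  proof (rule integrableI_bounded_set[of "cball 0 R" _ _ M])
    show "emeasure lborel (cball (0::'a) R) < \<infinity>"
      using emeasure_bounded_finite[of "cball (0::'a) R"] by simp
  qed (use R M in auto)
qed

lemma bbs_tensor:
  fixes u :: "'a::euclidean_space \<Rightarrow> real" and v :: "'b::euclidean_space \<Rightarrow> real"
  assumes "bbs u" "bbs v" shows "bbs (\<lambda>(x,y). u x * v y)"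
proof (rule bbsI)
  have "bounded_measurable (\<lambda>z::'a\<times>'b. u (fst z) * v (snd z))"
    by (intro bounded_measurable_mult bounded_measurable_compose[OF bbs_bounded_measurable] assms)
      (auto simp flip: borel_prod)
  then show "bounded_measurable (\<lambda>(x,y). u x * v y)" by (simp add: case_prod_unfold)
  show "bounded ({x. u x \<noteq> 0} \<times> {y. v y \<noteq> 0})"
    using assms by (intro bounded_Times) (auto simp: bbs_def)
qed auto

lemma bounded_measurable_section:
  assumes "bounded_measurable (\<lambda>(x,y). F x y)" 
  shows "bounded_measurable (\<lambda>y. F (x::'a::second_countable_topology) (y::'b::second_countable_topology))"
  using bounded_measurable_compose[OF assms, of "\<lambda>y. (x, y)"] by (simp flip: borel_prod)

lemma bbs_section:
  assumes "bbs (\<lambda>(x,y). F x y)" shows "bbs (\<lambda>y. F x y)"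
proof (rule bbsI)
  show "bounded_measurable (\<lambda>y. F x y)"
    by (rule bounded_measurable_section[OF bbs_bounded_measurable[OF assms]])
  show "bounded (snd ` {z. (\<lambda>(x,y). F x y) z \<noteq> 0})"
    using assms by (intro bounded_snd) (simp add: bbs_def)
  show "y \<in> snd ` {z. (\<lambda>(x,y). F x y) z \<noteq> 0}" if "F x y \<noteq> 0" for y
    using that by (force intro!: image_eqI[of _ _ "(x,y)"])
qed

lemma bbs_marginal:
  fixes F :: "'a::euclidean_space \<Rightarrow> 'b::euclidean_space \<Rightarrow> real"
  assumes "bbs (\<lambda>(x,y). F x y)" shows "bbs (\<lambda>x. LBINT y. F x y)"
proof -
  note [measurable] = bbs_borel[OF assms]
  obtain R where R: "R > 0" "\<And>z. (\<lambda>(x,y). F x y) z \<noteq> 0 \<Longrightarrow> norm z \<le> R"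
    using assms by (auto elim: bbs_cball)
  obtain M where M: "M > 0" "\<And>z. \<bar>(\<lambda>(x,y). F x y) z\<bar> \<le> M"
    using assms by (auto elim: bounded_measurableE dest!: bbs_bounded_measurable)
  have int: "integrable lborel (\<lambda>y. F x y)" for x by (rule bbs_integrable[OF bbs_section[OF assms]])
  show ?thesis
  proof (rule bbsI)
    show "bounded_measurable (\<lambda>x. LBINT y. F x y)"
    proof (rule bounded_measurableI)
      have "(\<lambda>(x,y). F x y) \<in> borel_measurable (borel \<Otimes>\<^sub>M lborel)"
        using bbs_borel[OF assms] unfolding borel_prod[symmetric] by simp
      then show "(\<lambda>x. LBINT y. F x y) \<in> borel_measurable borel"
        by (rule lborel.borel_measurable_lebesgue_integral)
      fix x
      have "\<bar>LBINT y. F x y\<bar> \<le> (LBINT y. \<bar>F x y\<bar>)" by simp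
      also have "\<dots> \<le> (\<integral>y. M * indicator (cball 0 R) y \<partial>(lborel :: 'b measure))"
      proof (rule integral_mono)
        show "integrable lborel (\<lambda>y. M * indicator (cball 0 R) (y::'b))"
          by (intro bbs_integrable bbs_cmult bbs_indicator) auto
        show "\<bar>F x y\<bar> \<le> M * indicator (cball 0 R) y" for y
          using M(2)[of "(x,y)"] R(2)[of "(x,y)"] norm_snd_le[of y x]
          by (cases "F x y = 0") (use M(1) in \<open>auto simp: indicator_def\<close>)
      qed (use int in auto)
      finally show "\<bar>LBINT y. F x y\<bar> \<le> (\<integral>y. M * indicator (cball 0 R) y \<partial>(lborel :: 'b measure))" .
    qed
    show "bounded (cball (0::'a) R)" by simp
    show "x \<in> cball 0 R" if "(LBINT y. F x y) \<noteq> 0" for x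
    proof -
      have "F x \<noteq> (\<lambda>_. 0)" using that by auto
      then obtain y where "F x y \<noteq> 0" by (auto simp: fun_eq_iff)
      then show ?thesis using R(2)[of "(x,y)"] norm_fst_le[of x y] by auto
    qed
  qed
qed

lemma bbs_Fubini:
  fixes F :: "'a::euclidean_space \<Rightarrow> 'b::euclidean_space \<Rightarrow> real"
  assumes "bbs (\<lambda>(x,y). F x y)"
  shows "(LBINT x. (LBINT y. F x y)) = (LBINT y. (LBINT x. F x y))"
proof -
  have "integrable (lborel \<Otimes>\<^sub>M lborel) (\<lambda>(x,y). F x y)"
    using bbs_integrable[OF assms] unfolding lborel_prod .
  then show ?thesis by (rule lborel_pair.Fubini_integral[symmetric])
qed

lemma bbs_swap:
  assumes "bbs (\<lambda>(x,y). F x y)" shows "bbs (\<lambda>(y,x). F x y)"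
proof (rule bbsI)
  have "bounded_measurable (\<lambda>z. (\<lambda>(x,y). F x y) (snd z, fst z))"
    using assms by (intro bounded_measurable_compose[OF bbs_bounded_measurable]) (auto simp flip: borel_prod)
  then show "bounded_measurable (\<lambda>(y,x). F x y)" by (simp add: case_prod_unfold)
  show "bounded (snd ` {z. (\<lambda>(x,y). F x y) z \<noteq> 0} \<times> fst ` {z. (\<lambda>(x,y). F x y) z \<noteq> 0})"
    using assms by (intro bounded_Times bounded_fst bounded_snd) (auto simp: bbs_def)
  show "p \<in> snd ` {z. (\<lambda>(x,y). F x y) z \<noteq> 0} \<times> fst ` {z. (\<lambda>(x,y). F x y) z \<noteq> 0}"
    if "(\<lambda>(y,x). F x y) p \<noteq> 0" for p
    using that by (cases p) (force intro: image_eqI[of _ _ "(snd p, fst p)"])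
qed

section \<open>Lebesgue integrals under translation, reflection and scaling\<close>

lemma lborel_integral_translate:
  fixes f :: "'a::euclidean_space \<Rightarrow> real"
  shows "(LBINT x. f (x - h)) = (LBINT x. f x)"
proof -
  have "(LBINT x. f x) = (\<integral>x. f x \<partial>distr lborel borel ((+) (-h)))"
    by (simp add: lborel_distr_plus)
  also have "\<dots> = (LBINT x. f (-h + x))"
  proof (cases "f \<in> borel_measurable borel")
    case True then show ?thesis by (subst integral_distr) auto
  next
    \<comment> \<open>If \<open>f\<close> is not measurable, neither integrand is integrable and
      both Bochner integrals take the default value 0.\<close>
    case False
    have "(\<lambda>x. f (-h + x)) \<notin> borel_measurable borel"
    proof
      assume "(\<lambda>x. f (-h + x)) \<in> borel_measurable borel"
      from measurable_compose[OF _ this, of "\<lambda>x. h + x" borel] False show False by simp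
    qed
    with False have "\<not> integrable (distr lborel borel ((+) (-h))) f"
      "\<not> integrable lborel (\<lambda>x. f (-h + x))"
      using borel_measurable_integrable by fastforce+
    then show ?thesis by (simp add: not_integrable_integral_eq)
  qed
  finally show ?thesis by (simp add: algebra_simps)
qed

lemma lborel_distr_uminus_euclidean: "distr lborel borel uminus = (lborel :: 'a::euclidean_space measure)"
proof -
  have "lborel = density (distr lborel borel (\<lambda>x::'a. 0 + (-1) *\<^sub>R x)) (\<lambda>_. ennreal (\<bar>-1\<bar> ^ DIM('a)))"
    using lborel_affine[of "-1" "0::'a"] by simp
  also have "\<dots> = distr lborel borel uminus"
    by (simp add: density_1)
  finally show ?thesis ..
qed

lemma lborel_integral_reflect:
  fixes f :: "'a::euclidean_space \<Rightarrow> real"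
  assumes [measurable]: "f \<in> borel_measurable borel"
  shows "(LBINT x. f (h - x)) = (LBINT x. f x)"
proof -
  have "(LBINT x. f x) = (\<integral>x. f x \<partial>distr lborel borel uminus)"
    by (simp add: lborel_distr_uminus_euclidean)
  also have "\<dots> = (LBINT x. f (- x))"
    by (subst integral_distr) auto
  also have "\<dots> = (LBINT x. f (- (x - h)))"
    by (rule lborel_integral_translate[symmetric])
  finally show ?thesis by simp
qed

lemma lborel_integral_scaleR:
  fixes f :: "'a::euclidean_space \<Rightarrow> real"
  assumes [measurable]: "f \<in> borel_measurable borel" and "c > 0"
  shows "(LBINT x. f x) = c ^ DIM('a) * (LBINT x. f (c *\<^sub>R x))"
proof -
  have "(LBINT x. f x) =
      (\<integral>x. f x \<partial>density (distr lborel borel (\<lambda>x. 0 + c *\<^sub>R x)) (\<lambda>_. ennreal (\<bar>c\<bar> ^ DIM('a))))"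
    using lborel_affine[of c "0::'a"] assms(2) by simp
  also have "\<dots> = c ^ DIM('a) * (LBINT x. f (c *\<^sub>R x))"
    using assms(2) by (subst integral_density) (auto simp: integral_distr)
  finally show ?thesis .
qed

section \<open>Cauchy-Schwarz and the L^2 norm\<close>

lemma bbs_Cauchy_Schwarz:
  assumes "bbs u" "bbs v"
  shows "(LBINT x. u x * v x)\<^sup>2 \<le> (LBINT x. (u x)\<^sup>2) * (LBINT x. (v x)\<^sup>2)"
proof -
  note [measurable] = assms[THEN bbs_borel]
  have 1: "(\<integral>\<^sup>+x. ennreal \<bar>u x\<bar> * ennreal \<bar>v x\<bar> \<partial>lborel)\<^sup>2
      \<le> (\<integral>\<^sup>+x. (ennreal \<bar>u x\<bar>)\<^sup>2 \<partial>lborel) * (\<integral>\<^sup>+x. (ennreal \<bar>v x\<bar>)\<^sup>2 \<partial>lborel)"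
    by (rule Cauchy_Schwarz_nn_integral) auto
  have 2: "(\<integral>\<^sup>+x. ennreal \<bar>u x\<bar> * ennreal \<bar>v x\<bar> \<partial>lborel) = ennreal (LBINT x. \<bar>u x\<bar> * \<bar>v x\<bar>)"
    by (subst nn_integral_eq_integral[symmetric]) (auto simp: ennreal_mult intro!: bbs_integrable bbs_mult bbs_abs assms)
  have 3: "(\<integral>\<^sup>+x. (ennreal \<bar>w x\<bar>)\<^sup>2 \<partial>lborel) = ennreal (LBINT x. (w x)\<^sup>2)" if "bbs w" for w
    by (subst nn_integral_eq_integral[symmetric]) (auto simp: ennreal_power intro!: bbs_integrable bbs_power2 that)
  have 4: "(LBINT x. \<bar>u x\<bar> * \<bar>v x\<bar>)\<^sup>2 \<le> (LBINT x. (u x)\<^sup>2) * (LBINT x. (v x)\<^sup>2)"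
    using 1 unfolding 2 3[OF assms(1)] 3[OF assms(2)]
    by (simp add: ennreal_power ennreal_mult'[symmetric] integral_nonneg_AE ennreal_le_iff)
  have "\<bar>LBINT x. u x * v x\<bar> \<le> (LBINT x. \<bar>u x * v x\<bar>)" by (rule integral_abs_bound)
  then have "(LBINT x. u x * v x)\<^sup>2 \<le> (LBINT x. \<bar>u x\<bar> * \<bar>v x\<bar>)\<^sup>2"
    by (intro power2_le_iff_abs_le[THEN iffD2]) (auto simp: abs_mult integral_nonneg_AE)
  with 4 show ?thesis by linarith
qed

definition norm2 :: "('a::euclidean_space \<Rightarrow> real) \<Rightarrow> real" where
  "norm2 w = sqrt (LBINT x. (w x)\<^sup>2)"

lemma norm2_nonneg: "0 \<le> norm2 w"
  by (simp add: norm2_def integral_nonneg_AE)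

lemma norm2_square: "(norm2 w)\<^sup>2 = (LBINT x. (w x)\<^sup>2)"
  by (simp add: norm2_def integral_nonneg_AE)

lemma norm2_translate: "norm2 (\<lambda>x. w (x - h)) = norm2 w"
  unfolding norm2_def by (subst lborel_integral_translate[of "\<lambda>x. (w x)\<^sup>2"]) simp

lemma bbs_inner_le_norm2:
  assumes "bbs u" "bbs v"
  shows "(LBINT x. u x * v x) \<le> norm2 u * norm2 v"
proof -
  have "(LBINT x. u x * v x)\<^sup>2 \<le> (norm2 u * norm2 v)\<^sup>2"
    using bbs_Cauchy_Schwarz[OF assms] by (simp add: power_mult_distrib norm2_square)
  then show ?thesis
    by (meson mult_nonneg_nonneg norm2_nonneg power2_le_imp_le)
qed

lemma norm2_triangle:
  assumes "bbs u" "bbs v"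
  shows "norm2 (\<lambda>x. u x + v x) \<le> norm2 u + norm2 v"
proof (rule power2_le_imp_le)
  have "(norm2 (\<lambda>x. u x + v x))\<^sup>2 = (LBINT x. (u x)\<^sup>2 + 2 * (u x * v x) + (v x)\<^sup>2)"
    unfolding norm2_square by (intro Bochner_Integration.integral_cong) (auto simp: power2_sum)
  also have "\<dots> = (norm2 u)\<^sup>2 + 2 * (LBINT x. u x * v x) + (norm2 v)\<^sup>2"
    unfolding norm2_square using assms
    by (simp add: bbs_integrable bbs_mult bbs_power2 bbs_add)
  also have "\<dots> \<le> (norm2 u + norm2 v)\<^sup>2"
    using bbs_inner_le_norm2[OF assms] by (simp add: power2_sum)
  finally show "(norm2 (\<lambda>x. u x + v x))\<^sup>2 \<le> (norm2 u + norm2 v)\<^sup>2" .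
qed (simp add: norm2_nonneg)

section \<open>Convolutions and translation differences\<close>

lemma bounded_measurable_fst:
  fixes u :: "'a::second_countable_topology \<Rightarrow> real"
  shows "bounded_measurable u \<Longrightarrow> bounded_measurable (\<lambda>z::'a\<times>'b::second_countable_topology. u (fst z))"
  by (rule bounded_measurable_compose) (auto simp flip: borel_prod)

lemma bounded_measurable_snd:
  fixes u :: "'b::second_countable_topology \<Rightarrow> real"
  shows "bounded_measurable u \<Longrightarrow> bounded_measurable (\<lambda>z::'a::second_countable_topology\<times>'b. u (snd z))"
  by (rule bounded_measurable_compose) (auto simp flip: borel_prod)

lemma bounded_measurable_fst_minus_snd:
  fixes u :: "'a::euclidean_space \<Rightarrow> real"
  shows "bounded_measurable u \<Longrightarrow> bounded_measurable (\<lambda>z::'a\<times>'a. u (fst z - snd z))"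
  by (rule bounded_measurable_compose) (auto simp flip: borel_prod)

lemma bounded_measurable_snd_minus_fst:
  fixes u :: "'a::euclidean_space \<Rightarrow> real"
  shows "bounded_measurable u \<Longrightarrow> bounded_measurable (\<lambda>z::'a\<times>'a. u (snd z - fst z))"
  by (rule bounded_measurable_compose) (auto simp flip: borel_prod)

lemmas bounded_measurable_intros =
  bounded_measurable_fst bounded_measurable_snd bounded_measurable_fst_minus_snd
  bounded_measurable_snd_minus_fst bounded_measurable_mult bounded_measurable_diff
  bounded_measurable_add bounded_measurable_power2 bounded_measurable_const bounded_measurable_abs

lemma bbs_pairI:
  fixes F :: "'a::euclidean_space \<Rightarrow> 'b::euclidean_space \<Rightarrow> real"
  assumes "bounded_measurable (\<lambda>z. F (fst z) (snd z))"
    and "\<And>x y. F x y \<noteq> 0 \<Longrightarrow> norm x \<le> R \<and> norm y \<le> S"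
  shows "bbs (\<lambda>(x,y). F x y)"
proof (rule bbsI)
  show "bounded_measurable (\<lambda>(x,y). F x y)" using assms(1) by (simp add: case_prod_unfold)
  show "bounded (cball (0::'a) R \<times> cball (0::'b) S)" by (intro bounded_Times) auto
  show "z \<in> cball 0 R \<times> cball 0 S" if "(\<lambda>(x,y). F x y) z \<noteq> 0" for z
    using that assms(2)[of "fst z" "snd z"] by (auto simp: case_prod_unfold mem_Times_iff)
qed

lemma bbs_Jensen:
  assumes "bbs r" "bounded_measurable G"
  shows "(LBINT y. r y * G y)\<^sup>2 \<le> (LBINT y. \<bar>r y\<bar>) * (LBINT y. \<bar>r y\<bar> * (G y)\<^sup>2)"
proof -
  note [measurable] = bbs_borel[OF assms(1)] bounded_measurable_borel[OF assms(2)]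
  obtain M where M: "M > 0" "\<And>x. \<bar>r x\<bar> \<le> M"
    using assms bbs_bounded_measurable bounded_measurableE by metis
  have u: "bbs (\<lambda>y. sqrt \<bar>r y\<bar>)"
  proof (rule bbsI)
    show "bounded_measurable (\<lambda>y. sqrt \<bar>r y\<bar>)"
      by (rule bounded_measurableI[of _ "sqrt M"]) (use M in auto)
    show "bounded {x. r x \<noteq> 0}" using assms by (simp add: bbs_def)
  qed auto
  have v: "bbs (\<lambda>y. sqrt \<bar>r y\<bar> * (sgn (r y) * G y))"
  proof (intro bbs_mult_bounded u bounded_measurable_mult assms)
    show "bounded_measurable (\<lambda>x. sgn (r x))"
      by (rule bounded_measurableI[of _ 1]) (auto simp: sgn_real_def)
  qed
  have e1: "sqrt \<bar>r y\<bar> * (sqrt \<bar>r y\<bar> * (sgn (r y) * G y)) = r y * G y" for y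
  proof -
    have "sqrt \<bar>r y\<bar> * (sqrt \<bar>r y\<bar> * (sgn (r y) * G y)) = \<bar>r y\<bar> * sgn (r y) * G y"
      by (simp flip: mult.assoc)
    then show ?thesis by (simp add: abs_mult_sgn)
  qed
  have e2: "(sqrt \<bar>r y\<bar> * (sgn (r y) * G y))\<^sup>2 = \<bar>r y\<bar> * (G y)\<^sup>2" for y
    by (cases "r y = 0") (auto simp: power_mult_distrib sgn_real_def)
  show ?thesis using bbs_Cauchy_Schwarz[OF u v] unfolding e1 e2 by simp
qed

definition conv :: "('a::euclidean_space \<Rightarrow> real) \<Rightarrow> ('a \<Rightarrow> real) \<Rightarrow> 'a \<Rightarrow> real" where
  "conv r w x = (LBINT y. r y * w (x - y))"

lemma bbs_conv_kernel:
  assumes "bbs r" "bbs w"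
  shows "bbs (\<lambda>(x,y). r y * w (x - y))"
proof -
  obtain R S where R: "\<And>x. r x \<noteq> 0 \<Longrightarrow> norm x \<le> R" and S: "\<And>x. w x \<noteq> 0 \<Longrightarrow> norm x \<le> S"
    using bbs_cball[OF assms(1)] bbs_cball[OF assms(2)] by metis
  show ?thesis
  proof (rule bbs_pairI)
    show "norm x \<le> R + S \<and> norm y \<le> R" if "r y * w (x - y) \<noteq> 0" for x y
      using that R[of y] S[of "x - y"] norm_triangle_ineq[of y "x - y"] by auto
  qed (intro bounded_measurable_intros bbs_bounded_measurable assms)
qed

lemma bbs_conv: "bbs r \<Longrightarrow> bbs w \<Longrightarrow> bbs (conv r w)"
  unfolding conv_def[abs_def] by (intro bbs_marginal bbs_conv_kernel)

lemma conv_commute: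
  assumes [measurable]: "r \<in> borel_measurable borel" "w \<in> borel_measurable borel"
  shows "conv r w x = (LBINT y. r (x - y) * w y)"
  unfolding conv_def
  by (subst lborel_integral_reflect[where h=x, symmetric]) (auto simp: algebra_simps)

lemma conv_translate: "conv r (\<lambda>x. w (x - h)) x = conv r w (x - h)"
  by (simp add: conv_def algebra_simps)

lemma conv_diff:
  assumes "bbs r" "bbs v" "bbs w"
  shows "conv r (\<lambda>x. v x - w x) x = conv r v x - conv r w x"
  unfolding conv_def
  using bbs_integrable[OF bbs_section[OF bbs_conv_kernel[OF assms(1,2)]]]
    bbs_integrable[OF bbs_section[OF bbs_conv_kernel[OF assms(1,3)]]]
  by (subst Bochner_Integration.integral_diff[symmetric]) (auto simp: right_diff_distrib)

lemma conv_kernel_square: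
  assumes "bbs r" "bbs w"
  shows "bbs (\<lambda>(x,y). \<bar>r y\<bar> * (w (x - y))\<^sup>2)"
  using bbs_conv_kernel[OF bbs_abs[OF assms(1)] bbs_power2[OF assms(2)]] .

text \<open>Young's inequality for an L^1 kernel acting on L^2: the weighted Jensen bound at each
  point, then Fubini and translation invariance.\<close>

lemma norm2_conv_le:
  assumes "bbs r" "bbs w"
  shows "norm2 (conv r w) \<le> (LBINT y. \<bar>r y\<bar>) * norm2 w"
proof (rule power2_le_imp_le)
  have "(norm2 (conv r w))\<^sup>2 \<le> (LBINT x. (LBINT y. \<bar>r y\<bar>) * (LBINT y. \<bar>r y\<bar> * (w (x - y))\<^sup>2))"
    unfolding norm2_square
  proof (rule integral_mono)
    show "(conv r w x)\<^sup>2 \<le> (LBINT y. \<bar>r y\<bar>) * (LBINT y. \<bar>r y\<bar> * (w (x - y))\<^sup>2)" for x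
      unfolding conv_def using assms by (intro bbs_Jensen bbs_bounded_measurable bbs_reflect)
  qed (use assms in \<open>auto intro!: bbs_integrable bbs_cmult bbs_marginal conv_kernel_square bbs_power2 bbs_conv\<close>)
  also have "\<dots> = (LBINT y. \<bar>r y\<bar>) * (LBINT y. (LBINT x. \<bar>r y\<bar> * (w (x - y))\<^sup>2))"
    by (simp add: bbs_Fubini[OF conv_kernel_square[OF assms]])
  also have "\<dots> = ((LBINT y. \<bar>r y\<bar>) * norm2 w)\<^sup>2"
    by (simp add: lborel_integral_translate[of "\<lambda>x. (w x)\<^sup>2"] power_mult_distrib norm2_square power2_eq_square[of "LBINT y. \<bar>r y\<bar>"])
  finally show "(norm2 (conv r w))\<^sup>2 \<le> ((LBINT y. \<bar>r y\<bar>) * norm2 w)\<^sup>2" .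
qed (simp add: norm2_nonneg)

text \<open>A substitute for the integral of (h . grad w)^2 that makes sense for functions that are
  merely bounded and measurable.\<close>

definition shift_energy :: "('a::euclidean_space \<Rightarrow> real) \<Rightarrow> 'a \<Rightarrow> real" where
  "shift_energy w h = (LBINT x. (w x - w (x - h))\<^sup>2)"

lemma shift_energy_norm2: "shift_energy w h = (norm2 (\<lambda>x. w x - w (x - h)))\<^sup>2"
  by (simp add: shift_energy_def norm2_square)

lemma shift_energy_nonneg: "0 \<le> shift_energy w h"
  by (simp add: shift_energy_norm2)

lemma bbs_shift_energy:
  assumes "bbs q" "bbs w"
  shows "bbs (\<lambda>(h,x). q h * (w x - w (x - h))\<^sup>2)"
proof -
  obtain R S where R: "\<And>x. q x \<noteq> 0 \<Longrightarrow> norm x \<le> R" and S: "\<And>x. w x \<noteq> 0 \<Longrightarrow> norm x \<le> S"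
    using bbs_cball[OF assms(1)] bbs_cball[OF assms(2)] by metis
  show ?thesis
  proof (rule bbs_pairI)
    show "norm h \<le> R \<and> norm x \<le> R + S" if "q h * (w x - w (x - h))\<^sup>2 \<noteq> 0" for x h
    proof -
      have "q h \<noteq> 0" "w x \<noteq> 0 \<or> w (x - h) \<noteq> 0" using that by auto
      then show ?thesis
        using R[of h] S[of "x - h"] S[of x] norm_triangle_ineq[of h "x - h"] norm_ge_zero[of h]
        by (auto simp del: norm_ge_zero)
    qed
  qed (intro bounded_measurable_intros bbs_bounded_measurable assms)
qed

lemma bbs_mult_shift_energy: "bbs q \<Longrightarrow> bbs w \<Longrightarrow> bbs (\<lambda>h. q h * shift_energy w h)"
  using bbs_marginal[OF bbs_shift_energy, of q w] by (simp add: shift_energy_def)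

text \<open>The difference over n h telescopes into n differences over h, all of the same norm by
  translation invariance. This carries control from the small radius of the kernel to the larger
  scale of the mollifier.\<close>

lemma norm2_shift_of_nat:
  assumes "bbs w"
  shows "norm2 (\<lambda>x. w x - w (x - real n *\<^sub>R h)) \<le> real n * norm2 (\<lambda>x. w x - w (x - h))"
proof (induction n)
  case 0 then show ?case by (simp add: norm2_def)
next
  case (Suc n)
  have "norm2 (\<lambda>x. w x - w (x - real (Suc n) *\<^sub>R h))
      = norm2 (\<lambda>x. (w x - w (x - h)) + (\<lambda>x. w x - w (x - real n *\<^sub>R h)) (x - h))"
    by (simp add: algebra_simps)
  also have "\<dots> \<le> norm2 (\<lambda>x. w x - w (x - h)) + norm2 (\<lambda>x. (\<lambda>x. w x - w (x - real n *\<^sub>R h)) (x - h))"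
    by (intro norm2_triangle bbs_translate[of "\<lambda>x. w x - w (x - real n *\<^sub>R h)"] bbs_diff bbs_translate[OF assms] assms)
  also have "\<dots> \<le> real (Suc n) * norm2 (\<lambda>x. w x - w (x - h))"
    unfolding norm2_translate[of "\<lambda>x. w x - w (x - real n *\<^sub>R h)"]
    using Suc by (simp add: algebra_simps)
  finally show ?case .
qed

lemma shift_energy_of_nat:
  assumes "bbs w"
  shows "shift_energy w (real n *\<^sub>R h) \<le> (real n)\<^sup>2 * shift_energy w h"
  unfolding shift_energy_norm2 power_mult_distrib[symmetric]
  by (intro power_mono norm2_shift_of_nat assms norm2_nonneg)

text \<open>Convolution commutes with translations, so Young's inequality can be applied to the
  difference w - w(. - h).\<close>

lemma shift_energy_conv_le:
  assumes "bbs r" "bbs w"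
  shows "shift_energy (conv r w) h \<le> (LBINT y. \<bar>r y\<bar>)\<^sup>2 * shift_energy w h"
proof -
  have "norm2 (\<lambda>x. conv r w x - conv r w (x - h)) = norm2 (conv r (\<lambda>x. w x - w (x - h)))"
    by (intro arg_cong[where f=norm2] ext)
      (use assms in \<open>simp add: conv_diff conv_translate bbs_translate\<close>)
  also have "\<dots> \<le> (LBINT y. \<bar>r y\<bar>) * norm2 (\<lambda>x. w x - w (x - h))"
    by (intro norm2_conv_le assms bbs_diff bbs_translate)
  finally show ?thesis
    unfolding shift_energy_norm2 power_mult_distrib[symmetric]
    by (intro power_mono norm2_nonneg)
qed

text \<open>Because \<open>r\<close> has mass 1, w - r * w is the \<open>r\<close>-average of the
  differences w - w(. - y); convexity of the square moves the average outside.\<close>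

lemma norm2_diff_conv_le:
  assumes "bbs r" "bbs w" and r: "\<And>y. 0 \<le> r y" "(LBINT y. r y) = 1"
  shows "(norm2 (\<lambda>x. w x - conv r w x))\<^sup>2 \<le> (LBINT y. r y * shift_energy w y)"
proof -
  have diff: "w x - conv r w x = (LBINT y. r y * (w x - w (x - y)))" for x
  proof -
    have "(LBINT y. r y * (w x - w (x - y))) = (LBINT y. r y * w x - r y * w (x - y))"
      by (simp add: right_diff_distrib)
    also have "\<dots> = (LBINT y. r y * w x) - conv r w x"
      unfolding conv_def
      by (intro Bochner_Integration.integral_diff integrable_mult_left bbs_integrable assms
          bbs_section[OF bbs_conv_kernel])
    finally show ?thesis using r by simp
  qed
  note B = bbs_swap[OF bbs_shift_energy[OF assms(1,2)]]
  have "(norm2 (\<lambda>x. w x - conv r w x))\<^sup>2 \<le> (LBINT x. (LBINT y. r y * (w x - w (x - y))\<^sup>2))"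
    unfolding norm2_square
  proof (rule integral_mono)
    show "(w x - conv r w x)\<^sup>2 \<le> (LBINT y. r y * (w x - w (x - y))\<^sup>2)" for x
      unfolding diff
      using bbs_Jensen[OF assms(1), of "\<lambda>y. w x - w (x - y)"] assms r
      by (simp add: bounded_measurable_intros bbs_bounded_measurable bbs_reflect)
  qed (use assms B in \<open>auto intro!: bbs_integrable bbs_marginal bbs_power2 bbs_diff bbs_conv\<close>)
  also have "\<dots> = (LBINT y. (LBINT x. r y * (w x - w (x - y))\<^sup>2))"
    by (rule bbs_Fubini[OF B])
  finally show ?thesis by (simp add: shift_energy_def)
qed

section \<open>Rayleigh quotients of restricted convolution operators\<close>

lemma Prekopa_Leindler_bbs:
  fixes F G H :: "'a::euclidean_space \<Rightarrow> real"
  assumes "bbs F" "bbs G" "bbs H" and nn: "\<And>x. 0 \<le> F x" "\<And>x. 0 \<le> G x" "\<And>x. 0 \<le> H x"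
    and FGH: "\<And>x y. F x * G y \<le> (H ((x + y) /\<^sub>R 2))\<^sup>2"
  shows "(LBINT x. F x) * (LBINT x. G x) \<le> (LBINT x. H x)\<^sup>2"
proof -
  note [measurable] = assms(1-3)[THEN bbs_borel]
  have "(\<integral>\<^sup>+x. ennreal (F x) \<partial>lborel) * (\<integral>\<^sup>+x. ennreal (G x) \<partial>lborel) \<le> (\<integral>\<^sup>+x. ennreal (H x) \<partial>lborel)\<^sup>2"
    by (rule Prekopa_Leindler) (use FGH nn in \<open>auto simp: ennreal_mult'[symmetric] ennreal_power intro!: ennreal_leI\<close>)
  then show ?thesis
    using nn by (simp add: nn_integral_eq_integral bbs_integrable assms(1-3) ennreal_mult'[symmetric]
      ennreal_power integral_nonneg_AE ennreal_le_iff)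
qed

text \<open>The iterates \<open>T\<^sub>K\<^sup>n w\<close> of the compressed convolution. Stage 0
  makes no cut, so lemmas on supports and inner products assume that the starting function vanishes
  off \<open>K\<close>.\<close>

primrec conv_iter :: "('a::euclidean_space \<Rightarrow> real) \<Rightarrow> 'a set \<Rightarrow> ('a \<Rightarrow> real) \<Rightarrow> nat \<Rightarrow> 'a \<Rightarrow> real" where
  "conv_iter k K w 0 = w"
| "conv_iter k K w (Suc n) = (\<lambda>x. indicator K x * conv k (conv_iter k K w n) x)"

lemma bbs_conv_iter:
  assumes "K \<in> sets borel" "bbs k" "bbs w"
  shows "bbs (conv_iter k K w n)"
proof (induction n)
  case (Suc n)
  have "bounded_measurable (indicator K)"
    using assms by (intro bounded_measurableI[of _ 1]) (auto simp: indicator_def)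
  then have "bbs (\<lambda>x. conv k (conv_iter k K w n) x * indicator K x)"
    by (intro bbs_mult_bounded bbs_conv Suc assms)
  then show ?case by (simp add: mult.commute)
qed (simp add: assms)

lemma conv_iter_support: "(\<And>x. x \<notin> K \<Longrightarrow> w x = 0) \<Longrightarrow> x \<notin> K \<Longrightarrow> conv_iter k K w n x = 0"
  by (cases n) auto

lemma conv_nonneg: "(\<And>x. 0 \<le> k x) \<Longrightarrow> (\<And>x. 0 \<le> w x) \<Longrightarrow> 0 \<le> conv k w x"
  unfolding conv_def by (intro integral_nonneg_AE) auto

lemma conv_mono:
  assumes "\<And>x. 0 \<le> k x" "bbs k" "bbs v" "bbs w" "\<And>x. v x \<le> w x"
  shows "conv k v x \<le> conv k w x"
  unfolding conv_def
  using assms by (intro integral_mono bbs_integrable bbs_section[OF bbs_conv_kernel] mult_left_mono) auto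

lemma conv_cmult: "conv k (\<lambda>x. c * w x) x = c * conv k w x"
  unfolding conv_def by (subst integral_mult_right_zero[symmetric]) (simp add: algebra_simps)

lemma conv_add:
  assumes "bbs r" "bbs v" "bbs w"
  shows "conv r (\<lambda>x. v x + w x) x = conv r v x + conv r w x"
  unfolding conv_def
  using bbs_integrable[OF bbs_section[OF bbs_conv_kernel[OF assms(1,2)]]]
    bbs_integrable[OF bbs_section[OF bbs_conv_kernel[OF assms(1,3)]]]
  by (subst Bochner_Integration.integral_add[symmetric]) (auto simp: distrib_left)

lemma conv_iter_nonneg: "(\<And>x. 0 \<le> k x) \<Longrightarrow> (\<And>x. 0 \<le> w x) \<Longrightarrow> 0 \<le> conv_iter k K w n x"
  by (induction n arbitrary: x) (auto simp: conv_nonneg)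

lemma conv_iter_mono:
  assumes "\<And>x. 0 \<le> k x" "bbs k" "bbs v" "bbs w" "\<And>x. v x \<le> w x" "K \<in> sets borel"
  shows "conv_iter k K v n x \<le> conv_iter k K w n x"
proof (induction n arbitrary: x)
  case (Suc n)
  then show ?case using assms
    by (auto simp: bbs_conv_iter intro!: mult_left_mono conv_mono)
qed (use assms in simp)

lemma conv_iter_cmult: "conv_iter k K (\<lambda>x. c * w x) n x = c * conv_iter k K w n x"
proof (induction n arbitrary: x)
  case (Suc n)
  then have "conv_iter k K (\<lambda>x. c * w x) n = (\<lambda>x. c * conv_iter k K w n x)" by auto
  then show ?case by (simp add: conv_cmult)
qed simp

text \<open>Evenness of the kernel makes k(x - y) symmetric in x and y; Fubini does the
  rest.\<close>

lemma conv_symmetric: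
  assumes "bbs k" "\<And>x. k (- x) = k x" "bbs u" "bbs v"
  shows "(LBINT x. u x * conv k v x) = (LBINT x. conv k u x * v x)"
proof -
  note [measurable] = assms(1,3,4)[THEN bbs_borel]
  have B: "bbs (\<lambda>(x,y). u x * (k (x - y) * v y))"
  proof -
    have "bbs (\<lambda>z. (\<lambda>(x,y). u x * v y) z * k (fst z - snd z))"
      by (intro bbs_mult_bounded bbs_tensor bounded_measurable_intros bbs_bounded_measurable assms)
    then show ?thesis by (simp add: case_prod_unfold mult_ac)
  qed
  have "(LBINT x. u x * conv k v x) = (LBINT x. (LBINT y. u x * (k (x - y) * v y)))"
    by (simp add: conv_commute)
  also have "\<dots> = (LBINT y. (LBINT x. u x * (k (x - y) * v y)))"
    by (rule bbs_Fubini[OF B])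
  also have "\<dots> = (LBINT y. (LBINT x. k (y - x) * u x) * v y)"
  proof (subst integral_mult_left_zero[symmetric], intro Bochner_Integration.integral_cong refl)
    show "u x * (k (x - y) * v y) = k (y - x) * u x * v y" for x y
      using assms(2)[of "x - y"] by simp
  qed
  finally show ?thesis by (simp add: conv_commute)
qed

lemma conv_iter_inner:
  assumes "bbs k" "\<And>x. k (- x) = k x" "bbs u" "K \<in> sets borel" "\<And>x. x \<notin> K \<Longrightarrow> u x = 0"
  shows "(LBINT x. conv_iter k K u i x * conv_iter k K u j x) = (LBINT x. u x * conv_iter k K u (i + j) x)"
proof (induction i arbitrary: j)
  case (Suc i)
  let ?w = "conv_iter k K u"
  note supp = conv_iter_support[of K u, OF assms(5)]
  have bbs: "bbs (?w n)" for n by (intro bbs_conv_iter assms)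
  have "(LBINT x. ?w (Suc i) x * ?w j x) = (LBINT x. conv k (?w i) x * ?w j x)"
    by (intro Bochner_Integration.integral_cong refl) (use supp in \<open>auto simp: indicator_def\<close>)
  also have "\<dots> = (LBINT x. ?w i x * conv k (?w j) x)"
    by (rule conv_symmetric[symmetric]) (use assms bbs in auto)
  also have "\<dots> = (LBINT x. ?w i x * ?w (Suc j) x)"
    by (intro Bochner_Integration.integral_cong refl) (use supp in \<open>auto simp: indicator_def\<close>)
  also have "\<dots> = (LBINT x. u x * ?w (i + Suc j) x)"
    by (rule Suc)
  finally show ?case by simp
qed simp

text \<open>The first hypothesis makes n \<mapsto> a(2n) log-convex, so the ratio a(2n + 2)/a(2n)
  never decreases. Its first value is at least \<rho>^2 because a(1)^2 \<le> a(0) a(2).\<close>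

lemma log_convex_growth:
  fixes a :: "nat \<Rightarrow> real"
  assumes cs: "\<And>i j. (a (i + j))\<^sup>2 \<le> a (2 * i) * a (2 * j)"
    and "0 < a 0" "\<rho> * a 0 \<le> a 1" "0 < \<rho>"
  shows "\<rho> ^ (2 * n) * a 0 \<le> a (2 * n)"
proof -
  have step: "0 < a (2 * n) \<and> \<rho>\<^sup>2 * a (2 * n) \<le> a (2 * Suc n)" for n
  proof (induction n)
    case 0
    have "a 0 * (\<rho>\<^sup>2 * a 0) = (\<rho> * a 0)\<^sup>2" by (simp add: power2_eq_square)
    also have "\<dots> \<le> (a 1)\<^sup>2" using assms by (intro power_mono) auto
    also have "\<dots> \<le> a 0 * a 2" using cs[of 0 1] by simp
    finally show ?case using assms by (simp add: eval_nat_numeral)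
  next
    case (Suc n)
    have "0 < \<rho>\<^sup>2 * a (2 * n)" using Suc \<open>0 < \<rho>\<close> by simp
    with Suc have pos: "0 < a (2 * Suc n)" "0 < a (2 * n)"
      by (blast intro: less_le_trans)+
    have "a (2 * n) * (\<rho>\<^sup>2 * a (2 * Suc n)) = (\<rho>\<^sup>2 * a (2 * n)) * a (2 * Suc n)" by simp
    also have "\<dots> \<le> a (2 * Suc n) * a (2 * Suc n)" using Suc pos by (intro mult_right_mono) auto
    also have "\<dots> = (a (n + Suc (Suc n)))\<^sup>2" by (simp add: power2_eq_square mult_2)
    also have "\<dots> \<le> a (2 * n) * a (2 * Suc (Suc n))" by (rule cs)
    finally show ?case using pos by simp
  qed
  show ?thesis
  proof (induction n)
    case (Suc n)
    have "\<rho> ^ (2 * Suc n) * a 0 = \<rho>\<^sup>2 * (\<rho> ^ (2 * n) * a 0)" by (simp add: power2_eq_square)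
    also have "\<dots> \<le> \<rho>\<^sup>2 * a (2 * n)" using Suc by (intro mult_left_mono) auto
    also have "\<dots> \<le> a (2 * Suc n)" using step by blast
    finally show ?case .
  qed simp
qed

text \<open>Otherwise s would be bounded by a multiple of \<sigma>^(2j), which is too small for
  growth at the rate \<rho>^(2j). A single good index replaces a passage to the limit.\<close>

lemma growth_ratio:
  fixes s :: "nat \<Rightarrow> real"
  assumes "\<And>j. c * \<rho> ^ (2 * j) \<le> s j" "0 < c" "0 < \<sigma>" "\<sigma> < \<rho>"
  shows "\<exists>j. \<sigma>\<^sup>2 * s j \<le> s (Suc j)"
proof (rule ccontr)
  assume "\<not> ?thesis"
  then have less: "s (Suc j) \<le> \<sigma>\<^sup>2 * s j" for j by (meson not_le less_imp_le)
  have "s j \<le> \<sigma> ^ (2 * j) * s 0" for j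
  proof (induction j)
    case (Suc j)
    have "\<sigma>\<^sup>2 * s j \<le> \<sigma>\<^sup>2 * (\<sigma> ^ (2 * j) * s 0)" using Suc by (intro mult_left_mono) auto
    with less[of j] show ?case by (simp add: power2_eq_square)
  qed simp
  then have "c * \<rho> ^ (2 * j) \<le> \<sigma> ^ (2 * j) * s 0" for j using assms(1) order_trans by blast
  then have bound: "((\<rho> / \<sigma>)\<^sup>2) ^ j \<le> s 0 / c" for j
    using assms by (simp add: power_divide field_simps flip: power_mult)
  have "1 < (\<rho> / \<sigma>)\<^sup>2" using assms by (simp add: one_less_power)
  then obtain j where "s 0 / c < ((\<rho> / \<sigma>)\<^sup>2) ^ j" using real_arch_pow by blast
  with bound[of j] show False by simp
qed

text \<open>The Prekopa-Leindler hypothesis reproduces itself: applied in z to the products of k(x -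
  z) with the n-th iterates, the inequality yields the same midpoint relation for the next iterates.
  The midpoint inclusion of the three sets starts the induction.\<close>

lemma conv_iter_midpoint:
  fixes K0 K1 K2 :: "'a::euclidean_space set"
  assumes k: "bbs k" "\<And>x. 0 \<le> k x" "\<And>x y. k x * k y \<le> (k ((x + y) /\<^sub>R 2))\<^sup>2"
    and K: "K0 \<in> sets borel" "K1 \<in> sets borel" "K2 \<in> sets borel" "bounded K0" "bounded K1" "bounded K2"
    and mid: "\<And>x y. x \<in> K1 \<Longrightarrow> y \<in> K2 \<Longrightarrow> (x + y) /\<^sub>R 2 \<in> K0"
  shows "conv_iter k K1 (indicator K1) n x * conv_iter k K2 (indicator K2) n y
    \<le> (conv_iter k K0 (indicator K0) n ((x + y) /\<^sub>R 2))\<^sup>2"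
proof (induction n arbitrary: x y)
  case 0
  then show ?case using mid by (auto simp: indicator_def)
next
  case (Suc n)
  let ?w = "\<lambda>K. conv_iter k K (indicator K) n"
  have bbs: "bbs (?w K)" if "K \<in> sets borel" "bounded K" for K
    using that k by (intro bbs_conv_iter bbs_indicator)
  have nn: "0 \<le> ?w K x" for K x using k by (intro conv_iter_nonneg) auto
  have comm: "conv k (?w K) x = (LBINT z. k (x - z) * ?w K z)" if "K \<in> sets borel" "bounded K" for K x
    by (rule conv_commute[OF bbs_borel[OF k(1)] bbs_borel[OF bbs[OF that]]])
  show ?case
  proof (cases "x \<in> K1 \<and> y \<in> K2")
    case True
    have "(LBINT z. k (x - z) * ?w K1 z) * (LBINT z. k (y - z) * ?w K2 z)
        \<le> (LBINT z. k ((x + y) /\<^sub>R 2 - z) * ?w K0 z)\<^sup>2"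
    proof (rule Prekopa_Leindler_bbs)
      fix z z'
      have "(x + y) /\<^sub>R 2 - (z + z') /\<^sub>R 2 = ((x - z) + (y - z')) /\<^sub>R 2"
        by (simp add: algebra_simps)
      then have "k (x - z) * k (y - z') \<le> (k ((x + y) /\<^sub>R 2 - (z + z') /\<^sub>R 2))\<^sup>2"
        using k(3)[of "x - z" "y - z'"] by simp
      then have "(k (x - z) * k (y - z')) * (?w K1 z * ?w K2 z')
          \<le> (k ((x + y) /\<^sub>R 2 - (z + z') /\<^sub>R 2))\<^sup>2 * (?w K0 ((z + z') /\<^sub>R 2))\<^sup>2"
        using Suc[of z z'] k(2) nn by (intro mult_mono) auto
      then show "k (x - z) * ?w K1 z * (k (y - z') * ?w K2 z')
          \<le> (k ((x + y) /\<^sub>R 2 - (z + z') /\<^sub>R 2) * ?w K0 ((z + z') /\<^sub>R 2))\<^sup>2"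
        by (simp add: power_mult_distrib mult_ac)
    qed (use k nn K bbs in \<open>auto intro!: bbs_mult bbs_reflect\<close>)
    then show ?thesis using True mid K by (simp add: comm del: scaleR_half_double)
  qed auto
qed

lemma conv_iter_uminus:
  assumes "bbs k" "\<And>x. k (- x) = k x" "K \<in> sets borel" "bounded K"
  shows "conv_iter k (uminus ` K) (indicator (uminus ` K)) n x = conv_iter k K (indicator K) n (- x)"
proof (induction n arbitrary: x)
  case 0
  then show ?case by (auto simp: indicator_def image_iff) (metis minus_minus)
next
  case (Suc n)
  let ?w = "conv_iter k K (indicator K) n"
  have w: "bbs ?w" using assms by (intro bbs_conv_iter bbs_indicator)
  note [measurable] = assms(1)[THEN bbs_borel] w[THEN bbs_borel]
  have "conv_iter k (uminus ` K) (indicator (uminus ` K)) n = (\<lambda>x. ?w (- x))" using Suc by auto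
  moreover have "conv k (\<lambda>x. ?w (- x)) x = conv k ?w (- x)"
  proof -
    have "conv k (\<lambda>x. ?w (- x)) x = (LBINT y. k y * ?w (- (x - y)))" by (simp add: conv_def)
    also have "\<dots> = (LBINT y. k (0 - y) * ?w (- (x - (0 - y))))"
      by (rule lborel_integral_reflect[symmetric]) measurable
    finally show ?thesis by (simp add: conv_def assms)
  qed
  moreover have "indicator (uminus ` K) x = (indicator K (- x) :: real)"
    by (auto simp: indicator_def image_iff) (metis minus_minus)
  ultimately show ?case by simp
qed

text \<open>With the reflected set -K1 as partner of K1 both factors on the left are the same
  moment, so the product inequality becomes one between squares. The difference in the midpoint
  condition accounts for the reflection.\<close>

lemma conv_iter_integral_le:
  fixes K0 K1 :: "'a::euclidean_space set"
  assumes k: "bbs k" "\<And>x. 0 \<le> k x" "\<And>x y. k x * k y \<le> (k ((x + y) /\<^sub>R 2))\<^sup>2" "\<And>x. k (- x) = k x"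
    and K: "compact K0" "compact K1"
    and mid: "\<And>x y. x \<in> K1 \<Longrightarrow> y \<in> K1 \<Longrightarrow> (x - y) /\<^sub>R 2 \<in> K0"
  shows "(LBINT x. conv_iter k K1 (indicator K1) n x) \<le> (LBINT x. conv_iter k K0 (indicator K0) n x)"
proof -
  let ?I = "\<lambda>K. LBINT x. conv_iter k K (indicator K) n x"
  let ?K2 = "uminus ` K1"
  have K2: "compact ?K2" using K by (rule_tac compact_continuous_image) (auto intro: continuous_intros)
  have sets: "K \<in> sets borel" "bounded K" if "compact K" for K :: "'a set"
    using that by (auto simp: borel_compact compact_imp_bounded)
  have nn: "0 \<le> ?I K" for K using k by (intro integral_nonneg_AE AE_I2 conv_iter_nonneg) auto
  have b: "bbs (conv_iter k K (indicator K) n)" if "compact K" for K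
    using that sets k by (intro bbs_conv_iter bbs_indicator)
  have "?I K1 * ?I ?K2 \<le> (?I K0)\<^sup>2"
  proof (rule Prekopa_Leindler_bbs)
    show "conv_iter k K1 (indicator K1) n x * conv_iter k ?K2 (indicator ?K2) n y
      \<le> (conv_iter k K0 (indicator K0) n ((x + y) /\<^sub>R 2))\<^sup>2" for x y
      using mid by (intro conv_iter_midpoint k sets K K2) auto
  qed (use k in \<open>auto intro!: b K K2 conv_iter_nonneg\<close>)
  moreover have "?I ?K2 = ?I K1"
  proof -
    note [measurable] = b[OF K(2), THEN bbs_borel]
    have "?I ?K2 = (LBINT x. conv_iter k K1 (indicator K1) n (0 - x))"
      using K sets k by (simp add: conv_iter_uminus)
    also have "\<dots> = ?I K1" by (rule lborel_integral_reflect) measurable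
    finally show ?thesis .
  qed
  ultimately have "(?I K1)\<^sup>2 \<le> (?I K0)\<^sup>2" by (simp add: power2_eq_square)
  then show ?thesis using nn power2_le_imp_le by blast
qed

text \<open>The vector \<open>w = (T + \<sigma>) T\<^sup>j 1\<close> satisfies \<open>\<langle>w, (T - \<sigma>) w\<rangle> = \<langle>T\<^sup>j 1, (T + \<sigma>) (T\<^sup>2 - \<sigma>\<^sup>2) T\<^sup>j 1\<rangle>\<close>, which
  is nonnegative for some \<open>j\<close> as the moments \<open>\<langle>1, T\<^sup>n 1\<rangle>\<close> grow at least like \<open>\<rho>\<^sup>n\<close> along even \<open>n\<close>.\<close>

lemma conv_Rayleigh_transfer:
  fixes K0 K1 :: "'a::euclidean_space set"
  assumes k: "bbs k" "\<And>x. 0 \<le> k x" "\<And>x y. k x * k y \<le> (k ((x + y) /\<^sub>R 2))\<^sup>2" "\<And>x. k (- x) = k x"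
    and K: "compact K0" "compact K1"
    and mid: "\<And>x y. x \<in> K1 \<Longrightarrow> y \<in> K1 \<Longrightarrow> (x - y) /\<^sub>R 2 \<in> K0"
    and u: "bbs u" "\<And>x. 0 \<le> u x" "\<And>x. x \<notin> K1 \<Longrightarrow> u x = 0" "0 < (LBINT x. (u x)\<^sup>2)"
      "\<rho> * (LBINT x. (u x)\<^sup>2) \<le> (LBINT x. u x * conv k u x)"
    and \<sigma>: "0 < \<sigma>" "\<sigma> < \<rho>"
  obtains w where "bbs w" "\<And>x. 0 \<le> w x" "\<And>x. x \<notin> K0 \<Longrightarrow> w x = 0" "0 < (LBINT x. (w x)\<^sup>2)"
      "\<sigma> * (LBINT x. (w x)\<^sup>2) \<le> (LBINT x. w x * conv k w x)"
proof -
  have sets: "K \<in> sets borel" "bounded K" if "compact K" for K :: "'a set"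
    using that by (auto simp: borel_compact compact_imp_bounded)
  obtain M where M: "M > 0" "\<And>x. \<bar>u x\<bar> \<le> M"
    using u bbs_bounded_measurable bounded_measurableE by metis
  have uM: "u x \<le> M * indicator K1 x" for x
    using M(2)[of x] u(3)[of x] by (auto simp: indicator_def)
  let ?v = "\<lambda>K. conv_iter k K (indicator K)"
  have bv: "bbs (?v K n)" if "compact K" for K n
    using that sets k by (intro bbs_conv_iter bbs_indicator)
  have bu: "bbs (conv_iter k K1 u n)" for n
    using K sets k u by (intro bbs_conv_iter)
  have vn: "0 \<le> ?v K n x" for K n x using k by (intro conv_iter_nonneg) auto
  have vs: "?v K n x = 0" if "x \<notin> K" for K n x using that by (intro conv_iter_support) auto

  define a where "a n = (LBINT x. u x * conv_iter k K1 u n x)" for n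
  have a_inner: "(LBINT x. conv_iter k K1 u i x * conv_iter k K1 u j x) = a (i + j)" for i j
    unfolding a_def by (rule conv_iter_inner) (use k u K sets in auto)
  have a0: "a 0 = (LBINT x. (u x)\<^sup>2)" by (simp add: a_def power2_eq_square)
  have a1: "a 1 = (LBINT x. u x * conv k u x)"
    unfolding a_def by (intro Bochner_Integration.integral_cong refl) (use u in \<open>auto simp: indicator_def\<close>)
  have growth: "\<rho> ^ (2 * n) * a 0 \<le> a (2 * n)" for n
  proof (rule log_convex_growth)
    show "(a (i + j))\<^sup>2 \<le> a (2 * i) * a (2 * j)" for i j
      using bbs_Cauchy_Schwarz[OF bu[of i] bu[of j]]
      by (simp add: a_inner power2_eq_square mult_2)
  qed (use a0 a1 u \<sigma> in auto)

  define b where "b n = (LBINT x. ?v K0 n x)" for n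
  have b_inner: "(LBINT x. ?v K0 i x * ?v K0 j x) = b (i + j)" for i j
  proof -
    have "(LBINT x. ?v K0 i x * ?v K0 j x) = (LBINT x. indicator K0 x * ?v K0 (i + j) x)"
      by (rule conv_iter_inner) (use k K sets in \<open>auto intro: bbs_indicator\<close>)
    also have "\<dots> = b (i + j)" unfolding b_def
      by (intro Bochner_Integration.integral_cong refl) (use vs in \<open>auto simp: indicator_def\<close>)
    finally show ?thesis .
  qed
  have b_nonneg: "0 \<le> b n" for n unfolding b_def using vn by (intro integral_nonneg_AE) auto
  \<comment> \<open>Positivity of the kernel lets M times the indicator of K1 dominate u under all
    iterates; the comparison of moments then exchanges K1 for K0.\<close>
  have ab: "a n \<le> M\<^sup>2 * b n" for n
  proof -
    have "a n \<le> (LBINT x. M\<^sup>2 * ?v K1 n x)"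
      unfolding a_def
    proof (rule integral_mono)
      fix x
      have "conv_iter k K1 u n x \<le> conv_iter k K1 (\<lambda>x. M * indicator K1 x) n x"
        using k u K uM sets by (intro conv_iter_mono bbs_cmult bbs_indicator) auto
      then have 1: "conv_iter k K1 u n x \<le> M * ?v K1 n x" by (simp add: conv_iter_cmult)
      have "u x * conv_iter k K1 u n x \<le> M * (M * ?v K1 n x)"
        using 1 u(2)[of x] M(2)[of x] M(1) vn[where n=n and K=K1 and x=x] conv_iter_nonneg[where k=k and w=u and n=n and K=K1 and x=x] k u
        by (intro mult_mono) auto
      then show "u x * conv_iter k K1 u n x \<le> M\<^sup>2 * ?v K1 n x" by (simp add: power2_eq_square)
    qed (use u bu bv K in \<open>auto intro!: bbs_integrable bbs_mult bbs_cmult\<close>)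
    also have "\<dots> \<le> M\<^sup>2 * b n"
      unfolding b_def using conv_iter_integral_le[OF k K mid] by (simp add: mult_left_mono)
    finally show ?thesis .
  qed

  \<comment> \<open>This is \<langle>v, (T + \<sigma>) v\<rangle> for v =
    \<open>T\<^sup>j 1\<close>, so the inner product to be made nonnegative is s (j + 1) -
    \<sigma>^2 s j.\<close>
  define s where "s j = b (2 * j + 1) + \<sigma> * b (2 * j)" for j
  have "\<exists>j. \<sigma>\<^sup>2 * s j \<le> s (Suc j)"
  proof (rule growth_ratio)
    \<comment> \<open>The constant comes from the term \<sigma> b(2j) alone; of the odd moment only
      nonnegativity is used.\<close>
    show "0 < \<sigma> * a 0 / M\<^sup>2" using \<sigma> M u a0 by simp
    show "\<sigma> * a 0 / M\<^sup>2 * \<rho> ^ (2 * j) \<le> s j" for j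
    proof -
      have "a 0 * \<rho> ^ (2 * j) \<le> M\<^sup>2 * b (2 * j)"
        using growth[of j] ab[of "2 * j"] by (simp add: mult.commute)
      then have "a 0 * \<rho> ^ (2 * j) / M\<^sup>2 \<le> b (2 * j)" using M by (simp add: field_simps)
      then have "\<sigma> * (a 0 * \<rho> ^ (2 * j) / M\<^sup>2) \<le> \<sigma> * b (2 * j)" using \<sigma> by (intro mult_left_mono) auto
      then show ?thesis using b_nonneg[of "2 * j + 1"] by (simp add: s_def)
    qed
  qed (use \<sigma> in auto)
  then obtain j where j: "\<sigma>\<^sup>2 * s j \<le> s (Suc j)" by blast
  have bpos: "0 < b (2 * j)"
  proof -
    have "0 < \<rho> ^ (2 * j) * a 0" using \<sigma> a0 u by simp
    also have "\<dots> \<le> M\<^sup>2 * b (2 * j)" using growth ab order_trans by blast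
    finally show ?thesis using M by (simp add: zero_less_mult_iff)
  qed
  let ?w = "\<lambda>x. ?v K0 (Suc j) x + \<sigma> * ?v K0 j x"
  have ii: "integrable lborel (\<lambda>x. ?v K0 i x * ?v K0 l x)" for i l
    using bv K by (intro bbs_integrable bbs_mult)
  have sq: "(LBINT x. (?w x)\<^sup>2) = b (2 * j + 2) + 2 * \<sigma> * b (2 * j + 1) + \<sigma>\<^sup>2 * b (2 * j)"
  proof -
    have "(LBINT x. (?w x)\<^sup>2) = (LBINT x. ?v K0 (Suc j) x * ?v K0 (Suc j) x
        + 2 * \<sigma> * (?v K0 (Suc j) x * ?v K0 j x) + \<sigma>\<^sup>2 * (?v K0 j x * ?v K0 j x))"
      by (intro Bochner_Integration.integral_cong refl) (simp add: power2_eq_square algebra_simps del: conv_iter.simps)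
    also have "\<dots> = b (Suc j + Suc j) + 2 * \<sigma> * b (Suc j + j) + \<sigma>\<^sup>2 * b (j + j)"
      by (simp add: ii b_inner del: conv_iter.simps)
    also have "Suc j + Suc j = 2 * j + 2" by simp
    also have "Suc j + j = 2 * j + 1" by simp
    also have "j + j = 2 * j" by simp
    finally show ?thesis .
  qed
  have form: "(LBINT x. ?w x * conv k ?w x) = b (2 * j + 3) + 2 * \<sigma> * b (2 * j + 2) + \<sigma>\<^sup>2 * b (2 * j + 1)"
  proof -
    have conv_w: "conv k ?w x = conv k (?v K0 (Suc j)) x + \<sigma> * conv k (?v K0 j) x" for x
      using k bv K by (simp add: conv_add bbs_cmult conv_cmult del: conv_iter.simps)
    have "(LBINT x. ?w x * conv k ?w x) = (LBINT x. ?w x * (?v K0 (Suc (Suc j)) x + \<sigma> * ?v K0 (Suc j) x))"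
    proof (intro Bochner_Integration.integral_cong refl)
      show "?w x * conv k ?w x = ?w x * (?v K0 (Suc (Suc j)) x + \<sigma> * ?v K0 (Suc j) x)" for x
        using vs[of x K0 "Suc j"] vs[of x K0 j] conv_w[of x] by (cases "x \<in> K0") auto
    qed
    also have "\<dots> = (LBINT x. ?v K0 (Suc j) x * ?v K0 (Suc (Suc j)) x + \<sigma> * (?v K0 (Suc j) x * ?v K0 (Suc j) x)
        + \<sigma> * (?v K0 j x * ?v K0 (Suc (Suc j)) x) + \<sigma>\<^sup>2 * (?v K0 j x * ?v K0 (Suc j) x))"
      by (intro Bochner_Integration.integral_cong refl) (simp add: power2_eq_square algebra_simps del: conv_iter.simps)
    also have "\<dots> = b (Suc j + Suc (Suc j)) + \<sigma> * b (Suc j + Suc j) + \<sigma> * b (j + Suc (Suc j)) + \<sigma>\<^sup>2 * b (j + Suc j)"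
      by (simp add: ii b_inner del: conv_iter.simps)
    also have "j + Suc (Suc j) = 2 * j + 2" by simp
    also have "Suc j + Suc (Suc j) = 2 * j + 3" by simp
    also have "Suc j + Suc j = 2 * j + 2" by simp
    also have "j + Suc j = 2 * j + 1" by simp
    finally show ?thesis by linarith
  qed
  show thesis
  proof (rule that)
    show "bbs ?w" using bv K by (intro bbs_add bbs_cmult)
    show "0 \<le> ?w x" for x using vn[where n="Suc j" and K=K0 and x=x] vn[where n=j and K=K0 and x=x] \<sigma> by (simp del: conv_iter.simps)
    show "?w x = 0" if "x \<notin> K0" for x using vs[OF that] by (simp del: conv_iter.simps)
    have "0 < \<sigma>\<^sup>2 * b (2 * j)" using bpos \<sigma> by simp
    then show "0 < (LBINT x. (?w x)\<^sup>2)"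
      unfolding sq using b_nonneg[of "2*j+2"] b_nonneg[of "2*j+1"] \<sigma> mult_nonneg_nonneg[of "2*\<sigma>" "b (2*j+1)"] by linarith
    have "\<sigma>\<^sup>2 * (b (2 * j + 1) + \<sigma> * b (2 * j)) \<le> b (2 * j + 3) + \<sigma> * b (2 * j + 2)"
      using j by (simp add: s_def eval_nat_numeral)
    then show "\<sigma> * (LBINT x. (?w x)\<^sup>2) \<le> (LBINT x. ?w x * conv k ?w x)"
      unfolding sq form by (simp add: algebra_simps power2_eq_square)
  qed
qed

section \<open>Autocorrelations and averaging over translations\<close>

definition autocorrelation :: "('a::euclidean_space \<Rightarrow> real) \<Rightarrow> 'a \<Rightarrow> real" where
  "autocorrelation w h = (LBINT x. w x * w (x - h))"

lemma shift_energy_autocorrelation: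
  assumes "bbs w"
  shows "shift_energy w h = 2 * (LBINT x. (w x)\<^sup>2) - 2 * autocorrelation w h"
proof -
  have "shift_energy w h = (LBINT x. (w x)\<^sup>2 + (w (x - h))\<^sup>2 - 2 * (w x * w (x - h)))"
    unfolding shift_energy_def by (intro Bochner_Integration.integral_cong refl) (simp add: power2_diff)
  also have "\<dots> = (LBINT x. (w x)\<^sup>2) + (LBINT x. (w (x - h))\<^sup>2) - 2 * autocorrelation w h"
    unfolding autocorrelation_def
    by (simp add: bbs_integrable bbs_power2 bbs_translate bbs_mult bbs_add assms)
  finally show ?thesis by (simp add: lborel_integral_translate[of "\<lambda>x. (w x)\<^sup>2"])
qed

lemma conv_inner_autocorrelation:
  assumes "bbs k" "bbs w"
  shows "bbs (\<lambda>h. k h * autocorrelation w h)"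
    and "(LBINT x. w x * conv k w x) = (LBINT h. k h * autocorrelation w h)"
proof -
  have B: "bbs (\<lambda>(h,x). k h * (w x * w (x - h)))"
  proof -
    have "bbs (\<lambda>z. (\<lambda>(h,x). k h * w x) z * w (snd z - fst z))"
      by (intro bbs_mult_bounded bbs_tensor bounded_measurable_intros bbs_bounded_measurable assms)
    then show ?thesis by (simp add: case_prod_unfold mult_ac)
  qed
  show "bbs (\<lambda>h. k h * autocorrelation w h)"
    using bbs_marginal[OF B] by (simp add: autocorrelation_def)
  have "(LBINT x. w x * conv k w x) = (LBINT x. (LBINT h. k h * (w x * w (x - h))))"
    unfolding conv_def
    by (subst integral_mult_right_zero[symmetric]) (simp add: mult_ac)
  also have "\<dots> = (LBINT h. (LBINT x. k h * (w x * w (x - h))))"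
    by (rule bbs_Fubini[OF bbs_swap[OF B]])
  finally show "(LBINT x. w x * conv k w x) = (LBINT h. k h * autocorrelation w h)"
    by (simp add: autocorrelation_def)
qed

lemma conv_inner_shift_energy:
  assumes "bbs k" "bbs w"
  shows "(LBINT x. w x * conv k w x)
    = (LBINT h. k h) * (LBINT x. (w x)\<^sup>2) - (LBINT h. k h * shift_energy w h) / 2"
proof -
  have "(LBINT x. w x * conv k w x) =
      (LBINT h. k h * (LBINT x. (w x)\<^sup>2) - k h * shift_energy w h / 2)"
  proof -
    have "k h * autocorrelation w h = k h * (LBINT x. (w x)\<^sup>2) - k h * shift_energy w h / 2" for h
      by (simp add: shift_energy_autocorrelation assms field_simps)
    then show ?thesis unfolding conv_inner_autocorrelation(2)[OF assms] by simp
  qed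
  also have "\<dots> = (LBINT h. k h) * (LBINT x. (w x)\<^sup>2) - (LBINT h. k h * shift_energy w h) / 2"
    using integrable_divide[OF bbs_integrable[OF bbs_mult_shift_energy[OF assms]], of 2]
      integrable_mult_left[OF bbs_integrable[OF assms(1)], of "LBINT x. (w x)\<^sup>2"]
    by (subst Bochner_Integration.integral_diff) auto
  finally show ?thesis .
qed

text \<open>A finite-difference form of Lieb's argument: averaging the Rayleigh quotients of the products
  \<open>f(y) g(y - x)\<close> over all translations \<open>x\<close>.\<close>

lemma Lieb_translation:
  fixes f g :: "'a::euclidean_space \<Rightarrow> real"
  assumes "bbs k" "\<And>x. 0 \<le> k x" "bbs f" "bbs g"
    and fg: "(LBINT x. (f x)\<^sup>2) = 1" "(LBINT x. (g x)\<^sup>2) = 1"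
    and \<rho>: "\<rho> < (LBINT h. k h) - ((LBINT h. k h * shift_energy f h) + (LBINT h. k h * shift_energy g h)) / 2"
  obtains x where "0 < (LBINT y. (f y * g (y - x))\<^sup>2)"
    "\<rho> * (LBINT y. (f y * g (y - x))\<^sup>2)
      \<le> (LBINT y. (f y * g (y - x)) * conv k (\<lambda>y. f y * g (y - x)) y)"
proof -
  define u where "u x y = f y * g (y - x)" for x y
  have bu: "bbs (u x)" for x unfolding u_def[abs_def] by (intro bbs_mult bbs_translate assms)
  obtain R S where R: "\<And>x. f x \<noteq> 0 \<Longrightarrow> norm x \<le> R" and S: "\<And>x. g x \<noteq> 0 \<Longrightarrow> norm x \<le> S"
    using bbs_cball[OF assms(3)] bbs_cball[OF assms(4)] by metis
  have bfh: "bbs (\<lambda>y. f y * f (y - h))" "bbs (\<lambda>y. g y * g (y - h))" for h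
    by (intro bbs_mult bbs_translate assms)+
  have B: "bbs (\<lambda>(x,y). (f y * f (y - h)) * (g (y - x) * g ((y - x) - h)))" for h
  proof (rule bbs_pairI)
    show "norm x \<le> R + S \<and> norm y \<le> R" if "f y * f (y - h) * (g (y - x) * g (y - x - h)) \<noteq> 0" for x y
      using that R[of y] S[of "y - x"] norm_triangle_ineq4[of y "y - x"] by auto
    have "bounded_measurable (\<lambda>z::'a\<times>'a. (\<lambda>y. f y * f (y - h)) (snd z) * (\<lambda>y. g y * g (y - h)) (snd z - fst z))"
      by (intro bounded_measurable_intros(2,4,5) bbs_bounded_measurable bfh)
    then show "bounded_measurable (\<lambda>z::'a\<times>'a. f (snd z) * f (snd z - h) * (g (snd z - fst z) * g (snd z - fst z - h)))"
      by simp
  qed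
  have corr_eq: "autocorrelation (u x) h = (LBINT y. (f y * f (y - h)) * (g (y - x) * g ((y - x) - h)))" for x h
    unfolding autocorrelation_def u_def
    by (intro Bochner_Integration.integral_cong refl) (simp add: algebra_simps)
  have bcorr: "bbs (\<lambda>x. autocorrelation (u x) h)" for h
    unfolding corr_eq by (rule bbs_marginal[OF B])
  \<comment> \<open>Integrating in x first, with y - x as the new variable, decouples the factors of
    f from those of g.\<close>
  have avg: "(LBINT x. autocorrelation (u x) h) = autocorrelation f h * autocorrelation g h" for h
  proof -
    note [measurable] = bfh[THEN bbs_borel]
    have "(LBINT x. autocorrelation (u x) h) =
        (LBINT y. (LBINT x. (f y * f (y - h)) * (g (y - x) * g ((y - x) - h))))"
      unfolding corr_eq by (rule bbs_Fubini[OF B])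
    also have "\<dots> = (LBINT y. (f y * f (y - h)) * autocorrelation g h)"
    proof (intro Bochner_Integration.integral_cong refl)
      fix y
      have "(LBINT x. g (y - x) * g (y - x - h)) = autocorrelation g h"
        unfolding autocorrelation_def
        by (rule lborel_integral_reflect[of "\<lambda>x. g x * g (x - h)" y]) measurable
      then show "(LBINT x. (f y * f (y - h)) * (g (y - x) * g ((y - x) - h)))
          = (f y * f (y - h)) * autocorrelation g h" by simp
    qed
    finally show ?thesis by (simp add: autocorrelation_def)
  qed
  have auto0: "autocorrelation w 0 = (LBINT x. (w x)\<^sup>2)" for w :: "'a \<Rightarrow> real"
    by (simp add: autocorrelation_def power2_eq_square)

  have T: "bbs (\<lambda>(x,h). k h * autocorrelation (u x) h)"
  proof -
    let ?F = "\<lambda>p y. k (snd p) * ((f y * f (y - snd p)) * (g (y - fst p) * g ((y - fst p) - snd p)))"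
    obtain Q where Q: "\<And>x. k x \<noteq> 0 \<Longrightarrow> norm x \<le> Q" using bbs_cball[OF assms(1)] by metis
    have "bbs (\<lambda>(p,y). ?F p y)"
    proof (rule bbs_pairI)
      show "norm p \<le> (R + S) + Q \<and> norm y \<le> R" if "?F p y \<noteq> 0" for p y
        using that R[of y] S[of "y - fst p"] Q[of "snd p"] norm_triangle_ineq4[of y "y - fst p"]
          norm_Pair_le[of "fst p" "snd p"] by auto
    next
      show "bounded_measurable (\<lambda>z. ?F (fst z) (snd z))"
        by (intro bounded_measurable_mult bounded_measurable_compose[OF bbs_bounded_measurable, OF assms(1)]
          bounded_measurable_compose[OF bbs_bounded_measurable, OF assms(3)]
          bounded_measurable_compose[OF bbs_bounded_measurable, OF assms(4)])
          (auto simp flip: borel_prod)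
    qed
    from bbs_marginal[OF this] show ?thesis
      by (simp add: corr_eq case_prod_unfold)
  qed
  \<comment> \<open>The first term is \<langle>u x, k * u x\<rangle> and the autocorrelation at 0 is
    the squared norm of u x. A positive integral of this function forces a positive value at some
    x.\<close>
  let ?\<Phi> = "\<lambda>x. (LBINT h. k h * autocorrelation (u x) h) - \<rho> * autocorrelation (u x) 0"
  have b\<Phi>: "bbs ?\<Phi>" by (intro bbs_diff bbs_marginal[OF T] bbs_cmult bcorr)
  have bk: "bbs (\<lambda>h. k h * (autocorrelation f h * autocorrelation g h))"
    using bbs_marginal[OF bbs_swap[OF T]] by (simp add: avg)
  have "(LBINT x. ?\<Phi> x) = (LBINT h. k h * (autocorrelation f h * autocorrelation g h)) - \<rho>"
  proof -
    have "(LBINT x. ?\<Phi> x) = (LBINT x. (LBINT h. k h * autocorrelation (u x) h))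
        - \<rho> * (LBINT x. autocorrelation (u x) 0)"
      by (subst Bochner_Integration.integral_diff)
        (auto intro!: bbs_integrable bbs_marginal[OF T] bbs_cmult bcorr)
    also have "(LBINT x. autocorrelation (u x) 0) = 1"
      unfolding avg by (simp add: auto0 fg)
    finally show ?thesis
      by (simp add: bbs_Fubini[OF T] avg)
  qed
  moreover have "(LBINT h. k h) - ((LBINT h. k h * shift_energy f h) + (LBINT h. k h * shift_energy g h)) / 2
      \<le> (LBINT h. k h * (autocorrelation f h * autocorrelation g h))"
  proof -
    have "(LBINT h. k h - (k h * shift_energy f h + k h * shift_energy g h) / 2)
        \<le> (LBINT h. k h * (autocorrelation f h * autocorrelation g h))"
    proof (rule integral_mono)
      fix h
      \<comment> \<open>As f and g have norm 1, their autocorrelations are 1 - a and 1 - b with a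
        and b half the shift energies. The step is (1 - a)(1 - b) \<ge> 1 - a - b; here the two
        deficits add up.\<close>
      have "0 \<le> (shift_energy f h / 2) * (shift_energy g h / 2)" by (simp add: shift_energy_nonneg)
      then have "1 - (shift_energy f h + shift_energy g h) / 2 \<le> autocorrelation f h * autocorrelation g h"
        by (simp add: shift_energy_autocorrelation assms algebra_simps diff_divide_distrib add_divide_distrib)
      from mult_left_mono[OF this assms(2)[of h]]
      show "k h - (k h * shift_energy f h + k h * shift_energy g h) / 2 \<le> k h * (autocorrelation f h * autocorrelation g h)"
        by (simp add: algebra_simps)
    qed (intro Bochner_Integration.integrable_diff integrable_divide Bochner_Integration.integrable_add
        bbs_integrable bbs_mult_shift_energy assms bk)+
    moreover have "(LBINT h. k h - (k h * shift_energy f h + k h * shift_energy g h) / 2)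
        = (LBINT h. k h) - ((LBINT h. k h * shift_energy f h) + (LBINT h. k h * shift_energy g h)) / 2"
      by (simp add: bbs_integrable bbs_mult_shift_energy assms)
    ultimately show ?thesis by simp
  qed
  ultimately have "0 < (LBINT x. ?\<Phi> x)" using \<rho> by linarith
  then obtain x where x: "0 < ?\<Phi> x"
  proof -
    have "\<not> (\<forall>x. ?\<Phi> x \<le> 0)"
    proof
      assume "\<forall>x. ?\<Phi> x \<le> 0"
      then have "(LBINT x. ?\<Phi> x) \<le> (\<integral>x. 0 \<partial>(lborel :: 'a measure))"
        by (intro integral_mono bbs_integrable[OF b\<Phi>]) auto
      with \<open>0 < (LBINT x. ?\<Phi> x)\<close> show False by simp
    qed
    then show ?thesis using that by (auto simp: not_le)
  qed
  have form: "(LBINT y. u x y * conv k (u x) y) = (LBINT h. k h * autocorrelation (u x) h)"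
    by (rule conv_inner_autocorrelation[OF assms(1) bu])
  \<comment> \<open>If u x had norm 0, Cauchy-Schwarz would make the first term of \<Phi> at most 0
    while the second vanishes.\<close>
  have pos: "0 < (LBINT y. (u x y)\<^sup>2)"
  proof (rule ccontr)
    assume "\<not> ?thesis"
    moreover have "0 \<le> (LBINT y. (u x y)\<^sup>2)" by (simp add: integral_nonneg_AE)
    ultimately have z: "(LBINT y. (u x y)\<^sup>2) = 0" by simp
    then have "norm2 (u x) = 0" by (simp add: norm2_def)
    then have "(LBINT y. u x y * conv k (u x) y) \<le> 0"
      using bbs_inner_le_norm2[OF bu bbs_conv[OF assms(1) bu], of x x] by simp
    with x z form show False by (simp add: auto0)
  qed
  show thesis
    using that[of x] pos x form unfolding u_def auto0 by simp
qed

section \<open>Smooth functions\<close>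

text \<open>Uniqueness of the derivative allows smoothness proofs to use an explicit derivative
  formula instead of \<open>frechet_derivative\<close>.\<close>

lemma C_diff_SucI:
  assumes "\<And>x. (f has_derivative f' x) (at x)" "\<And>v. C_diff k (\<lambda>x. f' x v)"
  shows "C_diff (Suc k) f"
proof -
  have "frechet_derivative f (at x) = f' x" for x
    using frechet_derivative_at[OF assms(1)] by simp
  then show ?thesis using assms by (auto simp: differentiable_def)
qed

lemma C_diff_continuous: "C_diff k f \<Longrightarrow> continuous_on UNIV f"
proof (cases k)
  case (Suc l)
  assume "C_diff k f"
  then have "isCont f x" for x
    using Suc differentiable_imp_continuous_within by auto
  then show ?thesis by (simp add: continuous_on_eq_continuous_at)
qed simp

lemma C_diff_SucD: "C_diff (Suc k) f \<Longrightarrow> C_diff k f"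
proof (induction k arbitrary: f)
  case 0
  then show ?case using C_diff_continuous[of "Suc 0" f] by simp
next
  case (Suc k)
  then show ?case by (auto simp del: C_diff.simps(2) simp: C_diff.simps(2)[of "Suc k" f] C_diff.simps(2)[of k f])
qed

lemma C_diff_const: "C_diff k (\<lambda>x. c)"
proof (induction k arbitrary: c)
  case (Suc k)
  show ?case by (rule C_diff_SucI[where f'="\<lambda>_ _. 0"]) (auto intro: Suc)
qed simp

lemma C_diff_has_derivative:
  "C_diff (Suc k) f \<Longrightarrow> (f has_derivative frechet_derivative f (at x)) (at x)"
  by (simp flip: frechet_derivative_works)

lemma C_diff_add: "C_diff k f \<Longrightarrow> C_diff k g \<Longrightarrow> C_diff k (\<lambda>x. f x + g x)"
proof (induction k arbitrary: f g)
  case 0 then show ?case by (auto intro: continuous_on_add)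
next
  case (Suc k)
  show ?case
    by (rule C_diff_SucI[OF has_derivative_add[OF C_diff_has_derivative[OF Suc.prems(1)] C_diff_has_derivative[OF Suc.prems(2)]]])
      (use Suc in auto)
qed

lemma C_diff_mult:
  fixes f g :: "'a::real_normed_vector \<Rightarrow> real"
  shows "C_diff k f \<Longrightarrow> C_diff k g \<Longrightarrow> C_diff k (\<lambda>x. f x * g x)"
proof (induction k arbitrary: f g)
  case 0 then show ?case by (auto intro: continuous_on_mult)
next
  case (Suc k)
  show ?case
  proof (rule C_diff_SucI[OF has_derivative_mult[OF C_diff_has_derivative[OF Suc.prems(1)] C_diff_has_derivative[OF Suc.prems(2)]]])
    fix v
    have "C_diff k (\<lambda>x. frechet_derivative f (at x) v)" "C_diff k (\<lambda>x. frechet_derivative g (at x) v)"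
      using Suc.prems by auto
    then show "C_diff k (\<lambda>x. f x * frechet_derivative g (at x) v + frechet_derivative f (at x) v * g x)"
      by (intro C_diff_add Suc.IH C_diff_SucD[OF Suc.prems(1)] C_diff_SucD[OF Suc.prems(2)])
  qed
qed

lemma C_diff_inner_left: "C_diff k (\<lambda>x::'a::real_inner. x \<bullet> v)"
proof (cases k)
  case 0
  then show ?thesis by (auto intro!: continuous_intros)
next
  case (Suc l)
  show ?thesis unfolding Suc
    by (rule C_diff_SucI[where f'="\<lambda>_ h. h \<bullet> v"])
      (auto intro!: derivative_eq_intros C_diff_const)
qed

text \<open>For n = 0 the classical flat function exp(-1/t). The extra powers of 1/t make the span
  of the family closed under differentiation, so one induction gives all orders of
  smoothness.\<close>

definition exp_germ :: "nat \<Rightarrow> real \<Rightarrow> real" where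
  "exp_germ n t = (if t > 0 then inverse t ^ n / exp (inverse t) else 0)"

lemma exp_germ_at_right_0: "(exp_germ n \<longlongrightarrow> 0) (at_right 0)"
proof -
  have "((\<lambda>t. inverse t ^ n / exp (inverse t :: real)) \<longlongrightarrow> 0) (at_right 0)"
    by (rule filterlim_compose[OF tendsto_power_div_exp_0 filterlim_inverse_at_top_right])
  then show ?thesis
    by (rule Lim_transform_eventually)
      (auto simp: eventually_at_right_less exp_germ_def eventually_at_filter)
qed

lemma exp_germ_has_derivative:
  "(exp_germ n has_real_derivative exp_germ (n + 2) t - real n * exp_germ (n + 1) t) (at t)"
proof -
  consider "t > 0" | "t < 0" | "t = 0" by linarith
  then show ?thesis
  proof cases
    case 1
    have "((\<lambda>t. inverse t ^ n / exp (inverse t)) has_real_derivative exp_germ (n + 2) t - real n * exp_germ (n + 1) t) (at t)"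
    proof -
      have "real n * inverse t ^ (n - 1) * (inverse t * inverse t) = real n * inverse t ^ (n + 1)"
        by (cases n) auto
      with 1 show ?thesis
        by (auto intro!: derivative_eq_intros simp: exp_germ_def field_simps power2_eq_square)
    qed
    then show ?thesis
      by (rule has_field_derivative_transform_within_open[where S="{0<..}"])
        (use 1 in \<open>auto simp: exp_germ_def\<close>)
  next
    case 2
    have "((\<lambda>t. 0) has_real_derivative exp_germ (n + 2) t - real n * exp_germ (n + 1) t) (at t)"
      using 2 by (simp add: exp_germ_def)
    then show ?thesis
      by (rule has_field_derivative_transform_within_open[where S="{..<0}"])
        (use 2 in \<open>auto simp: exp_germ_def\<close>)
  next
    case 3
    have "(exp_germ (n + 1) \<longlongrightarrow> 0) (at 0)"
    proof (rule filterlim_split_at)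
      show "(exp_germ (n + 1) \<longlongrightarrow> 0) (at_right 0)" by (rule exp_germ_at_right_0)
      show "(exp_germ (n + 1) \<longlongrightarrow> 0) (at_left 0)"
        by (rule Lim_transform_eventually[of "\<lambda>_. 0"])
          (auto simp: eventually_at_filter exp_germ_def)
    qed
    \<comment> \<open>The difference quotient at 0 is itself a member of the family; at h = 0 both
      sides are 0 because division by 0 gives 0.\<close>
    moreover have "exp_germ (n + 1) = (\<lambda>h. (exp_germ n (0 + h) - exp_germ n 0) / h)"
      by (auto simp: exp_germ_def field_simps)
    ultimately have "((\<lambda>h. (exp_germ n (0 + h) - exp_germ n 0) / h) \<longlongrightarrow> 0) (at 0)" by simp
    then show ?thesis
      unfolding 3 DERIV_def by (simp add: exp_germ_def[of _ 0])
  qed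
qed

lemma C_diff_exp_germ:
  fixes a b :: real
  shows "C_diff k (\<lambda>x::'a::real_inner. exp_germ n (b - a * (x \<bullet> x)))"
proof (induction k arbitrary: n)
  case 0
  have "isCont (exp_germ n) t" for t
    using exp_germ_has_derivative DERIV_isCont by blast
  then have "continuous_on UNIV (exp_germ n)" by (simp add: continuous_on_eq_continuous_at)
  then show ?case
    by (auto intro!: continuous_on_compose2[of UNIV "exp_germ n"] continuous_intros)
next
  case (Suc k)
  let ?t = "\<lambda>x::'a. b - a * (x \<bullet> x)"
  let ?D = "\<lambda>x. exp_germ (n + 2) (?t x) - real n * exp_germ (n + 1) (?t x)"
  show ?case
  proof (rule C_diff_SucI)
    show "((\<lambda>x. exp_germ n (?t x)) has_derivative (\<lambda>v. ?D x * (- 2 * a * (x \<bullet> v)))) (at x)" for x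
    proof -
      have "(?t has_derivative (\<lambda>v. - 2 * a * (x \<bullet> v))) (at x)"
        by (auto intro!: derivative_eq_intros simp: inner_commute fun_eq_iff)
      moreover have "(exp_germ n has_derivative (\<lambda>h. ?D x * h)) (at (?t x))"
        using exp_germ_has_derivative by (simp add: has_field_derivative_def mult_commute_abs)
      ultimately show ?thesis by (rule has_derivative_compose)
    qed
    fix v
    have "C_diff k (\<lambda>x. (exp_germ (n + 2) (?t x) + (- real n) * exp_germ (n + 1) (?t x)) * ((- 2 * a) * (x \<bullet> v)))"
      by (intro C_diff_mult C_diff_add Suc C_diff_const C_diff_inner_left)
    then show "C_diff k (\<lambda>x. ?D x * (- 2 * a * (x \<bullet> v)))" by simp
  qed
qed

lemma smooth_exp_germ: "smooth (\<lambda>x::'a::real_inner. exp_germ n (b - a * (x \<bullet> x)))"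
  by (simp add: smooth_def C_diff_exp_germ)

lemma smooth_cmult: "smooth f \<Longrightarrow> smooth (\<lambda>x. c * f x)" for f :: "'a::real_normed_vector \<Rightarrow> real"
  by (simp add: smooth_def C_diff_mult C_diff_const)

lemma smooth_frechet_derivative: "smooth f \<Longrightarrow> smooth (\<lambda>x. frechet_derivative f (at x) v)"
  unfolding smooth_def by (metis C_diff.simps(2))

lemma smooth_differentiable: "smooth f \<Longrightarrow> f differentiable (at x)"
  unfolding smooth_def by (metis C_diff.simps(2))

lemma smooth_continuous: "smooth f \<Longrightarrow> continuous_on UNIV f"
  unfolding smooth_def using C_diff_continuous by blast

section \<open>Gradients of smooth functions with bounded support\<close>

lemma smooth_has_derivative_gradient:
  fixes f :: "'a::euclidean_space \<Rightarrow> real"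
  assumes "smooth f"
  shows "(f has_derivative (\<lambda>h. h \<bullet> gradient f x)) (at x)"
  using GDERIV_gradient[OF smooth_differentiable[OF assms]] by (simp add: gderiv_def)

lemma frechet_derivative_gradient:
  fixes f :: "'a::euclidean_space \<Rightarrow> real"
  assumes "smooth f"
  shows "frechet_derivative f (at x) h = h \<bullet> gradient f x"
  using frechet_derivative_at[OF smooth_has_derivative_gradient[OF assms, of x]] by (metis)

lemma gradient_eqI:
  fixes f :: "'a::euclidean_space \<Rightarrow> real"
  assumes "(f has_derivative (\<lambda>h. h \<bullet> v)) (at x)"
  shows "gradient f x = v"
proof -
  have "frechet_derivative f (at x) = (\<lambda>h. h \<bullet> v)"
    by (rule frechet_derivative_at[OF assms, symmetric])
  then show ?thesis
    unfolding gradient_def by (simp add: inner_commute[of _ v] euclidean_representation)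
qed

lemma continuous_gradient:
  fixes f :: "'a::euclidean_space \<Rightarrow> real"
  assumes "smooth f" shows "continuous_on UNIV (gradient f)"
  unfolding gradient_def
  by (intro continuous_on_sum continuous_on_scaleR continuous_on_const smooth_continuous
      smooth_frechet_derivative assms)

lemma gradient_eq_0:
  fixes f :: "'a::euclidean_space \<Rightarrow> real"
  assumes "x \<notin> closure {x. f x \<noteq> 0}"
  shows "gradient f x = 0"
proof (rule gradient_eqI)
  have "((\<lambda>_. 0) has_derivative (\<lambda>h. h \<bullet> 0)) (at x)" by simp
  then show "(f has_derivative (\<lambda>h. h \<bullet> 0)) (at x)"
    by (rule has_derivative_transform_within_open[where s="- closure {x. f x \<noteq> 0}"])
      (use assms closure_subset[of "{x. f x \<noteq> 0}"] in auto)
qed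

lemma smooth_support_cball:
  fixes f :: "'a::euclidean_space \<Rightarrow> real"
  assumes "bounded {x. f x \<noteq> 0}"
  obtains R where "R > 0" "\<And>x. f x \<noteq> 0 \<Longrightarrow> norm x \<le> R" "\<And>x. gradient f x \<noteq> 0 \<Longrightarrow> norm x \<le> R"
proof -
  obtain R where R: "R > 0" "\<And>x. f x \<noteq> 0 \<Longrightarrow> norm x \<le> R"
    using assms unfolding bounded_pos by blast
  have "closure {x. f x \<noteq> 0} \<subseteq> cball 0 R"
    by (rule closure_minimal) (use R in auto)
  then have "norm x \<le> R" if "gradient f x \<noteq> 0" for x
    using gradient_eq_0[of x f] that by force
  with R that show ?thesis by blast
qed

lemma bbs_continuous:
  fixes f :: "'a::euclidean_space \<Rightarrow> real"
  assumes "continuous_on UNIV f" "\<And>x. f x \<noteq> 0 \<Longrightarrow> norm x \<le> R"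
  shows "bbs f"
proof (rule bbsI)
  have "compact (f ` cball 0 R)"
    using assms by (intro compact_continuous_image) (auto intro: continuous_on_subset)
  then obtain M where M: "\<And>y. y \<in> f ` cball 0 R \<Longrightarrow> norm y \<le> M"
    using compact_imp_bounded bounded_iff by metis
  have "\<bar>f x\<bar> \<le> max M 0" for x
    using M[of "f x"] assms(2)[of x] by (cases "f x = 0") force+
  then show "bounded_measurable f"
    using borel_measurable_continuous_onI[OF assms(1)] by (intro bounded_measurableI)
  show "bounded (cball (0::'a) R)" by simp
qed (use assms in auto)

lemma smooth_bbs:
  fixes f :: "'a::euclidean_space \<Rightarrow> real"
  assumes "smooth f" "bounded {x. f x \<noteq> 0}"
  shows "bbs f" "bbs (\<lambda>x. h \<bullet> gradient f x)" "bbs (\<lambda>x. (norm (gradient f x))\<^sup>2)"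
proof -
  obtain R where R: "\<And>x. f x \<noteq> 0 \<Longrightarrow> norm x \<le> R" "\<And>x. gradient f x \<noteq> 0 \<Longrightarrow> norm x \<le> R"
    using smooth_support_cball[OF assms(2)] by metis
  show "bbs f" using bbs_continuous smooth_continuous assms R by blast
  show "bbs (\<lambda>x. h \<bullet> gradient f x)"
    by (rule bbs_continuous[of _ R])
      (auto intro!: continuous_intros continuous_gradient assms R)
  show "bbs (\<lambda>x. (norm (gradient f x))\<^sup>2)"
    by (rule bbs_continuous[of _ R])
      (auto intro!: continuous_intros continuous_gradient assms R)
qed

text \<open>The gradient vanishes outside a ball of radius R and is thus uniformly continuous on the
  whole space, so the mean value inequality bounds the remainder uniformly in x. Of two points at
  distance at most 1, either both lie in the ball of radius R + 1 or the gradient vanishes at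
  both.\<close>

lemma smooth_uniform_Taylor:
  fixes f :: "'a::euclidean_space \<Rightarrow> real"
  assumes f: "smooth f" "bounded {x. f x \<noteq> 0}" and "0 < e"
  obtains d where "0 < d" "\<And>x h. norm h \<le> d \<Longrightarrow> \<bar>f (x + h) - f x - h \<bullet> gradient f x\<bar> \<le> e * norm h"
proof -
  obtain R where R: "\<And>x. gradient f x \<noteq> 0 \<Longrightarrow> norm x \<le> R"
    using smooth_support_cball[OF f(2)] by metis
  have "uniformly_continuous_on (cball 0 (R + 1)) (gradient f)"
    by (intro compact_uniformly_continuous continuous_on_subset[OF continuous_gradient[OF f(1)]]) auto
  then obtain d where d: "0 < d" "\<And>x y. x \<in> cball 0 (R + 1) \<Longrightarrow> y \<in> cball 0 (R + 1) \<Longrightarrow> dist y x < d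
      \<Longrightarrow> dist (gradient f y) (gradient f x) < e"
    using \<open>0 < e\<close> unfolding uniformly_continuous_on_def by metis
  define d' where "d' = min (d / 2) 1"
  have near: "norm (gradient f y - gradient f x) \<le> e" if "norm (y - x) \<le> d'" for x y
  proof (cases "x \<in> cball 0 (R + 1) \<and> y \<in> cball 0 (R + 1)")
    case True
    then show ?thesis using d(2)[of x y] that d(1) by (auto simp: dist_norm d'_def)
  next
    case False
    have "norm y \<le> norm x + 1" "norm x \<le> norm y + 1"
      using that norm_triangle_ineq[of x "y - x"] norm_triangle_ineq[of y "x - y"]
      by (auto simp: d'_def norm_minus_commute)
    then have "\<not> norm x \<le> R" "\<not> norm y \<le> R" using False by auto
    then have "gradient f x = 0" "gradient f y = 0" using R by blast+
    then show ?thesis using \<open>0 < e\<close> by simp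
  qed
  show ?thesis
  proof (rule that)
    show "0 < d'" using d by (simp add: d'_def)
    fix x h :: 'a assume h: "norm h \<le> d'"
    have "norm (f (x + h) - f x - (\<lambda>k. k \<bullet> gradient f x) (x + h - x)) \<le> norm (x + h - x) * e"
    proof (rule differentiable_bound_linearization[where S="cball x d'" and f'="\<lambda>y k. k \<bullet> gradient f y"])
      show "x + t *\<^sub>R (x + h - x) \<in> cball x d'" if "t \<in> {0..1}" for t
        using that h mult_left_le_one_le[of "norm h" t] by (auto simp: dist_norm)
      show "(f has_derivative (\<lambda>k. k \<bullet> gradient f y)) (at y within cball x d')" for y
        by (rule has_derivative_at_withinI[OF smooth_has_derivative_gradient[OF f(1)]])
      show "onorm ((\<lambda>k. k \<bullet> gradient f y) - (\<lambda>k. k \<bullet> gradient f x)) \<le> e" if "y \<in> cball x d'" for y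
        unfolding fun_diff_def
      proof (rule onorm_bound)
        show "norm (i \<bullet> gradient f y - i \<bullet> gradient f x) \<le> e * norm i" for i
        proof -
          have "\<bar>i \<bullet> (gradient f y - gradient f x)\<bar> \<le> norm i * norm (gradient f y - gradient f x)"
            by (rule Cauchy_Schwarz_ineq2)
          also have "\<dots> \<le> norm i * e"
            using near[of y x] that by (intro mult_left_mono) (auto simp: dist_norm norm_minus_commute)
          finally show ?thesis by (simp add: inner_diff_right mult.commute)
        qed
      qed (use \<open>0 < e\<close> in simp)
    qed (use \<open>0 < d'\<close> in auto)
    then show "\<bar>f (x + h) - f x - h \<bullet> gradient f x\<bar> \<le> e * norm h" by (simp add: mult.commute)
  qed
qed

text \<open>All differentiation falls on the smooth factor: its uniform Taylor remainder, integrated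
  against |w|, is the remainder of the convolution.\<close>

lemma conv_has_derivative:
  fixes f :: "'a::euclidean_space \<Rightarrow> real"
  assumes f: "smooth f" "bounded {x. f x \<noteq> 0}" and w: "bbs w"
  shows "(conv f w has_derivative (\<lambda>h. conv (\<lambda>z. h \<bullet> gradient f z) w x)) (at x)"
proof -
  note bbs = smooth_bbs[OF f]
  have lin: "linear (\<lambda>h. conv (\<lambda>z. h \<bullet> gradient f z) w x)"
  proof
    show "conv (\<lambda>z. (h + k) \<bullet> gradient f z) w x = conv (\<lambda>z. h \<bullet> gradient f z) w x + conv (\<lambda>z. k \<bullet> gradient f z) w x" for h k
      unfolding conv_def
      using bbs_integrable[OF bbs_section[OF bbs_conv_kernel[OF bbs(2)[of h] w]]]
        bbs_integrable[OF bbs_section[OF bbs_conv_kernel[OF bbs(2)[of k] w]]]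
      by (subst Bochner_Integration.integral_add[symmetric]) (auto simp: inner_add_left distrib_right)
    show "conv (\<lambda>z. (r *\<^sub>R h) \<bullet> gradient f z) w x = r *\<^sub>R conv (\<lambda>z. h \<bullet> gradient f z) w x" for r h
      unfolding conv_def by (simp add: mult.assoc)
  qed
  show ?thesis
    unfolding has_derivative_at_alt
  proof (intro conjI allI impI)
    show "bounded_linear (\<lambda>h. conv (\<lambda>z. h \<bullet> gradient f z) w x)"
      using lin linear_conv_bounded_linear by blast
    fix e :: real assume "0 < e"
    \<comment> \<open>The added 1 keeps W positive when w vanishes almost everywhere.\<close>
    define W where "W = (LBINT y. \<bar>w y\<bar>) + 1"
    have W: "W > 0" unfolding W_def by (rule add_nonneg_pos) (auto simp: integral_nonneg_AE)
    obtain d where d: "0 < d" "\<And>x h. norm h \<le> d \<Longrightarrow> \<bar>f (x + h) - f x - h \<bullet> gradient f x\<bar> \<le> e / W * norm h"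
      using smooth_uniform_Taylor[OF f, of "e / W"] \<open>0 < e\<close> W by (metis divide_pos_pos)
    show "\<exists>d>0. \<forall>y. norm (y - x) < d \<longrightarrow>
        norm (conv f w y - conv f w x - conv (\<lambda>z. (y - x) \<bullet> gradient f z) w x) \<le> e * norm (y - x)"
    proof (intro exI[of _ d] conjI allI impI d)
      fix y assume y: "norm (y - x) < d"
      have i: "integrable lborel (\<lambda>z. u (x - z) * w z)" if "bbs u" for u x
        using that w by (intro bbs_integrable bbs_mult bbs_reflect)
      let ?r = "\<lambda>z. f (y - z) * w z - f (x - z) * w z - ((y - x) \<bullet> gradient f (x - z)) * w z"
      have r: "integrable lborel ?r"
        using i[OF bbs(1)] i[OF bbs(2)] by (intro Bochner_Integration.integrable_diff) 
      have "conv f w y - conv f w x - conv (\<lambda>z. (y - x) \<bullet> gradient f z) w x = (LBINT z. ?r z)"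
        using i[OF bbs(1)] i[OF bbs(2)]
        by (simp add: conv_commute bbs_borel[OF bbs(1)] bbs_borel[OF bbs(2)] bbs_borel[OF w])
      also have "norm \<dots> \<le> (LBINT z. e / W * norm (y - x) * \<bar>w z\<bar>)"
      proof (rule order_trans[OF integral_norm_bound integral_mono])
        show "integrable lborel (\<lambda>z. norm (?r z))" using r by (rule integrable_norm)
        show "integrable lborel (\<lambda>z. e / W * norm (y - x) * \<bar>w z\<bar>)"
          by (intro bbs_integrable bbs_cmult bbs_abs w)
        fix z
        have "norm (?r z) = \<bar>f ((x - z) + (y - x)) - f (x - z) - (y - x) \<bullet> gradient f (x - z)\<bar> * \<bar>w z\<bar>"
          by (simp flip: abs_mult add: left_diff_distrib)
        also have "\<dots> \<le> e / W * norm (y - x) * \<bar>w z\<bar>"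
          using y by (intro mult_right_mono d) auto
        finally show "norm (?r z) \<le> e / W * norm (y - x) * \<bar>w z\<bar>" .
      qed
      also have "\<dots> = e * norm (y - x) * ((LBINT y. \<bar>w y\<bar>) / W)" by simp
      also have "\<dots> \<le> e * norm (y - x) * 1"
        using \<open>0 < e\<close> W by (intro mult_left_mono) (auto simp: W_def)
      finally show "norm (conv f w y - conv f w x - conv (\<lambda>z. (y - x) \<bullet> gradient f z) w x) \<le> e * norm (y - x)" by simp
    qed
  qed
qed

lemma smooth_conv:
  fixes f :: "'a::euclidean_space \<Rightarrow> real"
  assumes "smooth f" "bounded {x. f x \<noteq> 0}" "bbs w"
  shows "smooth (conv f w)"
proof -
  have "C_diff k (conv f w)" for k
    using assms
  proof (induction k arbitrary: f)
    case 0
    have "isCont (conv f w) x" for x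
      using conv_has_derivative[OF 0] has_derivative_continuous by blast
    then show ?case by (simp add: continuous_on_eq_continuous_at)
  next
    case (Suc k)
    show ?case
    proof (rule C_diff_SucI[OF conv_has_derivative[OF Suc.prems]])
      fix v
      have "bounded {x. v \<bullet> gradient f x \<noteq> 0}"
        using smooth_bbs(2)[OF Suc.prems(1,2)] by (simp add: bbs_def)
      moreover have "smooth (\<lambda>x. v \<bullet> gradient f x)"
        using smooth_frechet_derivative[OF Suc.prems(1), of v]
        by (simp add: frechet_derivative_gradient[OF Suc.prems(1)])
      ultimately have "C_diff k (conv (\<lambda>x. v \<bullet> gradient f x) w)"
        by (intro Suc.IH Suc.prems)
      then show "C_diff k (\<lambda>x. conv (\<lambda>z. v \<bullet> gradient f z) w x)" .
    qed
  qed
  then show ?thesis by (simp add: smooth_def)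
qed

lemma inner_gradient_conv:
  fixes f :: "'a::euclidean_space \<Rightarrow> real"
  assumes "smooth f" "bounded {x. f x \<noteq> 0}" "bbs w"
  shows "h \<bullet> gradient (conv f w) x = conv (\<lambda>z. h \<bullet> gradient f z) w x"
  using frechet_derivative_at[OF conv_has_derivative[OF assms, of x]]
    frechet_derivative_gradient[OF smooth_conv[OF assms], of x h] by metis

section \<open>Second moments of balls\<close>

lemma bbs_indicator_cball: "bbs (indicator (cball a r) :: 'a::euclidean_space \<Rightarrow> real)"
  by (intro bbs_indicator) auto

lemma indicator_cball_scaleR:
  assumes "c > 0"
  shows "indicator (cball 0 (c * r)) (c *\<^sub>R x) = (indicator (cball 0 r) (x::'a::real_normed_vector) :: real)"
  using assms by (auto simp: indicator_def)

lemma integral_indicator_cball_pos: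
  assumes "r > 0"
  shows "0 < (LBINT h. indicator (cball (0::'a::euclidean_space) r) h :: real)"
proof -
  have "0 < measure lborel (cball (0::'a) r)" using assms by (rule content_cball_pos)
  then show ?thesis by simp
qed

lemma integral_indicator_cball_scale:
  assumes "r > 0"
  shows "(LBINT h. indicator (cball (0::'a::euclidean_space) r) h)
    = r ^ DIM('a) * (LBINT h. indicator (cball (0::'a) 1) h :: real)"
  using lborel_integral_scaleR[of "indicator (cball (0::'a) r)" r] assms
    indicator_cball_scaleR[of r 1, where 'a='a] bbs_borel[OF bbs_indicator_cball[of "0::'a" r]]
  by (simp del: integral_indicator cball_eq_empty)

text \<open>The preimage of a box is a box with two side lengths exchanged. This symmetry equates
  the second moments of a ball along the coordinate axes.\<close>

lemma lborel_distr_swap: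
  fixes a b :: "'a::euclidean_space"
  assumes "a \<in> Basis" "b \<in> Basis"
  defines "T \<equiv> \<lambda>x. \<Sum>c\<in>Basis. (x \<bullet> Transposition.transpose a b c) *\<^sub>R c"
  shows "distr lborel borel T = lborel"
proof (rule lborel_eqI[symmetric])
  have perm: "bij_betw (Transposition.transpose a b) Basis Basis"
    using assms by (intro bij_betwI[where g="Transposition.transpose a b"]) (auto simp: Transposition.transpose_def)
  have mem: "Transposition.transpose a b c \<in> Basis" if "c \<in> Basis" for c using that assms by (auto simp: Transposition.transpose_def)
  have T_inner: "T x \<bullet> c = x \<bullet> Transposition.transpose a b c" if "c \<in> Basis" for x c
    using that by (simp add: T_def inner_sum_left inner_Basis if_distrib cong: if_cong)
  have [measurable]: "T \<in> borel_measurable borel" unfolding T_def by measurable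
  fix l u :: 'a
  assume lu: "\<And>b. b \<in> Basis \<Longrightarrow> l \<bullet> b \<le> u \<bullet> b"
  have "T -` box l u = box (T l) (T u)"
  proof (intro set_eqI)
    fix x
    have "x \<in> T -` box l u \<longleftrightarrow> (\<forall>c\<in>Basis. l \<bullet> c < x \<bullet> Transposition.transpose a b c \<and> x \<bullet> Transposition.transpose a b c < u \<bullet> c)"
      by (simp add: mem_box T_inner)
    also have "\<dots> \<longleftrightarrow> (\<forall>c\<in>Basis. l \<bullet> Transposition.transpose a b c < x \<bullet> c \<and> x \<bullet> c < u \<bullet> Transposition.transpose a b c)"
      using mem by (metis Transposition.transpose_involutory)
    finally show "x \<in> T -` box l u \<longleftrightarrow> x \<in> box (T l) (T u)" by (simp add: mem_box T_inner)
  qed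
  then have "emeasure (distr lborel borel T) (box l u) = emeasure lborel (box (T l) (T u))"
    by (simp add: emeasure_distr)
  also have "\<dots> = (\<Prod>c\<in>Basis. (T u - T l) \<bullet> c)"
    using lu mem by (simp add: emeasure_lborel_box_eq T_inner)
  also have "(\<Prod>c\<in>Basis. (T u - T l) \<bullet> c) = (\<Prod>c\<in>Basis. (u - l) \<bullet> Transposition.transpose a b c)"
    by (intro prod.cong refl) (simp add: inner_diff_left T_inner)
  also have "\<dots> = (\<Prod>c\<in>Basis. (u - l) \<bullet> c)"
    by (rule prod.reindex_bij_betw[OF perm])
  finally show "emeasure (distr lborel borel T) (box l u) = (\<Prod>c\<in>Basis. (u - l) \<bullet> c)" .
qed simp

text \<open>A diagonal map with entries 1 and -1 preserves volume. This symmetry changes the sign of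
  the mixed second moments of a ball.\<close>

lemma lborel_distr_reflection:
  fixes a :: "'a::euclidean_space"
  assumes "a \<in> Basis"
  shows "distr lborel borel (\<lambda>x. x - (2 * (x \<bullet> a)) *\<^sub>R a) = lborel"
proof -
  let ?c = "\<lambda>j. if j = a then -1 else (1::real)"
  have T: "0 + (\<Sum>j\<in>Basis. (?c j * (x \<bullet> j)) *\<^sub>R j) = x - (2 * (x \<bullet> a)) *\<^sub>R a" for x
  proof (rule euclidean_eqI)
    fix b :: 'a assume "b \<in> Basis"
    then show "(0 + (\<Sum>j\<in>Basis. (?c j * (x \<bullet> j)) *\<^sub>R j)) \<bullet> b = (x - (2 * (x \<bullet> a)) *\<^sub>R a) \<bullet> b"
      using assms by (auto simp: inner_sum_left inner_diff_left inner_Basis if_distrib[of "\<lambda>t. _ * t"] cong: if_cong)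
  qed
  have "(\<Prod>j\<in>Basis. \<bar>?c j\<bar>) = 1" by (intro prod.neutral) auto
  then show ?thesis
    using lborel_affine_euclidean[of ?c 0] unfolding T by (simp add: density_1)
qed

text \<open>Coordinate reflections annihilate the off-diagonal second moments of the unit ball and
  coordinate swaps equate the diagonal ones, so the moment matrix is \<kappa> times the identity.
  Scaling to radius r contributes the dimension from the volume and 2 from the square.\<close>

lemma integral_cball_inner_square:
  obtains \<kappa> :: real where "0 < \<kappa>"
    "\<And>r (v::'a::euclidean_space). 0 < r \<Longrightarrow>
      (LBINT h. indicator (cball 0 r) h * (h \<bullet> v)\<^sup>2) = \<kappa> * r ^ (DIM('a) + 2) * (norm v)\<^sup>2"
proof -
  let ?i = "indicator (cball (0::'a) 1) :: 'a \<Rightarrow> real"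
  define m where "m u v = (LBINT h. ?i h * ((h \<bullet> u) * (h \<bullet> v)))" for u v :: 'a
  have bb: "bbs (\<lambda>h. ?i h * q h)" if "continuous_on UNIV q" for q :: "'a \<Rightarrow> real"
  proof (rule bbsI)
    have "compact (q ` cball 0 1)"
      using that by (intro compact_continuous_image) (auto intro: continuous_on_subset)
    then obtain M where M: "\<And>y. y \<in> q ` cball 0 1 \<Longrightarrow> norm y \<le> M"
      using compact_imp_bounded bounded_iff by metis
    have [measurable]: "q \<in> borel_measurable borel" by (rule borel_measurable_continuous_onI[OF that])
    have "\<bar>?i h * q h\<bar> \<le> max M 0" for h
      using M[of "q h"] by (cases "h \<in> cball 0 1") force+
    moreover have "(\<lambda>h. ?i h * q h) \<in> borel_measurable borel"
      by (intro borel_measurable_times borel_measurable_indicator) auto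
    ultimately show "bounded_measurable (\<lambda>h. ?i h * q h)" by (intro bounded_measurableI)
    show "bounded (cball (0::'a) 1)" by simp
  qed (auto simp: indicator_def split: if_splits)
  have bm: "bbs (\<lambda>h. ?i h * ((h \<bullet> u) * (h \<bullet> v)))" for u v
    by (intro bb continuous_intros)
  have off: "m a b = 0" if "a \<in> Basis" "b \<in> Basis" "a \<noteq> b" for a b
  proof -
    let ?T = "\<lambda>x. x - (2 * (x \<bullet> a)) *\<^sub>R a"
    have T: "?T x \<bullet> a = - (x \<bullet> a)" "?T x \<bullet> b = x \<bullet> b" "norm (?T x) = norm x" for x
    proof -
      show "?T x \<bullet> a = - (x \<bullet> a)" "?T x \<bullet> b = x \<bullet> b"
        using that by (auto simp: inner_diff_left inner_Basis)
      have "(norm (?T x))\<^sup>2 = (norm x)\<^sup>2"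
        unfolding power2_norm_eq_inner
        using that by (simp add: inner_diff_left inner_diff_right inner_commute[of a x] inner_Basis algebra_simps)
      then show "norm (?T x) = norm x" by simp
    qed
    note [measurable] = bbs_borel[OF bm]
    have "m a b = (\<integral>h. ?i h * ((h \<bullet> a) * (h \<bullet> b)) \<partial>distr lborel borel ?T)"
      by (simp add: m_def lborel_distr_reflection that)
    also have "\<dots> = (LBINT h. ?i (?T h) * ((?T h \<bullet> a) * (?T h \<bullet> b)))"
      by (rule integral_distr) measurable
    also have "\<dots> = (LBINT h. - (?i h * ((h \<bullet> a) * (h \<bullet> b))))"
    proof (intro Bochner_Integration.integral_cong refl)
      fix x
      have "?i (?T x) = ?i x" unfolding indicator_def by (simp only: mem_cball_0 T(3))
      then show "?i (?T x) * ((?T x \<bullet> a) * (?T x \<bullet> b)) = - (?i x * ((x \<bullet> a) * (x \<bullet> b)))"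
        unfolding T(1,2) by simp
    qed
    also have "\<dots> = - m a b" by (simp add: m_def)
    finally show ?thesis by simp
  qed
  have diag: "m a a = m b b" if "a \<in> Basis" "b \<in> Basis" for a b
  proof -
    let ?T = "\<lambda>x. \<Sum>c\<in>Basis. (x \<bullet> Transposition.transpose a b c) *\<^sub>R c"
    have perm: "bij_betw (Transposition.transpose a b) Basis Basis"
      using that by (intro bij_betwI[where g="Transposition.transpose a b"]) (auto simp: Transposition.transpose_def)
    have T_inner: "?T x \<bullet> c = x \<bullet> Transposition.transpose a b c" if "c \<in> Basis" for x c
      using that by (simp add: inner_sum_left inner_Basis if_distrib cong: if_cong)
    have normT: "norm (?T x) = norm x" for x
    proof -
      have "(norm (?T x))\<^sup>2 = (\<Sum>c\<in>Basis. (x \<bullet> Transposition.transpose a b c)\<^sup>2)"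
        unfolding power2_norm_eq_inner euclidean_inner[of "?T x" "?T x"]
        by (intro sum.cong refl) (simp only: T_inner power2_eq_square)
      also have "\<dots> = (\<Sum>c\<in>Basis. (x \<bullet> c)\<^sup>2)" by (rule sum.reindex_bij_betw[OF perm])
      also have "\<dots> = (norm x)\<^sup>2"
        unfolding power2_norm_eq_inner euclidean_inner[of x x] by (simp add: power2_eq_square)
      finally show ?thesis by simp
    qed
    note [measurable] = bbs_borel[OF bm]
    have "m a a = (\<integral>h. ?i h * ((h \<bullet> a) * (h \<bullet> a)) \<partial>distr lborel borel ?T)"
      by (simp add: m_def lborel_distr_swap that)
    also have "\<dots> = (LBINT h. ?i (?T h) * ((?T h \<bullet> a) * (?T h \<bullet> a)))"
      by (rule integral_distr) measurable
    also have "\<dots> = m b b"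
      unfolding m_def using that
      by (intro Bochner_Integration.integral_cong refl) (simp only: T_inner normT indicator_def mem_cball_0 Transposition.transpose_apply_first)
    finally show ?thesis .
  qed
  define b0 where "b0 = (SOME b. b \<in> (Basis :: 'a set))"
  have b0: "b0 \<in> Basis" unfolding b0_def by (rule someI_ex) (use nonempty_Basis in blast)
  define \<kappa> where "\<kappa> = m b0 b0"
  have unit: "(LBINT h. ?i h * (h \<bullet> v)\<^sup>2) = \<kappa> * (norm v)\<^sup>2" for v
  proof -
    have "(LBINT h. ?i h * (h \<bullet> v)\<^sup>2)
        = (LBINT h. (\<Sum>a\<in>Basis. \<Sum>b\<in>Basis. (v \<bullet> a) * (v \<bullet> b) * (?i h * ((h \<bullet> a) * (h \<bullet> b)))))"
    proof (intro Bochner_Integration.integral_cong refl)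
      fix h
      have "(h \<bullet> v)\<^sup>2 = (\<Sum>a\<in>Basis. (h \<bullet> a) * (v \<bullet> a)) * (\<Sum>b\<in>Basis. (h \<bullet> b) * (v \<bullet> b))"
        by (simp add: power2_eq_square flip: euclidean_inner)
      then show "?i h * (h \<bullet> v)\<^sup>2 = (\<Sum>a\<in>Basis. \<Sum>b\<in>Basis. (v \<bullet> a) * (v \<bullet> b) * (?i h * ((h \<bullet> a) * (h \<bullet> b))))"
        by (simp add: sum_product sum_distrib_left mult_ac)
    qed
    also have "\<dots> = (\<Sum>a\<in>Basis. \<Sum>b\<in>Basis. (v \<bullet> a) * (v \<bullet> b) * m a b)"
    proof -
      have i: "integrable lborel (\<lambda>h. (v \<bullet> a) * (v \<bullet> b) * (?i h * ((h \<bullet> a) * (h \<bullet> b))))" for a b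
        by (intro bbs_integrable bbs_cmult bm)
      show ?thesis
        unfolding m_def
        by (subst Bochner_Integration.integral_sum, intro Bochner_Integration.integrable_sum i)
          (intro sum.cong refl, subst Bochner_Integration.integral_sum[OF i], simp)
    qed
    also have "\<dots> = (\<Sum>a\<in>Basis. (v \<bullet> a) * (v \<bullet> a) * \<kappa>)"
    proof (intro sum.cong refl)
      fix a :: 'a assume a: "a \<in> Basis"
      have "(\<Sum>b\<in>Basis. (v \<bullet> a) * (v \<bullet> b) * m a b) = (\<Sum>b\<in>Basis. if b = a then (v \<bullet> a) * (v \<bullet> a) * \<kappa> else 0)"
        using a off diag[OF b0] by (intro sum.cong refl) (auto simp: \<kappa>_def)
      then show "(\<Sum>b\<in>Basis. (v \<bullet> a) * (v \<bullet> b) * m a b) = (v \<bullet> a) * (v \<bullet> a) * \<kappa>"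
        using a by simp
    qed
    also have "\<dots> = \<kappa> * (norm v)\<^sup>2"
      unfolding power2_norm_eq_inner euclidean_inner[of v v] by (simp add: sum_distrib_left mult.commute)
    finally show ?thesis .
  qed
  \<comment> \<open>The trace, \<open>DIM('a)\<close> times \<kappa>, is the integral of |h|^2 over
    the unit ball, and |h|^2 \<ge> 1/4 on the shell outside radius 1/2, which has positive
    volume.\<close>
  have "0 < \<kappa>"
  proof -
    let ?V = "LBINT h. ?i h"
    have V: "0 < ?V" by (rule integral_indicator_cball_pos) simp
    have half: "(LBINT h. indicator (cball (0::'a) (1/2)) h) = (1/2) ^ DIM('a) * ?V"
      by (rule integral_indicator_cball_scale) simp
    have "(1/2::real) ^ DIM('a) < 1" by (rule power_less_one_iff[THEN iffD2]) auto
    then have "(1/2) ^ DIM('a) * ?V < 1 * ?V" using V by (intro mult_strict_right_mono) auto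
    then have "0 < 1/4 * (?V - (1/2) ^ DIM('a) * ?V)" by simp
    also have "\<dots> = (LBINT h. 1/4 * (?i h - indicator (cball (0::'a) (1/2)) h))"
      unfolding half[symmetric]
      by (subst integral_mult_right_zero, subst Bochner_Integration.integral_diff)
        (auto intro!: bbs_integrable bbs_indicator_cball)
    also have "\<dots> \<le> (LBINT h. ?i h * (h \<bullet> h))"
    proof (rule integral_mono)
      show "integrable lborel (\<lambda>h. 1/4 * (?i h - indicator (cball (0::'a) (1/2)) h))"
        by (intro bbs_integrable bbs_cmult bbs_diff bbs_indicator_cball)
      show "integrable lborel (\<lambda>h. ?i h * (h \<bullet> h))"
        by (intro bbs_integrable bb continuous_intros)
      fix h :: 'a
      have "1/4 \<le> h \<bullet> h" if "\<not> norm h \<le> 1/2"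
        using that power_mono[of "1/2" "norm h" 2]
        unfolding power2_norm_eq_inner by (simp add: power_divide)
      then show "1/4 * (?i h - indicator (cball (0::'a) (1/2)) h) \<le> ?i h * (h \<bullet> h)"
        by (auto simp: indicator_def)
    qed
    also have "\<dots> = (LBINT h. (\<Sum>b\<in>Basis. ?i h * (h \<bullet> b)\<^sup>2))"
      by (intro Bochner_Integration.integral_cong refl) (subst euclidean_inner, simp add: sum_distrib_left power2_eq_square)
    also have "\<dots> = (\<Sum>b\<in>(Basis::'a set). \<kappa> * (norm b)\<^sup>2)"
      by (subst Bochner_Integration.integral_sum)
        (auto simp: unit intro!: bbs_integrable bb continuous_intros)
    also have "\<dots> = DIM('a) * \<kappa>" by simp
    finally show ?thesis by (simp add: zero_less_mult_iff)
  qed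
  moreover have "(LBINT h. indicator (cball 0 r) h * (h \<bullet> v)\<^sup>2) = \<kappa> * r ^ (DIM('a) + 2) * (norm v)\<^sup>2"
    if r: "0 < r" for r and v :: 'a
  proof -
    have "(LBINT h. indicator (cball 0 r) h * (h \<bullet> v)\<^sup>2)
        = r ^ DIM('a) * (LBINT h. indicator (cball 0 r) (r *\<^sub>R h) * (r *\<^sub>R h \<bullet> v)\<^sup>2)"
      by (rule lborel_integral_scaleR[OF _ r], intro borel_measurable_times borel_measurable_indicator) auto
    also have "(\<lambda>h. indicator (cball 0 r) (r *\<^sub>R h) * (r *\<^sub>R h \<bullet> v)\<^sup>2) = (\<lambda>h. r\<^sup>2 * (?i h * (h \<bullet> v)\<^sup>2))"
      using indicator_cball_scaleR[OF r, of 1, where 'a='a] by (auto simp: power_mult_distrib)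
    also have "r ^ DIM('a) * (LBINT h. r\<^sup>2 * (?i h * (h \<bullet> v)\<^sup>2)) = \<kappa> * r ^ (DIM('a) + 2) * (norm v)\<^sup>2"
      by (simp add: unit power_add power2_eq_square[of r])
    finally show ?thesis .
  qed
  ultimately show ?thesis using that by blast
qed

section \<open>Translation differences and the Dirichlet energy\<close>

text \<open>For |h| \<le> 1 the remainder lives in the ball of radius R + 1, so the uniform Taylor
  bound can be integrated. The L^2 bound serves to estimate differences of f itself; the L^1 bound
  serves when the remainder acts as a convolution kernel.\<close>

lemma smooth_remainder:
  fixes f :: "'a::euclidean_space \<Rightarrow> real"
  assumes f: "smooth f" "bounded {x. f x \<noteq> 0}" and "0 < e"
  obtains d where "0 < d"
    "\<And>h. norm h \<le> d \<Longrightarrow> norm2 (\<lambda>x. f x - f (x - h) - h \<bullet> gradient f x) \<le> e * norm h"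
    "\<And>h. norm h \<le> d \<Longrightarrow> (LBINT x. \<bar>f x - f (x - h) - h \<bullet> gradient f x\<bar>) \<le> e * norm h"
proof -
  obtain R where R: "\<And>x. f x \<noteq> 0 \<Longrightarrow> norm x \<le> R" "\<And>x. gradient f x \<noteq> 0 \<Longrightarrow> norm x \<le> R"
    using smooth_support_cball[OF f(2)] by metis
  note bbs = smooth_bbs[OF f]
  let ?I = "indicator (cball (0::'a) (R + 1)) :: 'a \<Rightarrow> real"
  \<comment> \<open>One constant that dominates both the L^2 norm and the integral of the indicator
    and is positive.\<close>
  define C where "C = norm2 ?I + (LBINT x. ?I x) + 1"
  have C: "norm2 ?I \<le> C" "(LBINT x. ?I x) \<le> C" "0 < C"
  proof -
    have "0 \<le> (LBINT x. ?I x)" by (intro integral_nonneg_AE) auto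
    then show "norm2 ?I \<le> C" "(LBINT x. ?I x) \<le> C" "0 < C"
      using norm2_nonneg[of ?I] unfolding C_def by linarith+
  qed
  obtain d where d: "0 < d" "\<And>x h. norm h \<le> d \<Longrightarrow> \<bar>f (x + h) - f x - h \<bullet> gradient f x\<bar> \<le> e / C * norm h"
    using smooth_uniform_Taylor[OF f, of "e / C"] \<open>0 < e\<close> C by (metis divide_pos_pos)
  let ?r = "\<lambda>h x. f x - f (x - h) - h \<bullet> gradient f x"
  have br: "bbs (?r h)" for h by (intro bbs_diff bbs bbs_translate)
  have le: "\<bar>?r h x\<bar> \<le> e / C * norm h * ?I x" if h: "norm h \<le> min d 1" for h x
  proof (cases "norm x \<le> R + 1")
    case True
    have "\<bar>f (x + - h) - f x - (- h) \<bullet> gradient f x\<bar> \<le> e / C * norm (- h)"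
      using h by (intro d) auto
    moreover have "f (x + - h) - f x - (- h) \<bullet> gradient f x = - ?r h x" by simp
    ultimately show ?thesis using True by simp
  next
    case False
    then have "\<not> norm x \<le> R" "\<not> norm (x - h) \<le> R"
      using h norm_triangle_ineq[of "x - h" h] by auto
    then have "f x = 0" "f (x - h) = 0" "gradient f x = 0" using R by blast+
    then show ?thesis using False by simp
  qed
  show ?thesis
  proof (rule that)
    show "0 < min d 1" using d by simp
    fix h :: 'a assume h: "norm h \<le> min d 1"
    have "norm2 (?r h) \<le> norm2 (\<lambda>x. e / C * norm h * ?I x)"
      unfolding norm2_def
    proof (intro real_sqrt_le_mono integral_mono)
      show "integrable lborel (\<lambda>x. (?r h x)\<^sup>2)" by (intro bbs_integrable bbs_power2 br)
      show "integrable lborel (\<lambda>x. (e / C * norm h * ?I x)\<^sup>2)"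
        by (intro bbs_integrable bbs_power2 bbs_cmult bbs_indicator_cball)
      show "(?r h x)\<^sup>2 \<le> (e / C * norm h * ?I x)\<^sup>2" for x
        using le[OF h, of x] by (intro power2_le_iff_abs_le[THEN iffD2]) (use \<open>0 < e\<close> C in auto)
    qed
    also have "\<dots> = e / C * norm h * norm2 ?I"
      using \<open>0 < e\<close> C unfolding norm2_def power_mult_distrib
      by (simp only: integral_mult_right_zero real_sqrt_mult) simp
    also have "\<dots> \<le> e / C * norm h * C" using C \<open>0 < e\<close> by (intro mult_left_mono) auto
    finally show "norm2 (?r h) \<le> e * norm h" using C by simp
    have "(LBINT x. \<bar>?r h x\<bar>) \<le> (LBINT x. e / C * norm h * ?I x)"
      by (rule integral_mono[OF _ _ le[OF h]])
        (intro bbs_integrable bbs_abs br bbs_cmult bbs_indicator_cball)+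
    also have "\<dots> = e / C * norm h * (LBINT x. ?I x)" by (rule integral_mult_right_zero)
    also have "\<dots> \<le> e / C * norm h * C" using C \<open>0 < e\<close> by (intro mult_left_mono) auto
    finally show "(LBINT x. \<bar>?r h x\<bar>) \<le> e * norm h" using C by simp
  qed
qed

lemma norm2_cmult: "norm2 (\<lambda>x. c * w x) = \<bar>c\<bar> * norm2 w"
  unfolding norm2_def power_mult_distrib by (simp add: real_sqrt_mult)

text \<open>The vector h is cut into N steps so short that the first-order expansion is accurate;
  telescoping reassembles them, and the accumulated error is at most e.\<close>

lemma shift_energy_le_gradient:
  fixes f :: "'a::euclidean_space \<Rightarrow> real"
  assumes f: "smooth f" "bounded {x. f x \<noteq> 0}"
  shows "shift_energy f h \<le> (LBINT x. (h \<bullet> gradient f x)\<^sup>2)"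
proof -
  note bbs = smooth_bbs[OF f]
  have "norm2 (\<lambda>x. f x - f (x - h)) \<le> norm2 (\<lambda>x. h \<bullet> gradient f x) + e" if "0 < e" for e
  proof -
    \<comment> \<open>The steps have total length norm h, so the total error is e norm h / (norm h +
      1) \<le> e; the 1 covers h = 0.\<close>
    have "0 < e / (norm h + 1)" using that by (simp add: add_nonneg_pos)
    then obtain d where d: "0 < d"
      "\<And>k. norm k \<le> d \<Longrightarrow> norm2 (\<lambda>x. f x - f (x - k) - k \<bullet> gradient f x) \<le> e / (norm h + 1) * norm k"
      using smooth_remainder[OF f] by metis
    obtain N where N: "norm h / d < real N" using reals_Archimedean2 by blast
    have "0 \<le> norm h / d" using d by simp
    then have N0: "0 < real N" using N by linarith
    define k where "k = h /\<^sub>R real N"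
    have h: "h = real N *\<^sub>R k" and nk: "norm k = norm h / N" using N0 by (auto simp: k_def divide_inverse)
    have kd: "norm k \<le> d" using N d N0 by (simp add: nk field_simps)
    have "norm2 (\<lambda>x. f x - f (x - h)) \<le> N * norm2 (\<lambda>x. f x - f (x - k))"
      unfolding h by (rule norm2_shift_of_nat[OF bbs(1)])
    also have "norm2 (\<lambda>x. f x - f (x - k)) = norm2 (\<lambda>x. k \<bullet> gradient f x + (f x - f (x - k) - k \<bullet> gradient f x))"
      by simp
    also have "\<dots> \<le> norm2 (\<lambda>x. k \<bullet> gradient f x) + norm2 (\<lambda>x. f x - f (x - k) - k \<bullet> gradient f x)"
      by (intro norm2_triangle bbs bbs_diff bbs_translate)
    also have "norm2 (\<lambda>x. f x - f (x - k) - k \<bullet> gradient f x) \<le> e / (norm h + 1) * norm k"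
      by (rule d(2)[OF kd])
    also have "norm2 (\<lambda>x. k \<bullet> gradient f x) = norm2 (\<lambda>x. h \<bullet> gradient f x) / N"
      using N0 norm2_cmult[of "inverse N" "\<lambda>x. h \<bullet> gradient f x"] by (simp add: k_def divide_inverse mult.commute)
    finally have "norm2 (\<lambda>x. f x - f (x - h)) \<le> N * (norm2 (\<lambda>x. h \<bullet> gradient f x) / N + e / (norm h + 1) * norm k)"
      using N0 by (simp add: mult_left_mono)
    also have "\<dots> = norm2 (\<lambda>x. h \<bullet> gradient f x) + e * (norm h / (norm h + 1))"
      using N0 by (simp add: nk distrib_left)
    also have "\<dots> \<le> norm2 (\<lambda>x. h \<bullet> gradient f x) + e * 1"
      using that by (intro add_left_mono mult_left_mono) (auto simp: divide_le_eq_1 add_nonneg_pos)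
    finally show ?thesis by simp
  qed
  then have "norm2 (\<lambda>x. f x - f (x - h)) \<le> norm2 (\<lambda>x. h \<bullet> gradient f x)"
    by (rule field_le_epsilon)
  then show ?thesis
    unfolding shift_energy_norm2 norm2_square[symmetric] by (intro power_mono norm2_nonneg)
qed

text \<open>The Taylor remainder of \<open>conv f w\<close> is the remainder of f convolved with w,
  so Young's inequality yields a radius d that does not depend on w. This uniformity is essential: w
  will be constructed from a kernel whose radius is chosen after d.\<close>

lemma norm2_gradient_conv_le:
  fixes f :: "'a::euclidean_space \<Rightarrow> real"
  assumes f: "smooth f" "bounded {x. f x \<noteq> 0}" and "0 < e"
  obtains d where "0 < d"
    "\<And>h w. norm h \<le> d \<Longrightarrow> bbs w \<Longrightarrow>
      norm2 (\<lambda>x. h \<bullet> gradient (conv f w) x) \<le> norm2 (\<lambda>x. conv f w x - conv f w (x - h)) + e * norm h * norm2 w"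
proof -
  note bbs = smooth_bbs[OF f]
  obtain d where d: "0 < d"
    "\<And>h. norm h \<le> d \<Longrightarrow> (LBINT x. \<bar>f x - f (x - h) - h \<bullet> gradient f x\<bar>) \<le> e * norm h"
    using smooth_remainder[OF f \<open>0 < e\<close>] by metis
  show ?thesis
  proof (rule that[OF d(1)])
    fix h :: 'a and w :: "'a \<Rightarrow> real" assume h: "norm h \<le> d" and w: "bbs w"
    let ?g = "conv f w"
    let ?r = "\<lambda>x. f x - f (x - h) - h \<bullet> gradient f x"
    have br: "bbs ?r" by (intro bbs_diff bbs bbs_translate)
    have bg: "bbs ?g" by (intro bbs_conv bbs w)
    have conv_r: "conv ?r w x = ?g x - ?g (x - h) - h \<bullet> gradient ?g x" for x
    proof -
      have i: "integrable lborel (\<lambda>z. u (x - z) * w z)" if "bbs u" for u x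
        using that w by (intro bbs_integrable bbs_mult bbs_reflect)
      have j: "integrable lborel (\<lambda>z. f (x - h - z) * w z)" by (rule i[OF bbs(1)])
      have "conv ?r w x = (LBINT z. f (x - z) * w z - f (x - h - z) * w z - (h \<bullet> gradient f (x - z)) * w z)"
        using bbs_borel[OF br] bbs_borel[OF w]
        by (simp add: conv_commute left_diff_distrib distrib_right diff_diff_eq add.commute[of h])
      also have "\<dots> = ?g x - ?g (x - h) - h \<bullet> gradient ?g x"
        using i[OF bbs(1)] j i[OF bbs(2)] bbs_borel[OF bbs(1)] bbs_borel[OF bbs(2)] bbs_borel[OF w]
        by (simp add: inner_gradient_conv[OF f w] conv_commute)
      finally show ?thesis .
    qed
    have "norm2 (\<lambda>x. h \<bullet> gradient ?g x) = norm2 (\<lambda>x. (?g x - ?g (x - h)) + (-1) * conv ?r w x)"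
      unfolding conv_r by simp
    also have "\<dots> \<le> norm2 (\<lambda>x. ?g x - ?g (x - h)) + norm2 (\<lambda>x. (-1) * conv ?r w x)"
      by (intro norm2_triangle bbs_diff bg bbs_translate bbs_cmult bbs_conv br w)
    also have "norm2 (\<lambda>x. (-1) * conv ?r w x) = norm2 (conv ?r w)"
      using norm2_cmult[of "-1" "conv ?r w"] by simp
    also have "\<dots> \<le> (LBINT x. \<bar>?r x\<bar>) * norm2 w" by (rule norm2_conv_le[OF br w])
    also have "\<dots> \<le> e * norm h * norm2 w" by (intro mult_right_mono d h norm2_nonneg)
    finally show "norm2 (\<lambda>x. h \<bullet> gradient ?g x) \<le> norm2 (\<lambda>x. ?g x - ?g (x - h)) + e * norm h * norm2 w" by simp
  qed
qed

lemma bbs_directional_energy: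
  fixes f :: "'a::euclidean_space \<Rightarrow> real"
  assumes f: "smooth f" "bounded {x. f x \<noteq> 0}" and k: "bbs k"
  shows "bbs (\<lambda>(h,x). k h * (h \<bullet> gradient f x)\<^sup>2)"
proof -
  obtain R where R: "\<And>x. gradient f x \<noteq> 0 \<Longrightarrow> norm x \<le> R"
    using smooth_support_cball[OF f(2)] by metis
  obtain S where S: "\<And>x. k x \<noteq> 0 \<Longrightarrow> norm x \<le> S" using bbs_cball[OF k] by metis
  \<comment> \<open>The square (h . grad f)^2 is unbounded in h; cutting h to a ball that contains
    the support of k makes it bounded and leaves the product with k unchanged.\<close>
  let ?I = "indicator (cball (0::'a) S) :: 'a \<Rightarrow> real"
  have bq: "bbs (\<lambda>z::'a\<times>'a. ?I (fst z) * (fst z \<bullet> gradient f (snd z))\<^sup>2)"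
  proof (rule bbsI)
    have c: "continuous_on UNIV (\<lambda>z::'a\<times>'a. (fst z \<bullet> gradient f (snd z))\<^sup>2)"
      by (intro continuous_intros continuous_on_compose2[OF continuous_gradient[OF f(1)]]) auto
    have "bounded ((\<lambda>z::'a\<times>'a. (fst z \<bullet> gradient f (snd z))\<^sup>2) ` (cball 0 S \<times> cball 0 R))"
      by (intro compact_imp_bounded compact_continuous_image compact_Times continuous_on_subset[OF c]
          compact_cball subset_UNIV)
    then obtain M where M: "\<forall>y \<in> (\<lambda>z::'a\<times>'a. (fst z \<bullet> gradient f (snd z))\<^sup>2) ` (cball 0 S \<times> cball 0 R). norm y \<le> M"
      unfolding bounded_iff ..
    have "\<bar>?I (fst z) * (fst z \<bullet> gradient f (snd z))\<^sup>2\<bar> \<le> max M 0" for z :: "'a\<times>'a"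
    proof (cases "norm (fst z) \<le> S \<and> gradient f (snd z) \<noteq> 0")
      case True
      then have "z \<in> cball 0 S \<times> cball 0 R" using R by (auto simp: mem_Times_iff)
      then show ?thesis using bspec[OF M imageI, of z] True by auto
    next
      case False
      then show ?thesis by (auto simp: indicator_def)
    qed
    moreover have "(\<lambda>z::'a\<times>'a. ?I (fst z) * (fst z \<bullet> gradient f (snd z))\<^sup>2) \<in> borel_measurable borel"
    proof (intro borel_measurable_times)
      show "(\<lambda>z::'a\<times>'a. ?I (fst z)) \<in> borel_measurable borel"
        by (rule bounded_measurable_borel[OF bounded_measurable_fst[OF bbs_bounded_measurable[OF bbs_indicator_cball]]])
    qed (rule borel_measurable_continuous_onI[OF c])
    ultimately show "bounded_measurable (\<lambda>z::'a\<times>'a. ?I (fst z) * (fst z \<bullet> gradient f (snd z))\<^sup>2)"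
      by (intro bounded_measurableI)
    show "bounded (cball (0::'a) S \<times> cball (0::'a) R)" by (intro bounded_Times) auto
    show "z \<in> cball 0 S \<times> cball 0 R" if "?I (fst z) * (fst z \<bullet> gradient f (snd z))\<^sup>2 \<noteq> 0" for z
    proof -
      have "norm (fst z) \<le> S" "gradient f (snd z) \<noteq> 0"
        using that by (auto simp: indicator_def split: if_splits)
      then show ?thesis using R[of "snd z"] by (simp add: mem_Times_iff)
    qed
  qed
  have "bbs (\<lambda>z::'a\<times>'a. ?I (fst z) * (fst z \<bullet> gradient f (snd z))\<^sup>2 * k (fst z))"
    by (intro bbs_mult_bounded bq bounded_measurable_fst bbs_bounded_measurable k)
  moreover have "?I h * (h \<bullet> gradient f x)\<^sup>2 * k h = k h * (h \<bullet> gradient f x)\<^sup>2" for h x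
    using S[of h] by (auto simp: indicator_def)
  ultimately show ?thesis by (simp add: case_prod_unfold)
qed

lemma average_directional_energy:
  fixes f :: "'a::euclidean_space \<Rightarrow> real"
  assumes f: "smooth f" "bounded {x. f x \<noteq> 0}" 
    and \<kappa>: "\<And>v::'a. (LBINT h. k h * (h \<bullet> v)\<^sup>2) = c * (norm v)\<^sup>2" and k: "bbs k"
  shows "(LBINT h. k h * (LBINT x. (h \<bullet> gradient f x)\<^sup>2)) = c * (LBINT x. (norm (gradient f x))\<^sup>2)"
    and "bbs (\<lambda>h. k h * (LBINT x. (h \<bullet> gradient f x)\<^sup>2))"
proof -
  note B = bbs_directional_energy[OF f k]
  have "(LBINT h. k h * (LBINT x. (h \<bullet> gradient f x)\<^sup>2)) = (LBINT h. (LBINT x. k h * (h \<bullet> gradient f x)\<^sup>2))"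
    by simp
  also have "\<dots> = (LBINT x. (LBINT h. k h * (h \<bullet> gradient f x)\<^sup>2))"
    by (rule bbs_Fubini[OF B])
  finally show "(LBINT h. k h * (LBINT x. (h \<bullet> gradient f x)\<^sup>2)) = c * (LBINT x. (norm (gradient f x))\<^sup>2)"
    by (simp add: \<kappa>)
  show "bbs (\<lambda>h. k h * (LBINT x. (h \<bullet> gradient f x)\<^sup>2))"
    using bbs_marginal[OF B] by simp
qed

lemma average_shift_energy_le:
  fixes f :: "'a::euclidean_space \<Rightarrow> real"
  assumes f: "smooth f" "bounded {x. f x \<noteq> 0}" 
    and \<kappa>: "\<And>v::'a. (LBINT h. k h * (h \<bullet> v)\<^sup>2) = c * (norm v)\<^sup>2" and k: "bbs k" "\<And>h. 0 \<le> k h"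
  shows "(LBINT h. k h * shift_energy f h) \<le> c * (LBINT x. (norm (gradient f x))\<^sup>2)"
  unfolding average_directional_energy(1)[OF f \<kappa> k(1), symmetric]
  by (intro integral_mono bbs_integrable bbs_mult_shift_energy k smooth_bbs[OF f]
      average_directional_energy(2)[OF f \<kappa> k(1)] mult_left_mono shift_energy_le_gradient f)

lemma square_sum_le:
  fixes a b s :: real
  assumes "0 < s"
  shows "(a + b)\<^sup>2 \<le> (1 + s) * a\<^sup>2 + (1 + 1 / s) * b\<^sup>2"
proof -
  have "0 \<le> (s * a - b)\<^sup>2 / s" using assms by simp
  also have "\<dots> = s * a\<^sup>2 + b\<^sup>2 / s - 2 * a * b"
    using assms by (simp add: power2_eq_square field_simps)
  finally show ?thesis by (simp add: power2_sum algebra_simps)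
qed

text \<open>The second-moment matrix of k is c times the identity. The intended instance is the
  indicator of a ball of radius r, with c = \<kappa> r^(n + 2).\<close>

definition isotropic_kernel :: "('a::euclidean_space \<Rightarrow> real) \<Rightarrow> real \<Rightarrow> real \<Rightarrow> bool" where
  "isotropic_kernel k r c \<longleftrightarrow> bbs k \<and> (\<forall>h. 0 \<le> k h) \<and> (\<forall>h. k h \<noteq> 0 \<longrightarrow> norm h \<le> r)
    \<and> (\<forall>v. (LBINT h. k h * (h \<bullet> v)\<^sup>2) = c * (norm v)\<^sup>2)"

text \<open>Converse to \<open>average_shift_energy_le\<close> for mollified functions: the bound at
  each h is squared with weights 1 + s and 1 + 1/s and averaged over k. As k has total second moment
  \<open>DIM('a)\<close> times c, the error is proportional to c and survives division by c without
  blowing up for small kernels.\<close>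

lemma gradient_energy_conv_le:
  fixes f :: "'a::euclidean_space \<Rightarrow> real"
  assumes f: "smooth f" "bounded {x. f x \<noteq> 0}" and "0 < e" "0 < s"
  obtains d where "0 < d"
    "\<And>\<delta> k c w. \<delta> \<le> d \<Longrightarrow> isotropic_kernel k \<delta> c \<Longrightarrow> bbs w \<Longrightarrow>
      c * (LBINT x. (norm (gradient (conv f w) x))\<^sup>2)
      \<le> (1 + s) * (LBINT h. k h * shift_energy (conv f w) h)
        + (1 + 1 / s) * e\<^sup>2 * (norm2 w)\<^sup>2 * (real DIM('a) * c)"
proof -
  obtain d where d: "0 < d" "\<And>h w. norm h \<le> d \<Longrightarrow> bbs w \<Longrightarrow>
      norm2 (\<lambda>x. h \<bullet> gradient (conv f w) x) \<le> norm2 (\<lambda>x. conv f w x - conv f w (x - h)) + e * norm h * norm2 w"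
    using norm2_gradient_conv_le[OF f \<open>0 < e\<close>] by metis
  show ?thesis
  proof (rule that[OF d(1)])
    fix \<delta> c :: real and k w :: "'a \<Rightarrow> real"
    assume \<delta>: "\<delta> \<le> d" and iso: "isotropic_kernel k \<delta> c" and w: "bbs w"
    have k: "bbs k" "\<And>h. 0 \<le> k h" "\<And>h. k h \<noteq> 0 \<Longrightarrow> norm h \<le> \<delta>"
      and c: "\<And>v::'a. (LBINT h. k h * (h \<bullet> v)\<^sup>2) = c * (norm v)\<^sup>2"
      using iso by (auto simp: isotropic_kernel_def)
    let ?g = "conv f w"
    let ?W = "(1 + 1 / s) * e\<^sup>2 * (norm2 w)\<^sup>2"
    have bg: "bbs ?g" by (intro bbs_conv smooth_bbs f w)
    have g: "smooth ?g" "bounded {x. ?g x \<noteq> 0}"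
      using smooth_conv[OF f w] bg by (auto simp: bbs_def)
    have bh: "bbs (\<lambda>h. k h * (h \<bullet> b)\<^sup>2)" for b
    proof (rule bbsI)
      note [measurable] = bbs_borel[OF k(1)]
      obtain M where M: "M > 0" "\<And>x. \<bar>k x\<bar> \<le> M"
        using k bbs_bounded_measurable bounded_measurableE by metis
      show "bounded_measurable (\<lambda>h. k h * (h \<bullet> b)\<^sup>2)"
      proof (rule bounded_measurableI)
        fix h
        show "\<bar>k h * (h \<bullet> b)\<^sup>2\<bar> \<le> M * (\<delta> * norm b)\<^sup>2"
        proof (cases "k h = 0")
          case False
          have "\<bar>h \<bullet> b\<bar> \<le> norm h * norm b" by (rule Cauchy_Schwarz_ineq2)
          also have "\<dots> \<le> \<delta> * norm b" using k(3)[OF False] by (rule mult_right_mono) simp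
          finally have "(h \<bullet> b)\<^sup>2 \<le> (\<delta> * norm b)\<^sup>2" by (simp add: abs_le_square_iff[symmetric])
          then show ?thesis using M(2)[of h] M(1) by (simp add: abs_mult mult_mono)
        qed (use M in simp)
      qed measurable
      show "bounded {h. k h \<noteq> 0}" using k by (simp add: bbs_def)
    qed auto
    have n: "k h * (norm h)\<^sup>2 = (\<Sum>b\<in>Basis. k h * (h \<bullet> b)\<^sup>2)" for h
      unfolding power2_norm_eq_inner by (subst euclidean_inner) (simp add: sum_distrib_left power2_eq_square)
    have intn: "integrable lborel (\<lambda>h. k h * (norm h)\<^sup>2)"
      unfolding n by (intro Bochner_Integration.integrable_sum bbs_integrable bh)
    have trace: "(LBINT h. k h * (norm h)\<^sup>2) = DIM('a) * c"
      unfolding n by (simp add: c bbs_integrable[OF bh])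
    have "c * (LBINT x. (norm (gradient ?g x))\<^sup>2) = (LBINT h. k h * (LBINT x. (h \<bullet> gradient ?g x)\<^sup>2))"
      by (rule average_directional_energy(1)[OF g c k(1), symmetric])
    also have "\<dots> \<le> (LBINT h. (1 + s) * (k h * shift_energy ?g h) + ?W * (k h * (norm h)\<^sup>2))"
    proof (rule integral_mono)
      show "integrable lborel (\<lambda>h. k h * (LBINT x. (h \<bullet> gradient ?g x)\<^sup>2))"
        by (rule bbs_integrable[OF average_directional_energy(2)[OF g c k(1)]])
      show "integrable lborel (\<lambda>h. (1 + s) * (k h * shift_energy ?g h) + ?W * (k h * (norm h)\<^sup>2))"
        by (intro Bochner_Integration.integrable_add integrable_mult_right intn bbs_integrable[OF bbs_mult_shift_energy] k bg)
      fix h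
      show "k h * (LBINT x. (h \<bullet> gradient ?g x)\<^sup>2) \<le> (1 + s) * (k h * shift_energy ?g h) + ?W * (k h * (norm h)\<^sup>2)"
      proof (cases "k h = 0")
        case False
        then have "norm h \<le> d" using k(3) \<delta> by force
        then have "(norm2 (\<lambda>x. h \<bullet> gradient ?g x))\<^sup>2 \<le> (norm2 (\<lambda>x. ?g x - ?g (x - h)) + e * norm h * norm2 w)\<^sup>2"
          by (intro power_mono d w norm2_nonneg)
        also have "\<dots> \<le> (1 + s) * (norm2 (\<lambda>x. ?g x - ?g (x - h)))\<^sup>2 + (1 + 1 / s) * (e * norm h * norm2 w)\<^sup>2"
          by (rule square_sum_le[OF \<open>0 < s\<close>])
        finally have "(LBINT x. (h \<bullet> gradient ?g x)\<^sup>2) \<le> (1 + s) * shift_energy ?g h + ?W * (norm h)\<^sup>2"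
          unfolding norm2_square[of "\<lambda>x. h \<bullet> gradient ?g x"] shift_energy_norm2 by (simp add: power_mult_distrib mult_ac)
        from mult_left_mono[OF this k(2)[of h]] show ?thesis by (simp add: algebra_simps)
      qed simp
    qed
    also have "\<dots> = (1 + s) * (LBINT h. k h * shift_energy ?g h) + ?W * (real DIM('a) * c)"
      by (subst Bochner_Integration.integral_add)
        (intro integrable_mult_right intn bbs_integrable[OF bbs_mult_shift_energy] k bg,
          intro integrable_mult_right intn bbs_integrable[OF bbs_mult_shift_energy] k bg,
          simp only: integral_mult_right_zero trace)
    finally show "c * (LBINT x. (norm (gradient ?g x))\<^sup>2)
      \<le> (1 + s) * (LBINT h. k h * shift_energy ?g h) + ?W * (real DIM('a) * c)" .
  qed
qed

section \<open>The bottom of the Dirichlet spectrum\<close>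

lemma test_function_bounded:
  "f \<in> test_functions D \<Longrightarrow> bounded {x. f x \<noteq> 0}"
  unfolding test_functions_def
  by (auto intro: bounded_subset[OF compact_imp_bounded closure_subset])

lemma set_integral_test_function:
  fixes f :: "'a::euclidean_space \<Rightarrow> real"
  assumes "closure {x. f x \<noteq> 0} \<subseteq> D"
  shows "(LINT x:D|lborel. (f x)\<^sup>2) = (LBINT x. (f x)\<^sup>2)"
    and "(LINT x:D|lborel. (norm (gradient f x))\<^sup>2) = (LBINT x. (norm (gradient f x))\<^sup>2)"
proof -
  have "f x = 0" "gradient f x = 0" if "x \<notin> D" for x
    using that assms closure_subset[of "{x. f x \<noteq> 0}"] gradient_eq_0[of x f] by blast+
  then show "(LINT x:D|lborel. (f x)\<^sup>2) = (LBINT x. (f x)\<^sup>2)"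
    "(LINT x:D|lborel. (norm (gradient f x))\<^sup>2) = (LBINT x. (norm (gradient f x))\<^sup>2)"
    unfolding set_lebesgue_integral_def
    by (intro Bochner_Integration.integral_cong refl, auto simp: indicator_def)+
qed

lemma lambda1_le_Rayleigh:
  fixes f :: "'a::euclidean_space \<Rightarrow> real"
  assumes f: "f \<in> test_functions D" and pos: "0 < (LBINT x. (f x)\<^sup>2)"
    and le: "(LBINT x. (norm (gradient f x))\<^sup>2) \<le> L * (LBINT x. (f x)\<^sup>2)"
  shows "lambda1 D \<le> ereal L"
proof -
  define c where "c = inverse (sqrt (LBINT x. (f x)\<^sup>2))"
  have c: "c > 0" "c\<^sup>2 * (LBINT x. (f x)\<^sup>2) = 1"
    using pos by (auto simp: c_def power_inverse)
  let ?g = "\<lambda>x. c * f x"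
  have supp: "{x. ?g x \<noteq> 0} = {x. f x \<noteq> 0}" using c by auto
  have g: "?g \<in> test_functions D"
    using f unfolding test_functions_def mem_Collect_eq supp by (auto intro: smooth_cmult)
  have clos: "closure {x. ?g x \<noteq> 0} \<subseteq> D" using g by (simp add: test_functions_def)
  have smooth: "smooth f" using f by (simp add: test_functions_def)
  have grad: "gradient ?g x = c *\<^sub>R gradient f x" for x
  proof (rule gradient_eqI)
    show "(?g has_derivative (\<lambda>h. h \<bullet> c *\<^sub>R gradient f x)) (at x)"
      using has_derivative_mult_right[OF smooth_has_derivative_gradient[OF smooth, of x], of c] by simp
  qed
  have "(LINT x:D|lborel. (?g x)\<^sup>2) = 1"
    unfolding set_integral_test_function(1)[OF clos] by (simp add: power_mult_distrib c)
  moreover have "(LINT x:D|lborel. (norm (gradient ?g x))\<^sup>2) = c\<^sup>2 * (LBINT x. (norm (gradient f x))\<^sup>2)"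
    unfolding set_integral_test_function(2)[OF clos] unfolding grad by (simp add: power_mult_distrib)
  ultimately have "lambda1 D \<le> ereal (c\<^sup>2 * (LBINT x. (norm (gradient f x))\<^sup>2))"
    unfolding lambda1_def using g by (intro Inf_lower) (auto intro!: exI[of _ ?g])
  also have "\<dots> \<le> ereal L"
  proof -
    have "c\<^sup>2 * (LBINT x. (norm (gradient f x))\<^sup>2) \<le> c\<^sup>2 * (L * (LBINT x. (f x)\<^sup>2))"
      using le by (rule mult_left_mono) simp
    also have "\<dots> = L * (c\<^sup>2 * (LBINT x. (f x)\<^sup>2))" by simp
    finally show ?thesis by (simp add: c)
  qed
  finally show ?thesis .
qed

text \<open>The last bound, with \<open>M\<close> independent of r, dominates the mollifier by M/r^n
  times the indicator of the ball of radius r. Averages against it are thereby reduced to averages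
  over balls.\<close>

lemma mollifiers:
  obtains M :: real and \<phi> :: "real \<Rightarrow> 'a::euclidean_space \<Rightarrow> real" where "0 < M"
    "\<And>r. 0 < r \<Longrightarrow> smooth (\<phi> r)" "\<And>r x. 0 < r \<Longrightarrow> \<phi> r x \<noteq> 0 \<Longrightarrow> norm x \<le> r"
    "\<And>r. 0 < r \<Longrightarrow> (LBINT x. \<phi> r x) = 1"
    "\<And>r x. 0 < r \<Longrightarrow> 0 \<le> \<phi> r x" "\<And>r x. 0 < r \<Longrightarrow> \<phi> r x * r ^ DIM('a) \<le> M"
proof -
  define \<psi> where "\<psi> x = exp_germ 0 (1 - x \<bullet> x)" for x :: 'a
  have sm: "smooth \<psi>" using smooth_exp_germ[of 0 1 1] by (simp add: \<psi>_def[abs_def])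
  have \<psi>: "0 \<le> \<psi> x" "\<psi> x \<le> 1" "\<psi> x \<noteq> 0 \<longleftrightarrow> norm x < 1" for x
  proof -
    show "0 \<le> \<psi> x" by (simp add: \<psi>_def exp_germ_def)
    show "\<psi> x \<le> 1" by (auto simp: \<psi>_def exp_germ_def divide_le_eq_1)
    show "\<psi> x \<noteq> 0 \<longleftrightarrow> norm x < 1"
      by (auto simp: \<psi>_def exp_germ_def norm_lt_square)
  qed
  have b: "bbs \<psi>" by (rule bbs_continuous[of _ 1]) (use \<psi>(3) smooth_continuous[OF sm] in \<open>auto simp: less_imp_le\<close>)
  define Z where "Z = (LBINT x. \<psi> x)"
  have Z: "0 < Z"
  proof -
    have "Z \<noteq> 0"
    proof
      assume "Z = 0"
      then have "AE x in lborel. \<psi> x = 0"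
        unfolding Z_def using \<psi>(1) by (subst (asm) integral_nonneg_eq_0_iff_AE) (auto intro: bbs_integrable b)
      then have "AE x in lborel. x \<notin> ball (0::'a) 1" by eventually_elim (use \<psi>(3) in auto)
      then have "emeasure lborel (ball (0::'a) 1) = 0"
        by (subst (asm) AE_iff_measurable[of "ball 0 1"]) auto
      then have "measure lborel (ball (0::'a) 1) = 0" by (simp add: measure_def)
      then show False using content_ball_pos[of 1 "0::'a"] by simp
    qed
    moreover have "0 \<le> Z" unfolding Z_def using \<psi> by (intro integral_nonneg_AE) auto
    ultimately show ?thesis by simp
  qed
  define \<phi> where "\<phi> r x = (1 / (Z * r ^ DIM('a))) * \<psi> (x /\<^sub>R r)" for r and x :: 'a
  show ?thesis
  proof (rule that[of "1 / Z" \<phi>])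
    show "0 < 1 / Z" using Z by simp
    fix r :: real assume r: "0 < r"
    have "\<psi> (x /\<^sub>R r) = exp_germ 0 (1 - (inverse r)\<^sup>2 * (x \<bullet> x))" for x
      by (simp add: \<psi>_def power2_eq_square mult.assoc)
    then show "smooth (\<phi> r)"
      unfolding \<phi>_def[abs_def] using smooth_cmult[OF smooth_exp_germ[of 0 1 "(inverse r)\<^sup>2"], of "1 / (Z * r ^ DIM('a))"] by simp
    show "norm x \<le> r" if "\<phi> r x \<noteq> 0" for x
      using that r \<psi>(3)[of "x /\<^sub>R r"] by (simp add: \<phi>_def field_simps)
    have "Z = (LBINT x. \<psi> (r *\<^sub>R x /\<^sub>R r))" using r by (simp add: Z_def)
    moreover have "(LBINT x. \<psi> (x /\<^sub>R r)) = r ^ DIM('a) * (LBINT x. \<psi> ((r *\<^sub>R x) /\<^sub>R r))"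
    proof (rule lborel_integral_scaleR[OF _ r])
      note [measurable] = bbs_borel[OF b]
      show "(\<lambda>x. \<psi> (x /\<^sub>R r)) \<in> borel_measurable borel" by measurable
    qed
    ultimately show "(LBINT x. \<phi> r x) = 1"
      unfolding \<phi>_def using r Z by simp
    show "0 \<le> \<phi> r x" for x using \<psi>(1) r Z by (simp add: \<phi>_def)
    show "\<phi> r x * r ^ DIM('a) \<le> 1 / Z" for x using \<psi>(2)[of "x /\<^sub>R r"] r Z by (simp add: \<phi>_def divide_right_mono)
  qed
qed

text \<open>Substituting N h for h contributes N to the dimension, and telescoping each difference
  contributes N^2.\<close>

lemma average_shift_energy_of_nat:
  assumes w: "bbs w" and "0 < \<delta>" "0 < N"
  shows "(LBINT h. indicator (cball 0 (real N * \<delta>)) h * shift_energy w h)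
    \<le> real N ^ (DIM('a) + 2) * (LBINT h. indicator (cball (0::'a::euclidean_space) \<delta>) h * shift_energy w h)"
proof -
  let ?k = "\<lambda>r. indicator (cball (0::'a) r) :: 'a \<Rightarrow> real"
  have bk: "bbs (\<lambda>h. ?k r h * shift_energy w h)" for r
    by (rule bbs_mult_shift_energy[OF bbs_indicator_cball w])
  have "(LBINT h. ?k (real N * \<delta>) h * shift_energy w h)
      = real N ^ DIM('a) * (LBINT h. ?k (real N * \<delta>) (real N *\<^sub>R h) * shift_energy w (real N *\<^sub>R h))"
    by (rule lborel_integral_scaleR[OF bbs_borel[OF bk]]) (use assms in simp)
  also have "(\<lambda>h. ?k (real N * \<delta>) (real N *\<^sub>R h) * shift_energy w (real N *\<^sub>R h)) = (\<lambda>h. ?k \<delta> h * shift_energy w (real N *\<^sub>R h))"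
    using assms by (simp add: indicator_cball_scaleR)
  also have "real N ^ DIM('a) * (LBINT h. ?k \<delta> h * shift_energy w (real N *\<^sub>R h))
      \<le> real N ^ DIM('a) * (LBINT h. (real N)\<^sup>2 * (?k \<delta> h * shift_energy w h))"
  proof (intro mult_left_mono integral_mono')
    show "integrable lborel (\<lambda>h. (real N)\<^sup>2 * (?k \<delta> h * shift_energy w h))"
      by (intro bbs_integrable bbs_cmult bk)
    show "?k \<delta> h * shift_energy w (real N *\<^sub>R h) \<le> (real N)\<^sup>2 * (?k \<delta> h * shift_energy w h)" for h
      using mult_left_mono[OF shift_energy_of_nat[OF w, of N h], of "?k \<delta> h"] by (simp add: mult_ac)
    show "0 \<le> (real N)\<^sup>2 * (?k \<delta> h * shift_energy w h)" for h by (simp add: shift_energy_nonneg)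
  qed simp
  also have "\<dots> = real N ^ (DIM('a) + 2) * (LBINT h. ?k \<delta> h * shift_energy w h)"
    by (simp add: power_add power2_eq_square)
  finally show ?thesis .
qed

text \<open>By the reverse triangle inequality absolute values do not raise the energy. This permits
  replacing f and g by |f| and |g|, as the transfer of moments works with nonnegative
  functions.\<close>

lemma shift_energy_abs_le:
  assumes "bbs w"
  shows "shift_energy (\<lambda>x. \<bar>w x\<bar>) h \<le> shift_energy w h"
  unfolding shift_energy_def
proof (rule integral_mono)
  show "(\<bar>w x\<bar> - \<bar>w (x - h)\<bar>)\<^sup>2 \<le> (w x - w (x - h))\<^sup>2" for x
    by (rule abs_le_square_iff[THEN iffD1]) (rule abs_triangle_ineq3)
qed (intro bbs_integrable bbs_power2 bbs_diff bbs_abs bbs_translate[of w] bbs_translate[of "\<lambda>x. \<bar>w x\<bar>"] assms)+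

text \<open>Here A and B are compact symmetric convex sets carrying f and g, and D is an open
  neighbourhood of their intersection. Compactness leaves room in D for mollification. The choices
  are made in the order \<eta>, then s and e, then d, then N and \<delta>, and only then w.\<close>

lemma lambda1_Int_le_gradient_energy:
  fixes f g :: "'a::euclidean_space \<Rightarrow> real"
  assumes f: "smooth f" "bounded {x. f x \<noteq> 0}" "\<And>x. f x \<noteq> 0 \<Longrightarrow> x \<in> A" "(LBINT x. (f x)\<^sup>2) = 1"
    and g: "smooth g" "bounded {x. g x \<noteq> 0}" "\<And>x. g x \<noteq> 0 \<Longrightarrow> x \<in> B" "(LBINT x. (g x)\<^sup>2) = 1"
    and A: "compact A" "convex A" "\<And>x. x \<in> A \<Longrightarrow> - x \<in> A"
    and B: "compact B" "convex B" "\<And>x. x \<in> B \<Longrightarrow> - x \<in> B"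
    and D: "open D" "A \<inter> B \<subseteq> D"
  shows "lambda1 D \<le> ereal ((LBINT x. (norm (gradient f x))\<^sup>2) + (LBINT x. (norm (gradient g x))\<^sup>2))"
    (is "_ \<le> ereal ?\<Lambda>")
proof (rule ereal_le_epsilon2)
  fix \<epsilon> :: real assume \<epsilon>: "0 < \<epsilon>"
  define \<Lambda> where "\<Lambda> = ?\<Lambda>"
  define L where "L = \<Lambda> + \<epsilon>"
  \<comment> \<open>The gap from \<Lambda> to L1 is spent on averaging and on the transfer to K0,
    the gap from L1 to L on mollification.\<close>
  define L1 where "L1 = \<Lambda> + \<epsilon> / 2"
  have "0 \<le> \<Lambda>" unfolding \<Lambda>_def by (intro add_nonneg_nonneg integral_nonneg_AE) auto
  with \<epsilon> have L1: "0 < L1" "L1 < L" "\<Lambda> < L1" unfolding L_def L1_def by linarith+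
  obtain \<kappa> :: real where \<kappa>: "0 < \<kappa>"
    "\<And>r (v::'a). 0 < r \<Longrightarrow>
      (LBINT h. indicator (cball 0 r) h * (h \<bullet> v)\<^sup>2) = \<kappa> * r ^ (DIM('a) + 2) * (norm v)\<^sup>2"
    by (rule integral_cball_inner_square[where 'a='a]) (rule that)
  obtain M and \<phi> :: "real \<Rightarrow> 'a \<Rightarrow> real" where M: "0 < M" and
    \<phi>: "\<And>r. 0 < r \<Longrightarrow> smooth (\<phi> r)" "\<And>r x. 0 < r \<Longrightarrow> \<phi> r x \<noteq> 0 \<Longrightarrow> norm x \<le> r"
    "\<And>r. 0 < r \<Longrightarrow> (LBINT x. \<phi> r x) = 1"
    "\<And>r x. 0 < r \<Longrightarrow> 0 \<le> \<phi> r x" "\<And>r x. 0 < r \<Longrightarrow> \<phi> r x * r ^ DIM('a) \<le> M"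
    using mollifiers[where 'a='a] by metis

  \<comment> \<open>Mollifying at scale \<eta> will change w by at most C \<eta> times its norm; C
    involves neither \<eta> nor \<delta>.\<close>
  define C where "C = sqrt (M * \<kappa> * L1)"
  have C: "0 < C" "C\<^sup>2 = M * \<kappa> * L1" using M \<kappa> L1 by (auto simp: C_def)
  \<comment> \<open>Mollification may shrink the norm by a factor \<theta> as long as \<theta>^2 L
    still exceeds L1; \<theta> is taken halfway between q and 1.\<close>
  define q where "q = sqrt (L1 / L)"
  have q: "q < 1" "0 \<le> q" "q\<^sup>2 = L1 / L" using L1 by (auto simp: q_def)
  define \<theta> where "\<theta> = (1 + q) / 2"
  have \<theta>: "q < \<theta>" "\<theta> < 1" "0 < \<theta>" using q by (auto simp: \<theta>_def)
  have "L1 / L < \<theta>\<^sup>2" using \<theta> q(2) unfolding q(3)[symmetric] by (intro power_strict_mono) auto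
  then have \<theta>L: "L1 < \<theta>\<^sup>2 * L" using L1 by (simp add: divide_less_eq)

  define K0 where "K0 = A \<inter> B"
  have K0: "compact K0" using A B unfolding K0_def by (intro compact_Int)
  obtain \<eta>0 where \<eta>0: "0 < \<eta>0" "(\<Union>x\<in>K0. cball x \<eta>0) \<subseteq> D"
    using compact_subset_open_imp_cball_epsilon_subset[OF K0 D(1)] D(2) unfolding K0_def by metis
  \<comment> \<open>The first bound keeps the mollified function supported in D, the second keeps
    the loss of norm within 1 - \<theta>.\<close>
  define \<eta> where "\<eta> = min \<eta>0 ((1 - \<theta>) / C)"
  have \<eta>: "0 < \<eta>" "\<eta> \<le> \<eta>0" "\<theta> \<le> 1 - C * \<eta>"
  proof -
    show "0 < \<eta>" "\<eta> \<le> \<eta>0" using \<eta>0 \<theta> C by (auto simp: \<eta>_def)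
    have "C * \<eta> \<le> C * ((1 - \<theta>) / C)" using C by (intro mult_left_mono) (auto simp: \<eta>_def)
    then show "\<theta> \<le> 1 - C * \<eta>" using C by simp
  qed
  let ?\<phi> = "\<phi> \<eta>"
  have b\<phi>: "bounded {x. ?\<phi> x \<noteq> 0}" using \<phi>(2)[OF \<eta>(1)] by (auto simp: bounded_iff)
  note s\<phi> = \<phi>(1)[OF \<eta>(1)]
  have bbs\<phi>: "bbs ?\<phi>" by (rule smooth_bbs[OF s\<phi> b\<phi>])

  \<comment> \<open>The room between L1 and \<theta>^2 L is split in two: s makes (1 + s) L1 = L1 +
    \<gamma>, and e makes the error term of \<open>gradient_energy_conv_le\<close> equal to
    \<gamma>.\<close>
  define \<gamma> where "\<gamma> = (\<theta>\<^sup>2 * L - L1) / 2"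
  define s where "s = \<gamma> / L1"
  define e where "e = sqrt (\<gamma> / ((1 + 1 / s) * DIM('a)))"
  have \<gamma>: "0 < \<gamma>" "0 < s" using \<theta>L L1 by (auto simp: \<gamma>_def s_def)
  then have "0 < (1 + 1 / s) * real DIM('a)" by (intro mult_pos_pos add_pos_pos) auto
  then have e: "0 < e" "(1 + 1 / s) * e\<^sup>2 * DIM('a) = \<gamma>" using \<gamma> by (auto simp: e_def)
  have sL: "(1 + s) * L1 = L1 + \<gamma>" using L1 by (simp add: s_def distrib_right)
  obtain d where d: "0 < d"
    "\<And>\<delta> k c w. \<delta> \<le> d \<Longrightarrow> isotropic_kernel k \<delta> c \<Longrightarrow> bbs w \<Longrightarrow>
      c * (LBINT x. (norm (gradient (conv ?\<phi> w) x))\<^sup>2)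
      \<le> (1 + s) * (LBINT h. k h * shift_energy (conv ?\<phi> w) h)
        + (1 + 1 / s) * e\<^sup>2 * (norm2 w)\<^sup>2 * (real DIM('a) * c)"
    by (rule gradient_energy_conv_le[OF s\<phi> b\<phi> e(1) \<gamma>(2)]) (rule that)

  define V where "V = (LBINT h. indicator (cball (0::'a) 1) h :: real)"
  have V: "0 < V" unfolding V_def by (rule integral_indicator_cball_pos) simp
  \<comment> \<open>The second bound gives \<delta> \<le> d; the third makes the kernel small enough
    that \<sigma> below is positive.\<close>
  obtain N :: nat where N: "max 1 (max (\<eta> / d) (\<kappa> * \<eta>\<^sup>2 * L1 / (2 * V))) < real N"
    using reals_Archimedean2 by blast
  define \<delta> where "\<delta> = \<eta> / real N"
  have \<delta>: "0 < \<delta>" "\<delta> \<le> d" "\<eta> = real N * \<delta>" "\<kappa> * \<delta>\<^sup>2 * L1 < 2 * V"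
  proof -
    show "0 < \<delta>" "\<eta> = real N * \<delta>" using N \<eta> by (auto simp: \<delta>_def)
    show "\<delta> \<le> d" using N d by (simp add: \<delta>_def field_simps)
    have "real N * 1 \<le> real N * real N" using N by (intro mult_left_mono) auto
    moreover have "\<kappa> * \<eta>\<^sup>2 * L1 / (2 * V) < real N" using N by simp
    ultimately have "\<kappa> * \<eta>\<^sup>2 * L1 / (2 * V) < (real N)\<^sup>2"
      unfolding power2_eq_square[of "real N"] by linarith
    then show "\<kappa> * \<delta>\<^sup>2 * L1 < 2 * V" using V N by (simp add: \<delta>_def power_divide field_simps)
  qed
  let ?k = "indicator (cball (0::'a) \<delta>) :: 'a \<Rightarrow> real"
  define c where "c = \<kappa> * \<delta> ^ (DIM('a) + 2)"
  define S where "S = (LBINT h. ?k h)"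
  have S: "S = \<delta> ^ DIM('a) * V" unfolding S_def V_def by (rule integral_indicator_cball_scale[OF \<delta>(1)])
  have c: "0 < c" using \<kappa> \<delta> by (simp add: c_def)
  have k: "bbs ?k" "\<And>x. 0 \<le> ?k x" "\<And>x. ?k (- x) = ?k x" "\<And>x. ?k x \<noteq> 0 \<Longrightarrow> norm x \<le> \<delta>"
    "\<And>v. (LBINT h. ?k h * (h \<bullet> v)\<^sup>2) = c * (norm v)\<^sup>2"
    using \<kappa>(2)[OF \<delta>(1)] by (auto simp: bbs_indicator_cball c_def indicator_def)
  \<comment> \<open>Log-concavity of the indicator at midpoints, which is convexity of the
    ball.\<close>
  have kmid: "?k x * ?k y \<le> (?k ((x + y) /\<^sub>R 2))\<^sup>2" for x y
  proof (cases "norm x \<le> \<delta> \<and> norm y \<le> \<delta>")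
    case True
    then have "norm ((x + y) /\<^sub>R 2) \<le> \<delta>" using norm_triangle_ineq[of x y] by simp
    then show ?thesis by (auto simp: indicator_def)
  qed (auto simp: indicator_def)

  \<comment> \<open>Averaging reaches every level below S - c \<Lambda>/2, and the transfer loses an
    arbitrarily small amount. So \<rho> is the midpoint between S - c \<Lambda>/2 and the target
    \<sigma> = S - c L1/2.\<close>
  define \<rho> where "\<rho> = S - c * (\<Lambda> + L1) / 4"
  define \<sigma> where "\<sigma> = S - c * L1 / 2"
  have \<sigma>: "0 < \<sigma>" "\<sigma> < \<rho>"
  proof -
    have "c * L1 = \<delta> ^ DIM('a) * (\<kappa> * \<delta>\<^sup>2 * L1)" by (simp add: c_def power_add power2_eq_square)
    also have "\<dots> < \<delta> ^ DIM('a) * (2 * V)" using \<delta> by (intro mult_strict_left_mono) auto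
    finally show "0 < \<sigma>" by (simp add: \<sigma>_def S)
    have "c * \<Lambda> < c * L1" using c L1 by simp
    then show "\<sigma> < \<rho>" unfolding \<sigma>_def \<rho>_def distrib_left by argo
  qed
  note bf = smooth_bbs(1)[OF f(1,2)] and bg = smooth_bbs(1)[OF g(1,2)]
  have avg: "(LBINT h. ?k h * shift_energy (\<lambda>x. \<bar>v x\<bar>) h) \<le> c * (LBINT x. (norm (gradient v x))\<^sup>2)"
    if "smooth v" "bounded {x. v x \<noteq> 0}" for v
  proof -
    note b = smooth_bbs(1)[OF that]
    have "(LBINT h. ?k h * shift_energy (\<lambda>x. \<bar>v x\<bar>) h) \<le> (LBINT h. ?k h * shift_energy v h)"
      by (intro integral_mono bbs_integrable bbs_mult_shift_energy k bbs_abs b mult_left_mono shift_energy_abs_le)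
    also have "\<dots> \<le> c * (LBINT x. (norm (gradient v x))\<^sup>2)"
      by (rule average_shift_energy_le[OF that k(5,1,2)])
    finally show ?thesis .
  qed
  have \<rho>_less: "\<rho> < (LBINT h. ?k h) - ((LBINT h. ?k h * shift_energy (\<lambda>x. \<bar>f x\<bar>) h)
      + (LBINT h. ?k h * shift_energy (\<lambda>x. \<bar>g x\<bar>) h)) / 2"
  proof -
    have "c * \<Lambda> < c * L1" using c L1 by simp
    moreover have "(LBINT h. ?k h * shift_energy (\<lambda>x. \<bar>f x\<bar>) h)
        + (LBINT h. ?k h * shift_energy (\<lambda>x. \<bar>g x\<bar>) h) \<le> c * \<Lambda>"
      unfolding \<Lambda>_def distrib_left by (intro add_mono avg f g)
    ultimately show ?thesis
      unfolding S_def[symmetric] \<rho>_def distrib_left by argo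
  qed
  have sq: "(LBINT x. \<bar>f x\<bar>\<^sup>2) = 1" "(LBINT x. \<bar>g x\<bar>\<^sup>2) = 1" using f g by simp_all
  obtain x where x: "0 < (LBINT y. (\<bar>f y\<bar> * \<bar>g (y - x)\<bar>)\<^sup>2)"
    "\<rho> * (LBINT y. (\<bar>f y\<bar> * \<bar>g (y - x)\<bar>)\<^sup>2)
      \<le> (LBINT y. (\<bar>f y\<bar> * \<bar>g (y - x)\<bar>) * conv ?k (\<lambda>y. \<bar>f y\<bar> * \<bar>g (y - x)\<bar>) y)"
    by (rule Lieb_translation[OF k(1,2) bbs_abs[OF bf] bbs_abs[OF bg] sq \<rho>_less]) (rule that)
  let ?u = "\<lambda>y. \<bar>f y\<bar> * \<bar>g (y - x)\<bar>"
  define K1 where "K1 = A \<inter> (+) x ` B"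
  have K1: "compact K1" using A B unfolding K1_def by (intro compact_Int compact_translation)
  \<comment> \<open>The unknown translation x cancels in y - y', so symmetry and convexity apply to
    B as they do to A.\<close>
  have mid: "(y - y') /\<^sub>R 2 \<in> K0" if y: "y \<in> K1" "y' \<in> K1" for y y'
  proof -
    have *: "(z - z') /\<^sub>R 2 \<in> T" if "convex T" "\<And>x. x \<in> T \<Longrightarrow> - x \<in> T" "z \<in> T" "z' \<in> T" for T :: "'a set" and z z'
      using convexD[OF that(1,3) that(2)[OF that(4)], of "1/2" "1/2"] by (simp add: scaleR_diff_right)
    obtain z z' where z: "y = x + z" "y' = x + z'" "z \<in> B" "z' \<in> B" using y by (auto simp: K1_def)
    have "(y - y') /\<^sub>R 2 \<in> A" using y A by (intro *) (auto simp: K1_def)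
    moreover have "(y - y') /\<^sub>R 2 \<in> B" using *[OF B(2,3) z(3,4)] z by simp
    ultimately show ?thesis by (simp add: K0_def)
  qed
  have u: "bbs ?u" "\<And>y. 0 \<le> ?u y" "\<And>y. y \<notin> K1 \<Longrightarrow> ?u y = 0"
  proof -
    show "bbs ?u" using bbs_abs[OF bf] bbs_translate[OF bbs_abs[OF bg], of x] by (rule bbs_mult)
    show "?u y = 0" if "y \<notin> K1" for y
    proof (rule ccontr)
      assume "?u y \<noteq> 0"
      then have "y \<in> A" "y - x \<in> B" using f(3) g(3) by auto
      then have "y \<in> K1" unfolding K1_def by (auto intro!: image_eqI[of _ _ "y - x"])
      with that show False ..
    qed
  qed simp
  obtain w where w: "bbs w" "\<And>x. x \<notin> K0 \<Longrightarrow> w x = 0" "0 < (LBINT x. (w x)\<^sup>2)"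
      "\<sigma> * (LBINT x. (w x)\<^sup>2) \<le> (LBINT x. w x * conv ?k w x)"
    by (rule conv_Rayleigh_transfer[OF k(1,2) kmid k(3) K0 K1 mid u x \<sigma>]) (assumption+, rule that)
  define W where "W = (norm2 w)\<^sup>2"
  have W: "W = (LBINT x. (w x)\<^sup>2)" "0 < W" "0 < norm2 w"
    using w(3) norm2_nonneg[of w] by (auto simp: W_def norm2_square norm2_def)
  \<comment> \<open>The Rayleigh bound read as a bound on the averaged energy: S - \<sigma> is c
    L1/2.\<close>
  have Xw: "(LBINT h. ?k h * shift_energy w h) \<le> c * L1 * W"
  proof -
    have "\<sigma> * W \<le> S * W - (LBINT h. ?k h * shift_energy w h) / 2"
      using w(4) unfolding conv_inner_shift_energy[OF k(1) w(1)] W(1)[symmetric] S_def[symmetric] .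
    then show ?thesis by (simp add: \<sigma>_def left_diff_distrib)
  qed

  let ?g = "conv ?\<phi> w"
  have b_g: "bbs ?g" by (intro bbs_conv bbs\<phi> w)
  have "(norm2 (\<lambda>x. w x - ?g x))\<^sup>2 \<le> (C * \<eta>)\<^sup>2 * W"
  proof -
    have "(norm2 (\<lambda>x. w x - ?g x))\<^sup>2 \<le> (LBINT y. ?\<phi> y * shift_energy w y)"
      using \<phi>(3,4)[OF \<eta>(1)] by (intro norm2_diff_conv_le bbs\<phi> w) auto
    also have "\<dots> \<le> (LBINT y. M / \<eta> ^ DIM('a) * (indicator (cball 0 \<eta>) y * shift_energy w y))"
    proof (rule integral_mono)
      show "integrable lborel (\<lambda>y. ?\<phi> y * shift_energy w y)"
        by (intro bbs_integrable bbs_mult_shift_energy bbs\<phi> w)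
      show "integrable lborel (\<lambda>y. M / \<eta> ^ DIM('a) * (indicator (cball 0 \<eta>) y * shift_energy w y))"
        by (intro bbs_integrable bbs_cmult bbs_mult_shift_energy bbs_indicator_cball w)
      fix y
      have "?\<phi> y \<le> M / \<eta> ^ DIM('a) * indicator (cball 0 \<eta>) y"
        using \<phi>(2)[OF \<eta>(1), of y] \<phi>(5)[OF \<eta>(1), of y] \<eta>(1) M by (cases "?\<phi> y = 0") (auto simp: field_simps)
      from mult_right_mono[OF this shift_energy_nonneg[of w y]]
      show "?\<phi> y * shift_energy w y \<le> M / \<eta> ^ DIM('a) * (indicator (cball 0 \<eta>) y * shift_energy w y)"
        by (simp add: mult.assoc)
    qed
    also have "\<dots> = M / \<eta> ^ DIM('a) * (LBINT y. indicator (cball 0 \<eta>) y * shift_energy w y)"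
      by (rule integral_mult_right_zero)
    also have "\<dots> \<le> M / \<eta> ^ DIM('a) * (real N ^ (DIM('a) + 2) * (c * L1 * W))"
    proof (rule mult_left_mono)
      have "(LBINT y. indicator (cball 0 \<eta>) y * shift_energy w y)
          \<le> real N ^ (DIM('a) + 2) * (LBINT h. ?k h * shift_energy w h)"
        unfolding \<delta>(3) using N by (intro average_shift_energy_of_nat w \<delta>) simp
      also have "\<dots> \<le> real N ^ (DIM('a) + 2) * (c * L1 * W)" using Xw by (rule mult_left_mono) simp
      finally show "(LBINT y. indicator (cball 0 \<eta>) y * shift_energy w y)
        \<le> real N ^ (DIM('a) + 2) * (c * L1 * W)" .
    qed (use M \<eta> in simp)
    \<comment> \<open>The power of N lost in passing from radius \<delta> to \<eta> is exactly
      absorbed by c, so N and \<delta> disappear and a factor \<eta>^2 is left.\<close>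
    also have "\<dots> = M / \<eta> ^ DIM('a) * (\<kappa> * \<eta> ^ (DIM('a) + 2) * L1 * W)"
      by (simp add: c_def \<delta>(3) power_mult_distrib)
    also have "\<dots> = (C * \<eta>)\<^sup>2 * W"
      unfolding power_mult_distrib C(2) using \<eta>(1) by (simp add: power_add power2_eq_square)
    finally show ?thesis .
  qed
  also have "\<dots> = (C * \<eta> * norm2 w)\<^sup>2" by (simp add: W_def power_mult_distrib)
  finally have close: "norm2 (\<lambda>x. w x - ?g x) \<le> C * \<eta> * norm2 w"
    by (rule power2_le_imp_le) (use C \<eta> W in simp)
  have norm_g: "\<theta> * norm2 w \<le> norm2 ?g"
  proof -
    have "norm2 w = norm2 (\<lambda>x. (w x - ?g x) + ?g x)" by simp
    also have "\<dots> \<le> norm2 (\<lambda>x. w x - ?g x) + norm2 ?g" by (intro norm2_triangle bbs_diff w b_g)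
    finally have "(1 - C * \<eta>) * norm2 w \<le> norm2 ?g" using close by (simp add: left_diff_distrib)
    moreover have "\<theta> * norm2 w \<le> (1 - C * \<eta>) * norm2 w" using \<eta> W by (intro mult_right_mono) auto
    ultimately show ?thesis by linarith
  qed
  have "0 < \<theta> * norm2 w" using \<theta> W by simp
  then have g_pos: "0 < norm2 ?g" using norm_g by linarith
  have iso: "isotropic_kernel ?k \<delta> c"
    unfolding isotropic_kernel_def by (intro conjI allI impI k)
  have "c * (LBINT x. (norm (gradient ?g x))\<^sup>2) \<le> c * (\<theta>\<^sup>2 * L * W)"
  proof -
    have "c * (LBINT x. (norm (gradient ?g x))\<^sup>2)
        \<le> (1 + s) * (LBINT h. ?k h * shift_energy ?g h) + (1 + 1 / s) * e\<^sup>2 * (norm2 w)\<^sup>2 * (real DIM('a) * c)"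
      by (rule d(2)[OF \<delta>(2) iso w(1)])
    also have "\<dots> \<le> (1 + s) * (c * L1 * W) + (1 + 1 / s) * e\<^sup>2 * (norm2 w)\<^sup>2 * (real DIM('a) * c)"
    proof (intro add_right_mono mult_left_mono)
      have "(LBINT h. ?k h * shift_energy ?g h) \<le> (LBINT h. ?k h * shift_energy w h)"
      proof (intro integral_mono bbs_integrable bbs_mult_shift_energy k b_g w mult_left_mono)
        show "shift_energy ?g h \<le> shift_energy w h" for h
          using shift_energy_conv_le[OF bbs\<phi> w(1), of h] \<phi>(3,4)[OF \<eta>(1)] by simp
      qed
      with Xw show "(LBINT h. ?k h * shift_energy ?g h) \<le> c * L1 * W" by linarith
    qed (use \<gamma> in simp)
    also have "\<dots> = c * (((1 + s) * L1 + (1 + 1 / s) * e\<^sup>2 * DIM('a)) * W)"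
      by (simp add: W_def algebra_simps)
    also have "(1 + s) * L1 + (1 + 1 / s) * e\<^sup>2 * DIM('a) = \<theta>\<^sup>2 * L"
      unfolding sL e(2) by (simp add: \<gamma>_def)
    finally show ?thesis .
  qed
  then have "(LBINT x. (norm (gradient ?g x))\<^sup>2) \<le> L * (\<theta> * norm2 w)\<^sup>2"
    using c by (simp add: W_def power_mult_distrib mult_ac)
  also have "\<dots> \<le> L * (norm2 ?g)\<^sup>2"
    using norm_g \<open>0 < \<theta> * norm2 w\<close> L1 by (intro mult_left_mono power_mono) auto
  finally have Rayleigh: "(LBINT x. (norm (gradient ?g x))\<^sup>2) \<le> L * (LBINT x. (?g x)\<^sup>2)"
    by (simp add: norm2_square)

  have "?g \<in> test_functions D"
  proof -
    let ?T = "{y + z | y z. y \<in> K0 \<and> z \<in> cball 0 \<eta>}"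
    have T: "compact ?T" by (intro compact_sums K0) auto
    have "{x. ?g x \<noteq> 0} \<subseteq> ?T"
    proof
      fix x assume "x \<in> {x. ?g x \<noteq> 0}"
      then have "(\<lambda>y. ?\<phi> y * w (x - y)) \<noteq> (\<lambda>_. 0)" by (auto simp: conv_def)
      then obtain y where "?\<phi> y \<noteq> 0" "w (x - y) \<noteq> 0" by (auto simp: fun_eq_iff)
      then have "x - y \<in> K0" "y \<in> cball 0 \<eta>" using w(2) \<phi>(2)[OF \<eta>(1)] by auto
      then show "x \<in> ?T" by (intro CollectI exI[of _ "x - y"] exI[of _ y]) auto
    qed
    then have cl: "closure {x. ?g x \<noteq> 0} \<subseteq> ?T"
      using T by (intro closure_minimal compact_imp_closed)
    have "?T \<subseteq> (\<Union>x\<in>K0. cball x \<eta>0)" using \<eta>(2) by (force simp: dist_norm)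
    then have "?T \<subseteq> D" using \<eta>0 by blast
    moreover have "compact (closure {x. ?g x \<noteq> 0})"
      using b_g unfolding compact_closure bbs_def by blast
    ultimately show ?thesis
      using cl smooth_conv[OF s\<phi> b\<phi> w(1)] by (auto simp: test_functions_def)
  qed
  then have "lambda1 D \<le> ereal L"
    using Rayleigh g_pos by (intro lambda1_le_Rayleigh) (auto simp: norm2_def)
  then show "lambda1 D \<le> ereal ?\<Lambda> + ereal \<epsilon>" by (simp add: L_def \<Lambda>_def)
qed

text \<open>The open sets are replaced by the convex hulls of the supports and their reflections:
  these are compact, convex and symmetric and stay inside A and B because A and B are convex and
  symmetric.\<close>

lemma lambda1_Int_le_test_functions:
  fixes A B :: "'a::euclidean_space set"
  assumes A: "open A" "convex A" "A = uminus ` A" and B: "open B" "convex B" "B = uminus ` B"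
    and f: "f \<in> test_functions A" "(LINT x:A|lborel. (f x)\<^sup>2) = 1"
    and g: "g \<in> test_functions B" "(LINT x:B|lborel. (g x)\<^sup>2) = 1"
  shows "lambda1 (A \<inter> B) \<le> ereal (LINT x:A|lborel. (norm (gradient f x))\<^sup>2) + ereal (LINT x:B|lborel. (norm (gradient g x))\<^sup>2)"
proof -
  define H where "H v = convex hull (closure {x. v x \<noteq> 0} \<union> uminus ` closure {x. v x \<noteq> 0})" for v :: "'a \<Rightarrow> real"
  have H: "compact (H v)" "convex (H v)" "\<And>x. x \<in> H v \<Longrightarrow> - x \<in> H v" "\<And>x. v x \<noteq> 0 \<Longrightarrow> x \<in> H v" "H v \<subseteq> T"
    if T: "convex T" "T = uminus ` T" and v: "v \<in> test_functions T" for v T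
  proof -
    let ?S = "closure {x. v x \<noteq> 0}"
    have S: "compact ?S" "?S \<subseteq> T" using v by (auto simp: test_functions_def)
    have "compact (uminus ` ?S)" by (intro compact_continuous_image S continuous_intros)
    then show "compact (H v)" unfolding H_def by (intro compact_convex_hull compact_Un S)
    show "convex (H v)" unfolding H_def by (rule convex_convex_hull)
    have "uminus ` H v = H v"
      unfolding H_def by (subst convex_hull_linear_image) (auto simp: image_Un image_image linear_uminus Un_commute)
    then show "- x \<in> H v" if "x \<in> H v" for x using that by blast
    show "x \<in> H v" if "v x \<noteq> 0" for x
      using that closure_subset[of "{x. v x \<noteq> 0}"] unfolding H_def by (intro hull_inc) auto
    have "uminus ` ?S \<subseteq> T" using S(2) T(2) by blast
    then show "H v \<subseteq> T" unfolding H_def using S T by (intro hull_minimal) auto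
  qed
  note Hf = H[OF A(2,3) f(1)] and Hg = H[OF B(2,3) g(1)]
  have cl: "closure {x. f x \<noteq> 0} \<subseteq> A" "closure {x. g x \<noteq> 0} \<subseteq> B" and sm: "smooth f" "smooth g"
    using f g by (auto simp: test_functions_def)
  note eq = set_integral_test_function[OF cl(1)] set_integral_test_function[OF cl(2)]
  have "lambda1 (A \<inter> B) \<le> ereal ((LBINT x. (norm (gradient f x))\<^sup>2) + (LBINT x. (norm (gradient g x))\<^sup>2))"
    by (rule lambda1_Int_le_gradient_energy[where A="H f" and B="H g"])
      (use sm f g A B Hf Hg eq test_function_bounded in \<open>auto intro: open_Int\<close>)
  then show ?thesis by (simp add: eq)
qed

theorem corollary6p2:
  fixes A B :: "(real ^ 'n) set"
  assumes "open A" and "convex A" and "A = uminus ` A" and "A \<noteq> UNIV"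
    and "open B" and "convex B" and "B = uminus ` B" and "B \<noteq> UNIV"
  shows "lambda1 (A \<inter> B) \<le> lambda1 A + lambda1 B"
proof (rule ereal_le_epsilon2)
  fix e :: real assume e: "0 < e"
  \<comment> \<open>This excludes the value -\<infinity>, so that adding e/2 to a value below
    \<infinity> increases it strictly and a near-minimizing test function exists.\<close>
  have nonneg: "0 \<le> lambda1 D" for D :: "(real ^ 'n) set"
    unfolding lambda1_def set_lebesgue_integral_def
    by (intro Inf_greatest) (auto intro!: integral_nonneg_AE)
  have near: "\<exists>f. f \<in> test_functions D \<and> (LINT x:D|lborel. (f x)\<^sup>2) = 1 \<and>
      ereal (LINT x:D|lborel. (norm (gradient f x))\<^sup>2) < lambda1 D + ereal (e / 2)"
    if "lambda1 D < \<infinity>" for D :: "(real ^ 'n) set"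
  proof -
    have "lambda1 D < lambda1 D + ereal (e / 2)"
      using that nonneg[of D] e by (cases "lambda1 D") auto
    then show ?thesis unfolding lambda1_def Inf_less_iff by blast
  qed
  show "lambda1 (A \<inter> B) \<le> lambda1 A + lambda1 B + ereal e"
  proof (cases "lambda1 A = \<infinity> \<or> lambda1 B = \<infinity>")
    case False
    then obtain f g where f: "f \<in> test_functions A" "(LINT x:A|lborel. (f x)\<^sup>2) = 1"
        "ereal (LINT x:A|lborel. (norm (gradient f x))\<^sup>2) < lambda1 A + ereal (e / 2)"
      and g: "g \<in> test_functions B" "(LINT x:B|lborel. (g x)\<^sup>2) = 1"
        "ereal (LINT x:B|lborel. (norm (gradient g x))\<^sup>2) < lambda1 B + ereal (e / 2)"
      using near[of A] near[of B] by (auto simp: less_top[symmetric])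
    have "lambda1 (A \<inter> B) \<le> ereal (LINT x:A|lborel. (norm (gradient f x))\<^sup>2) + ereal (LINT x:B|lborel. (norm (gradient g x))\<^sup>2)"
      by (rule lambda1_Int_le_test_functions[OF assms(1-3) assms(5-7) f(1,2) g(1,2)])
    also have "\<dots> \<le> (lambda1 A + ereal (e / 2)) + (lambda1 B + ereal (e / 2))"
      using f(3) g(3) by (intro add_mono) auto
    also have "\<dots> = lambda1 A + lambda1 B + ereal e"
      using False nonneg[of A] nonneg[of B] by (cases "lambda1 A"; cases "lambda1 B") auto
    finally show ?thesis .
  qed auto
qed

end
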